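(* Fix a positive integer $T$ and $\epsilon>0$. There exists $\delta>0$ such that the integrality gap of $n^{\delta}$ rounds of the Sherali–Adams hierarchy for Generalized Max-Dicut($T$) is at most $\frac{T+1}{4T}(1+\epsilon)$. Furthermore, the same holds even when the directed graph of the instance is acyclic.
   Context: Generalized Max-Dicut($T$): an instance is a directed graph $D=(V,A)$ with edge labels $l_A:A\to\{1,\dots,T\}$ and weights $w:A\to\mathbb{R}^+$ summing to $1$; a labeling $l_V:V\to\{0,\dots,T\}$ satisfies $(u,v)$ iff $l_V(u)=0$ and $l_V(v)=l_A(u,v)$; $\mathsf{Opt}$ is the maximum total weight of satisfied edges. The $r$-round Sherali–Adams relaxation has variables $x_S(\alpha)$ for each vertex set $S$, $|S|\le r$, and $\alpha\in\{0,\dots,T\}^S$, with $x_S(\alpha)\ge0$, $\sum_\alpha x_S(\alpha)=1$, and $\sum_{\alpha\in\{0,\dots,T\}^{S'\setminus S}}x_{S'}(\alpha\circ\beta)=x_S(\beta)$ for $S\subseteq S'$; its objective is $\sum_{(u,v)\in A}w(u,v)\,x_{\{u,v\}}(0,l_A(u,v))$. The integrality gap is the integral optimum divided by the relaxation optimum; the claim is that for arbitrarily large $n$ there exist instances on $n$ vertices with gap at most the stated bound. *)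

theory Defs
  imports Complex_Main "HOL-Library.FuncSet"
begin

record 'v gmd_instance =
  verts :: "'v set"
  arcs :: "('v \<times> 'v) set"
  elabel :: "'v \<times> 'v \<Rightarrow> nat"
  weight :: "'v \<times> 'v \<Rightarrow> real"

(* Loops are excluded: they could never be satisfied, and the local assignment
   (0, l_A(u,v)) on {u,v} only makes sense for distinct u and v. *)
definition gmd_instance :: "nat \<Rightarrow> 'v gmd_instance \<Rightarrow> bool" where
  "gmd_instance T I \<longleftrightarrow>
     finite (verts I) \<and>
     arcs I \<subseteq> verts I \<times> verts I \<and>
     irrefl (arcs I) \<and>
     elabel I \<in> arcs I \<rightarrow> {1..T} \<and>
     (\<forall>a\<in>arcs I. weight I a > 0) \<and>
     (\<Sum>a\<in>arcs I. weight I a) = 1"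

definition assignments :: "nat \<Rightarrow> 'v set \<Rightarrow> ('v \<Rightarrow> nat) set" where
  "assignments T S = S \<rightarrow>\<^sub>E {0..T}"

definition satisfies :: "'v gmd_instance \<Rightarrow> ('v \<Rightarrow> nat) \<Rightarrow> 'v \<times> 'v \<Rightarrow> bool" where
  "satisfies I f a \<longleftrightarrow> f (fst a) = 0 \<and> f (snd a) = elabel I a"

definition gmd_value :: "'v gmd_instance \<Rightarrow> ('v \<Rightarrow> nat) \<Rightarrow> real" where
  "gmd_value I f = (\<Sum>a\<in>{a \<in> arcs I. satisfies I f a}. weight I a)"

definition gmd_opt :: "nat \<Rightarrow> 'v gmd_instance \<Rightarrow> real" where
  "gmd_opt T I = Max (gmd_value I ` assignments T (verts I))"

(* x S \<alpha> is the variable x_S(\<alpha>); its values are irrelevant unless S is a set of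
   at most r vertices and \<alpha> is an (extensional) assignment on S.
   The function override_on \<alpha> \<beta> S agrees with \<beta> on S and with \<alpha> elsewhere, so for
   \<alpha> on S' - S and \<beta> on S it is the combined assignment on S'. *)
definition sa_feasible ::
  "nat \<Rightarrow> nat \<Rightarrow> 'v gmd_instance \<Rightarrow> ('v set \<Rightarrow> ('v \<Rightarrow> nat) \<Rightarrow> real) \<Rightarrow> bool" where
  "sa_feasible T r I x \<longleftrightarrow>
     (\<forall>S. S \<subseteq> verts I \<and> card S \<le> r \<longrightarrow>
        (\<forall>\<alpha>\<in>assignments T S. x S \<alpha> \<ge> 0) \<and>
        (\<Sum>\<alpha>\<in>assignments T S. x S \<alpha>) = 1) \<and>
     (\<forall>S S'. S \<subseteq> S' \<and> S' \<subseteq> verts I \<and> card S' \<le> r \<longrightarrow>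
        (\<forall>\<beta>\<in>assignments T S.
           (\<Sum>\<alpha>\<in>assignments T (S' - S). x S' (override_on \<alpha> \<beta> S)) = x S \<beta>))"

definition arc_assignment :: "'v gmd_instance \<Rightarrow> 'v \<times> 'v \<Rightarrow> 'v \<Rightarrow> nat" where
  "arc_assignment I a =
     (\<lambda>z\<in>{fst a, snd a}. if z = fst a then 0 else elabel I a)"

definition sa_objective ::
  "'v gmd_instance \<Rightarrow> ('v set \<Rightarrow> ('v \<Rightarrow> nat) \<Rightarrow> real) \<Rightarrow> real" where
  "sa_objective I x =
     (\<Sum>a\<in>arcs I. weight I a * x {fst a, snd a} (arc_assignment I a))"

(* Meaningful for r \<ge> 2 only: for smaller r the variables on pairs are unconstrained,
   and the supremum is taken over an unbounded set. *)
definition sa_opt :: "nat \<Rightarrow> nat \<Rightarrow> 'v gmd_instance \<Rightarrow> real" where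
  "sa_opt T r I = (SUP x\<in>{x. sa_feasible T r I x}. sa_objective I x)"

definition integrality_gap :: "nat \<Rightarrow> nat \<Rightarrow> 'v gmd_instance \<Rightarrow> real" where
  "integrality_gap T r I = gmd_opt T I / sa_opt T r I"

(* A real bound card S \<le> n powr \<delta> is the same as card S \<le> sa_rounds \<delta> n. *)
definition sa_rounds :: "real \<Rightarrow> nat \<Rightarrow> nat" where
  "sa_rounds \<delta> n = nat \<lfloor>real n powr \<delta>\<rfloor>"

end

theory Submission
  imports Defs "HOL-Probability.Probability"
begin

text \<open>
  The base instance consists of linearly many random labelled arcs on \<open>n\<close> vertices, with one arc
  deleted from each short cycle, so that the girth is of order \<open>log n\<close>. Replacing each vertex by
  many layers and putting the arcs between nearby layers in increasing direction makes it acyclic, and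
  no labelling does much better than \<open>1/(4T)\<close>: quasirandomness reduces the value to an average of
  \<open>p a * (1 - p b) / T\<close> over nearby layers \<open>a < b\<close>, where \<open>p\<close> is the density of the label 0.

  On a tree one could satisfy a fraction \<open>1/(T + 1)\<close> of the arcs: choose a uniform label of the root
  modulo \<open>q = T + 1\<close> and propagate it by adding the arc labels. This is imitated on sets of
  \<open>n powr \<delta>\<close> vertices by Gaussians indexed by pairs (vertex, label), with covariance \<open>\<rho> ^ d\<close>
  at distance \<open>d < l\<close> in the \<open>q\<close>-fold lift of the graph and 0 at larger distance. This kernel is
  locally positive: on the union of the short paths between the given points, the probability of being
  connected by percolation with parameter \<open>\<rho>\<close> is a positive kernel, and it differs from
  \<open>\<rho> ^ d\<close> by at most \<open>\<rho> ^ l\<close> times the number of points, as an open path with \<open>l\<close>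
  edges is determined by its ends. The error is absorbed by a small multiple of the identity.

  Only the trigonometric moments of the Gaussians are used: a bit with conditional mean
  \<open>(1 + cos g) / 2\<close> has a joint law that is a finite combination of exponentials of the
  covariance, hence consistent for different vertex sets. A vertex counts many such bits for each
  label and compares the counts with a random threshold shared by all vertices; if exactly one label
  passes, the vertex takes it, and otherwise it waits for the next independent round.
\<close>

section \<open>Positive kernels and pseudo-random bits\<close>

text \<open>Two probabilities are played against each other. The chance that a vertex finds its
  label in one round is bounded below in terms of \<open>T\<close> alone, because the Gaussians of
  its different labels are uncorrelated and have variance at least 1. The chance that the two ends
  of an arc behave differently in a round tends to 0 as the correlation along the lift tends to 1
  and the number of bits grows. So the number of rounds can be fixed before the correlation is. The
  obstacle is positivity: \<open>\<rho> ^ d\<close> is a positive kernel on a tree but need not be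
  one on a graph with cycles, and on a set of points its truncation has a defect bounded by the cube
  of their number times \<open>l * \<rho> ^ l\<close>. As \<open>l\<close> is proportional to the
  logarithm of the number of vertices, a small power of that number is affordable, and this fixes
  \<open>\<delta>\<close>. The ratio in the theorem compares \<open>1 / (4 * T)\<close>, which
  reflects \<open>p * (1 - p) \<le> 1/4\<close>, with \<open>1 / (T + 1)\<close>.\<close>

inductive pos_kernel :: "('a \<Rightarrow> 'a \<Rightarrow> real) \<Rightarrow> bool" where
  zero: "pos_kernel (\<lambda>x y. 0)"
| add_square: "pos_kernel K \<Longrightarrow> pos_kernel (\<lambda>x y. K x y + f x * f y)"

lemma pos_kernel_square: "pos_kernel (\<lambda>x y. f x * f y)"
  using add_square[OF zero, of f] by simp

lemma pos_kernel_add: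
  assumes "pos_kernel K" "pos_kernel L"
  shows "pos_kernel (\<lambda>x y. K x y + L x y)"
  using assms(2)
proof (induction)
  case zero
  then show ?case using assms(1) by simp
next
  case (add_square L f)
  from pos_kernel.add_square[OF add_square.IH, of f] show ?case by (simp add: add.assoc)
qed

lemma pos_kernel_mult_square:
  assumes "pos_kernel K" shows "pos_kernel (\<lambda>x y. K x y * (f x * f y))"
  using assms
proof (induction)
  case zero
  then show ?case using pos_kernel.zero by simp
next
  case (add_square K g)
  from pos_kernel.add_square[OF add_square.IH, of "\<lambda>x. g x * f x"] show ?case
    by (simp add: algebra_simps)
qed

text \<open>Schur product theorem. The inductive definition by finite sums of rank-one terms reduces
  it to multiplication by a single square, which rescales every vector of the other
  decomposition.\<close>

lemma pos_kernel_mult: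
  assumes "pos_kernel K" "pos_kernel L"
  shows "pos_kernel (\<lambda>x y. K x y * L x y)"
  using assms(2)
proof (induction)
  case zero
  then show ?case using pos_kernel.zero by simp
next
  case (add_square L f)
  from pos_kernel_add[OF add_square.IH pos_kernel_mult_square[OF assms(1), of f]]
  show ?case by (simp add: algebra_simps)
qed

lemma pos_kernel_scale:
  assumes "pos_kernel K" "0 \<le> c"
  shows "pos_kernel (\<lambda>x y. c * K x y)"
  using pos_kernel_mult_square[OF assms(1), of "\<lambda>_. sqrt c"] assms(2) by (simp add: mult.commute)

lemma pos_kernel_sum:
  assumes "finite I" "\<And>i. i \<in> I \<Longrightarrow> pos_kernel (K i)"
  shows "pos_kernel (\<lambda>x y. \<Sum>i\<in>I. K i x y)"
  using assms
proof (induction I rule: finite_induct)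
  case empty
  then show ?case using pos_kernel.zero by simp
next
  case (insert i I)
  then show ?case using pos_kernel_add[of "K i" "\<lambda>x y. \<Sum>i\<in>I. K i x y"] by simp
qed

lemma pos_kernel_pullback:
  assumes "pos_kernel K" shows "pos_kernel (\<lambda>x y. K (h x) (h y))"
  using assms
proof (induction)
  case zero
  then show ?case using pos_kernel.zero by simp
next
  case (add_square K f)
  from pos_kernel.add_square[OF add_square.IH, of "\<lambda>x. f (h x)"] show ?case by simp
qed

lemma pos_kernel_power: 
  assumes "pos_kernel K" shows "pos_kernel (\<lambda>x y. K x y ^ n)"
proof (induction n)
  case 0
  then show ?case using pos_kernel_square[of "\<lambda>_. 1"] by simp
next
  case (Suc n)
  then show ?case using pos_kernel_mult[OF assms Suc] by simp
qed

lemma pos_kernel_quadratic_form: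
  assumes "pos_kernel K"
  shows "0 \<le> (\<Sum>x\<in>I. \<Sum>y\<in>I. d x * d y * K x y)"
  using assms
proof (induction)
  case zero
  then show ?case by simp
next
  case (add_square K f)
  have "(\<Sum>x\<in>I. \<Sum>y\<in>I. d x * d y * (f x * f y)) = (\<Sum>x\<in>I. d x * f x)\<^sup>2"
    by (simp add: power2_eq_square sum_product mult_ac)
  then show ?case using add_square.IH
    by (simp add: distrib_left sum.distrib)
qed

text \<open>Termwise in the power series of \<open>exp\<close>, each entrywise power being positive.
  The result is a quadratic form rather than a \<open>pos_kernel\<close>, because the latter allows
  only finitely many squares.\<close>

lemma pos_kernel_exp_quadratic_form:
  fixes K :: "'a \<Rightarrow> 'a \<Rightarrow> real"
  assumes "pos_kernel K"
  shows "0 \<le> (\<Sum>x\<in>I. \<Sum>y\<in>I. d x * d y * exp (K x y))"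
proof -
  have "(\<lambda>n. \<Sum>x\<in>I. \<Sum>y\<in>I. d x * d y * (K x y ^ n /\<^sub>R fact n)) sums
      (\<Sum>x\<in>I. \<Sum>y\<in>I. d x * d y * exp (K x y))"
    by (intro sums_sum sums_mult exp_converges)
  moreover have "0 \<le> (\<Sum>x\<in>I. \<Sum>y\<in>I. d x * d y * (K x y ^ n /\<^sub>R fact n))" for n
    using pos_kernel_quadratic_form[OF pos_kernel_scale[OF pos_kernel_power[OF assms], of "inverse (fact n)" n], where d=d and I=I]
    by (simp add: mult_ac)
  ultimately show ?thesis by (rule sums_le[OF _ sums_zero, rotated]) 
qed

section \<open>Laws of bits driven by a Gaussian vector\<close>

definition kform :: "('b \<Rightarrow> 'b \<Rightarrow> real) \<Rightarrow> 'b set \<Rightarrow> 'b set \<Rightarrow> real" where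
  "kform Q A A' = (\<Sum>y\<in>A. \<Sum>z\<in>A'. Q y z)"

lemma pos_kernel_kform:
  assumes "pos_kernel K" shows "pos_kernel (kform K)"
  using assms
proof (induction)
  case zero
  then show ?case using pos_kernel.zero by (simp add: kform_def)
next
  case (add_square K f)
  have "kform (\<lambda>x y. K x y + f x * f y) A B = kform K A B + (\<Sum>y\<in>A. f y) * (\<Sum>y\<in>B. f y)" for A B
    by (simp add: kform_def sum.distrib sum_product)
  then have "kform (\<lambda>x y. K x y + f x * f y) = (\<lambda>A B. kform K A B + (\<Sum>y\<in>A. f y) * (\<Sum>y\<in>B. f y))"
    by (intro ext)
  then show ?case using pos_kernel.add_square[OF add_square.IH, of "\<lambda>A. \<Sum>y\<in>A. f y"] by simp
qed

text \<open>For a centred Gaussian vector \<open>g\<close> with covariance \<open>Q\<close>,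
  \<open>kform Q A A'\<close> is the covariance of the sums of \<open>g\<close> over
  \<open>A\<close> and over \<open>A'\<close>, and this is minus half the variance of their
  difference. Its exponential is thus the characteristic function of that difference at 1.\<close>

definition bit_exponent :: "('b \<Rightarrow> 'b \<Rightarrow> real) \<Rightarrow> 'b set \<Rightarrow> 'b set \<Rightarrow> real" where
  "bit_exponent Q A A' = kform Q A A' - (kform Q A A + kform Q A' A') / 2"

text \<open>\<open>bit_weight Q B \<beta>\<close> is the expectation of the product of \<open>(1 \<plusminus> cos (g y)) / 2\<close> over
  \<open>y \<in> B\<close>, with the sign + on \<open>\<beta>\<close>, for a centred Gaussian vector \<open>g\<close> with covariance
  \<open>Q\<close>: write each factor as \<open>\<bar>1 \<plusminus> exp (\<i> g y)\<bar>\<^sup>2 / 4\<close> and expand.\<close>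
definition bit_weight :: "('b \<Rightarrow> 'b \<Rightarrow> real) \<Rightarrow> 'b set \<Rightarrow> 'b set \<Rightarrow> real" where
  "bit_weight Q B \<beta> = (1/4) ^ card B *
     (\<Sum>A\<in>Pow B. \<Sum>A'\<in>Pow B. (-1) ^ card (A - \<beta>) * (-1) ^ card (A' - \<beta>) * exp (bit_exponent Q A A'))"

text \<open>Positivity is a statement about \<open>B\<close> alone, since the covariance used later
  is shown to be positive only on small sets. Symmetry, which the marginal identities use, is
  global.\<close>

definition covariance_on :: "('b \<Rightarrow> 'b \<Rightarrow> real) \<Rightarrow> 'b set \<Rightarrow> bool" where
  "covariance_on Q B \<longleftrightarrow> finite B \<and> (\<forall>x y. Q x y = Q y x) \<and>
     (\<exists>K. pos_kernel K \<and> (\<forall>x\<in>B. \<forall>y\<in>B. Q x y = K x y))"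

lemma covariance_on_subset: "covariance_on Q B \<Longrightarrow> A \<subseteq> B \<Longrightarrow> covariance_on Q A"
  unfolding covariance_on_def by (meson finite_subset subsetD)

text \<open>The signs and the diagonal parts of the exponent split into a factor for
  \<open>A\<close> and one for \<open>A'\<close>, so the double sum is a quadratic form of the
  kernel \<open>exp (kform K A A')\<close> on the subsets of \<open>B\<close>.\<close>

lemma bit_weight_nonneg:
  assumes "covariance_on Q B"
  shows "0 \<le> bit_weight Q B \<beta>"
proof -
  obtain K where K: "pos_kernel K" "\<And>x y. x \<in> B \<Longrightarrow> y \<in> B \<Longrightarrow> Q x y = K x y"
    using assms by (auto simp: covariance_on_def)
  have kf: "kform Q A A' = kform K A A'" if "A \<in> Pow B" "A' \<in> Pow B" for A A'
    unfolding kform_def using that K(2) by (intro sum.cong) auto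
  define d where "d A = (-1) ^ card (A - \<beta>) * exp (- kform K A A / 2)" for A
  have "(\<Sum>A\<in>Pow B. \<Sum>A'\<in>Pow B. (-1) ^ card (A - \<beta>) * (-1) ^ card (A' - \<beta>) * exp (bit_exponent Q A A'))
      = (\<Sum>A\<in>Pow B. \<Sum>A'\<in>Pow B. d A * d A' * exp (kform K A A'))"
    by (intro sum.cong refl) (simp add: d_def bit_exponent_def kf exp_add[symmetric] exp_diff exp_minus field_simps)
  then show ?thesis
    using pos_kernel_exp_quadratic_form[OF pos_kernel_kform[OF K(1)], where d=d and I="Pow B"]
    by (simp add: bit_weight_def)
qed

lemma sum_Pow_insert:
  assumes "finite B" "y \<notin> B"
  shows "(\<Sum>A\<in>Pow (insert y B). g A) = (\<Sum>A\<in>Pow B. g A + g (insert y A))"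
proof -
  have "inj_on (insert y) (Pow B)" using assms(2) by (auto simp: inj_on_def)
  then show ?thesis
    using assms unfolding Pow_insert
    by (subst sum.union_disjoint) (auto simp: sum.reindex sum.distrib)
qed

text \<open>Both Gaussian sums gain the same term, so their difference does not change.\<close>

lemma bit_exponent_insert:
  assumes "finite A" "finite A'" "y \<notin> A" "y \<notin> A'" and sym: "\<And>x y. Q x y = Q y x"
  shows "bit_exponent Q (insert y A) (insert y A') = bit_exponent Q A A'"
proof -
  have l: "kform Q (insert y B) C = (\<Sum>z\<in>C. Q y z) + kform Q B C" if "finite B" "y \<notin> B" for B C
    using that by (simp add: kform_def)
  have r: "kform Q C (insert y B) = (\<Sum>z\<in>C. Q y z) + kform Q C B" if "finite B" "y \<notin> B" for B C
    using that sym by (simp add: kform_def sum.distrib)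
  show ?thesis
    using assms(1-4) by (simp add: bit_exponent_def l r add_divide_distrib)
qed

text \<open>Adding over the two signs at \<open>y\<close> cancels the pairs in which exactly one of
  the two subsets contains \<open>y\<close>. The pairs with \<open>y\<close> in both or in neither
  give four equal terms, which match the factor 1/4.\<close>

lemma bit_weight_insert:
  assumes "finite B" "y \<notin> B" "\<beta> \<subseteq> B" and sym: "\<And>x y. Q x y = Q y x"
  shows "bit_weight Q (insert y B) \<beta> + bit_weight Q (insert y B) (insert y \<beta>) = bit_weight Q B \<beta>"
proof -
  define s where "s \<beta> A = (-1 :: real) ^ card (A - \<beta>)" for A \<beta> :: "'a set"
  have s: "s (insert y \<beta>) A = s \<beta> A" "s \<beta> (insert y A) = - s \<beta> A" "s (insert y \<beta>) (insert y A) = s \<beta> A"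
    if "A \<in> Pow B" for A
  proof -
    have y: "y \<notin> A" "finite A" "y \<notin> \<beta>" using that assms(1-3) by (auto dest: finite_subset)
    show "s (insert y \<beta>) A = s \<beta> A" "s (insert y \<beta>) (insert y A) = s \<beta> A"
      using y by (simp_all add: s_def insert_Diff_if Diff_insert0)
    have "insert y A - \<beta> = insert y (A - \<beta>)" using y by auto
    then show "s \<beta> (insert y A) = - s \<beta> A" using y by (simp add: s_def)
  qed
  have e: "bit_exponent Q (insert y A) (insert y A') = bit_exponent Q A A'" if "A \<in> Pow B" "A' \<in> Pow B" for A A'
    using that assms(1,2) by (intro bit_exponent_insert sym) (auto dest: finite_subset)
  have "(\<Sum>A\<in>Pow (insert y B). \<Sum>A'\<in>Pow (insert y B). s \<beta> A * s \<beta> A' * exp (bit_exponent Q A A')) +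
        (\<Sum>A\<in>Pow (insert y B). \<Sum>A'\<in>Pow (insert y B). s (insert y \<beta>) A * s (insert y \<beta>) A' * exp (bit_exponent Q A A'))
      = (\<Sum>A\<in>Pow B. \<Sum>A'\<in>Pow B. 4 * (s \<beta> A * s \<beta> A' * exp (bit_exponent Q A A')))"
    unfolding sum_Pow_insert[OF assms(1,2)] sum.distrib[symmetric]
    by (intro sum.cong refl) (simp add: s e)
  then have "(\<Sum>A\<in>Pow (insert y B). \<Sum>A'\<in>Pow (insert y B). s \<beta> A * s \<beta> A' * exp (bit_exponent Q A A')) +
        (\<Sum>A\<in>Pow (insert y B). \<Sum>A'\<in>Pow (insert y B). s (insert y \<beta>) A * s (insert y \<beta>) A' * exp (bit_exponent Q A A'))
      = 4 * (\<Sum>A\<in>Pow B. \<Sum>A'\<in>Pow B. (s \<beta> A * s \<beta> A' * exp (bit_exponent Q A A')))"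
    by (simp add: sum_distrib_left)
  moreover have "c / 4 * X + c / 4 * Y = c * Z" if "X + Y = 4 * Z" for c X Y Z :: real
  proof -
    have "c / 4 * X + c / 4 * Y = c / 4 * (X + Y)" by (simp only: distrib_left)
    then show ?thesis using that by simp
  qed
  ultimately have "(1/4) ^ card B / 4 * (\<Sum>A\<in>Pow (insert y B). \<Sum>A'\<in>Pow (insert y B). s \<beta> A * s \<beta> A' * exp (bit_exponent Q A A')) +
      (1/4) ^ card B / 4 * (\<Sum>A\<in>Pow (insert y B). \<Sum>A'\<in>Pow (insert y B). s (insert y \<beta>) A * s (insert y \<beta>) A' * exp (bit_exponent Q A A'))
    = (1/4) ^ card B * (\<Sum>A\<in>Pow B. \<Sum>A'\<in>Pow B. (s \<beta> A * s \<beta> A' * exp (bit_exponent Q A A')))"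
    by blast
  then show ?thesis using assms(1,2)
    unfolding bit_weight_def s_def[symmetric] by simp
qed

lemma sum_bit_weight:
  assumes "finite B" and sym: "\<And>x y. Q x y = Q y x"
  shows "(\<Sum>\<beta>\<in>Pow B. bit_weight Q B \<beta>) = 1"
  using assms(1)
proof (induction B rule: finite_induct)
  case empty
  show ?case by (simp add: bit_weight_def bit_exponent_def kform_def)
next
  case (insert y B)
  then show ?case by (simp add: sum_Pow_insert bit_weight_insert[OF _ _ _ sym])
qed

definition bits :: "('b \<Rightarrow> 'b \<Rightarrow> real) \<Rightarrow> 'b set \<Rightarrow> 'b set pmf" where
  "bits Q B = embed_pmf (\<lambda>\<beta>. if \<beta> \<subseteq> B then bit_weight Q B \<beta> else 0)"

lemma pmf_bits:
  assumes "covariance_on Q B"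
  shows "pmf (bits Q B) \<beta> = (if \<beta> \<subseteq> B then bit_weight Q B \<beta> else 0)"
  unfolding bits_def
proof (rule pmf_embed_pmf)
  show "0 \<le> (if \<beta> \<subseteq> B then bit_weight Q B \<beta> else 0)" for \<beta>
    using bit_weight_nonneg[OF assms] by simp
  have fin: "finite B" and sym: "\<And>x y. Q x y = Q y x"
    using assms by (auto simp: covariance_on_def)
  have "(\<integral>\<^sup>+ x. ennreal (if x \<subseteq> B then bit_weight Q B x else 0) \<partial>count_space UNIV)
      = (\<Sum>x\<in>Pow B. ennreal (bit_weight Q B x))"
    using fin by (subst nn_integral_count_space'[of "Pow B"]) (auto intro!: sum.cong)
  also have "\<dots> = ennreal (\<Sum>x\<in>Pow B. bit_weight Q B x)"
    using bit_weight_nonneg[OF assms] by simp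
  finally show "(\<integral>\<^sup>+ x. ennreal (if x \<subseteq> B then bit_weight Q B x else 0) \<partial>count_space UNIV) = 1"
    using sum_bit_weight[OF fin sym] by simp
qed

lemma set_pmf_bits: "covariance_on Q B \<Longrightarrow> set_pmf (bits Q B) \<subseteq> Pow B"
  by (auto simp: set_pmf_eq pmf_bits split: if_splits)

lemma bits_marginal_insert:
  assumes "covariance_on Q (insert y B)" "y \<notin> B"
  shows "map_pmf (\<lambda>\<beta>. \<beta> \<inter> B) (bits Q (insert y B)) = bits Q B"
proof (rule pmf_eqI)
  fix \<beta>
  have fin: "finite B" and sym: "\<And>x y. Q x y = Q y x"
    using assms by (auto simp: covariance_on_def)
  have cB: "covariance_on Q B" using assms(1) by (rule covariance_on_subset) auto
  have "pmf (map_pmf (\<lambda>\<beta>. \<beta> \<inter> B) (bits Q (insert y B))) \<beta>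
     = measure (bits Q (insert y B)) ((\<lambda>\<beta>. \<beta> \<inter> B) -` {\<beta>})"
    by (simp add: pmf_map)
  also have "\<dots> = measure (bits Q (insert y B)) (((\<lambda>\<beta>. \<beta> \<inter> B) -` {\<beta>}) \<inter> set_pmf (bits Q (insert y B)))"
    by (simp add: measure_Int_set_pmf)
  also have "\<dots> = measure (bits Q (insert y B)) ((((\<lambda>\<beta>. \<beta> \<inter> B) -` {\<beta>}) \<inter> Pow (insert y B)) \<inter> set_pmf (bits Q (insert y B)))"
    using set_pmf_bits[OF assms(1)] by (intro arg_cong[where f="measure _"]) auto
  also have "\<dots> = measure (bits Q (insert y B)) (((\<lambda>\<beta>. \<beta> \<inter> B) -` {\<beta>}) \<inter> Pow (insert y B))"
    by (simp add: measure_Int_set_pmf)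
  also have "((\<lambda>\<beta>. \<beta> \<inter> B) -` {\<beta>}) \<inter> Pow (insert y B) = (if \<beta> \<subseteq> B then {\<beta>, insert y \<beta>} else {})"
    using assms(2) by auto
  also have "measure (bits Q (insert y B)) \<dots> = pmf (bits Q B) \<beta>"
  proof (cases "\<beta> \<subseteq> B")
    case True
    then have "\<beta> \<noteq> insert y \<beta>" using assms(2) by auto
    with True show ?thesis using bit_weight_insert[OF fin assms(2) True sym]
      by (auto simp: measure_measure_pmf_finite pmf_bits[OF assms(1)] pmf_bits[OF cB])
  qed (simp add: pmf_bits[OF cB])
  finally show "pmf (map_pmf (\<lambda>\<beta>. \<beta> \<inter> B) (bits Q (insert y B))) \<beta> = pmf (bits Q B) \<beta>" .
qed

lemma bits_marginal:
  assumes "covariance_on Q C" "B \<subseteq> C"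
  shows "map_pmf (\<lambda>\<beta>. \<beta> \<inter> B) (bits Q C) = bits Q B"
proof -
  have "finite (C - B)" using assms(1) by (simp add: covariance_on_def)
  have "covariance_on Q (D \<union> B) \<Longrightarrow> D \<inter> B = {} \<Longrightarrow> map_pmf (\<lambda>\<beta>. \<beta> \<inter> B) (bits Q (D \<union> B)) = bits Q B"
    if "finite D" for D
    using that
  proof (induction D rule: finite_induct)
    case empty
    then have "map_pmf (\<lambda>\<beta>. \<beta> \<inter> B) (bits Q B) = map_pmf id (bits Q B)"
      using set_pmf_bits[of Q B] by (intro map_pmf_cong) auto
    then show ?case by (simp add: pmf.map_id)
  next
    case (insert y D)
    have "map_pmf (\<lambda>\<beta>. \<beta> \<inter> B) (bits Q (insert y (D \<union> B)))
       = map_pmf (\<lambda>\<beta>. \<beta> \<inter> B) (map_pmf (\<lambda>\<beta>. \<beta> \<inter> (D \<union> B)) (bits Q (insert y (D \<union> B))))"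
      unfolding pmf.map_comp by (intro map_pmf_cong) auto
    also have "\<dots> = map_pmf (\<lambda>\<beta>. \<beta> \<inter> B) (bits Q (D \<union> B))"
      using insert by (subst bits_marginal_insert) auto
    also have "\<dots> = bits Q B"
      using insert by (intro insert.IH) (auto intro: covariance_on_subset)
    finally show ?case by simp
  qed
  moreover have "(C - B) \<inter> B = {}" "C - B \<union> B = C" using assms(2) by auto
  ultimately show ?thesis using assms(1) \<open>finite (C - B)\<close> by metis
qed

lemma prob_bits_marginal:
  assumes "covariance_on Q C" "B \<subseteq> C" "\<And>\<beta>. \<phi> \<beta> = \<psi> (\<beta> \<inter> B)"
  shows "measure_pmf.prob (bits Q C) {\<beta>. \<phi> \<beta>} = measure_pmf.prob (bits Q B) {\<beta>. \<psi> \<beta>}"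
  by (simp add: bits_marginal[OF assms(1,2), symmetric] assms(3) vimage_def)

lemma prob_bits_eq_sum:
  assumes "covariance_on Q B"
  shows "measure_pmf.prob (bits Q B) {\<beta>. \<phi> \<beta>} = (\<Sum>\<beta>\<in>Pow B. bit_weight Q B \<beta> * of_bool (\<phi> \<beta>))"
proof -
  have fin: "finite (Pow B)" using assms by (simp add: covariance_on_def)
  have "measure_pmf.prob (bits Q B) {\<beta>. \<phi> \<beta>} = measure_pmf.prob (bits Q B) ({\<beta>. \<phi> \<beta>} \<inter> set_pmf (bits Q B))"
    by (simp add: measure_Int_set_pmf)
  also have "\<dots> = measure_pmf.prob (bits Q B) ({\<beta>\<in>Pow B. \<phi> \<beta>} \<inter> set_pmf (bits Q B))"
    using set_pmf_bits[OF assms] by (intro arg_cong[where f="measure _"]) auto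
  also have "\<dots> = (\<Sum>\<beta>\<in>{\<beta>\<in>Pow B. \<phi> \<beta>}. bit_weight Q B \<beta>)"
    using fin by (simp add: measure_Int_set_pmf measure_measure_pmf_finite pmf_bits[OF assms])
  also have "\<dots> = (\<Sum>\<beta>\<in>Pow B. bit_weight Q B \<beta> * of_bool (\<phi> \<beta>))"
    using fin by (intro sum.mono_neutral_cong_left) auto
  finally show ?thesis .
qed

lemma sum_Pow_Un:
  assumes "finite B" "finite C" "B \<inter> C = {}"
  shows "(\<Sum>A\<in>Pow (B \<union> C). g A) = (\<Sum>a\<in>Pow B. \<Sum>b\<in>Pow C. g (a \<union> b))"
  using assms(2,3)
proof (induction C arbitrary: g rule: finite_induct)
  case empty
  then show ?case by simp
next
  case (insert y C)
  then show ?case using assms(1)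
    by (simp add: sum_Pow_insert sum.distrib)
qed

text \<open>Uncorrelated Gaussian blocks are independent. Here this is the splitting of
  \<open>kform\<close> over the blocks, which makes the exponents add and the fourfold sum
  factor.\<close>

lemma bit_weight_Un:
  assumes "finite B" "finite C" "B \<inter> C = {}" "\<beta> \<subseteq> B" "\<gamma> \<subseteq> C"
    and sym: "\<And>x y. Q x y = Q y x" and orth: "\<And>x y. x \<in> B \<Longrightarrow> y \<in> C \<Longrightarrow> Q x y = 0"
  shows "bit_weight Q (B \<union> C) (\<beta> \<union> \<gamma>) = bit_weight Q B \<beta> * bit_weight Q C \<gamma>"
proof -
  have k: "kform Q (a \<union> b) (a' \<union> b') = kform Q a a' + kform Q b b'"
    if "a \<in> Pow B" "a' \<in> Pow B" "b \<in> Pow C" "b' \<in> Pow C" for a a' b b'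
  proof -
    have fin: "finite a" "finite b" "finite a'" "finite b'" "a \<inter> b = {}" "a' \<inter> b' = {}"
      using that assms(1-3) by (auto dest: finite_subset)
    have "(\<Sum>y\<in>a. \<Sum>z\<in>b'. Q y z) = 0" using that orth by (intro sum.neutral ballI) (metis PowD subsetD)
    moreover have "(\<Sum>y\<in>b. \<Sum>z\<in>a'. Q y z) = 0" using that orth sym
      by (intro sum.neutral ballI) (metis PowD subsetD)
    ultimately show ?thesis using fin by (simp add: kform_def sum.union_disjoint sum.distrib)
  qed
  have c: "card ((a \<union> b) - (\<beta> \<union> \<gamma>)) = card (a - \<beta>) + card (b - \<gamma>)" if "a \<in> Pow B" "b \<in> Pow C" for a b
  proof -
    have "(a \<union> b) - (\<beta> \<union> \<gamma>) = (a - \<beta>) \<union> (b - \<gamma>)" using that assms(3-5) by auto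
    moreover have "finite (a - \<beta>)" "finite (b - \<gamma>)" "(a - \<beta>) \<inter> (b - \<gamma>) = {}"
      using that assms(1-3) by (auto dest: finite_subset)
    ultimately show ?thesis by (simp add: card_Un_disjoint)
  qed
  define F where "F \<beta> a a' = (-1 :: real) ^ card (a - \<beta>) * (-1) ^ card (a' - \<beta>) * exp (bit_exponent Q a a')" for \<beta> a a'
  have F: "F (\<beta> \<union> \<gamma>) (a \<union> b) (a' \<union> b') = F \<beta> a a' * F \<gamma> b b'"
    if "a \<in> Pow B" "a' \<in> Pow B" "b \<in> Pow C" "b' \<in> Pow C" for a a' b b'
  proof -
    have "bit_exponent Q (a \<union> b) (a' \<union> b') = bit_exponent Q a a' + bit_exponent Q b b'"
      using that by (simp add: bit_exponent_def k field_simps)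
    then show ?thesis using that by (simp add: F_def c exp_add power_add mult_ac)
  qed
  have "(\<Sum>A\<in>Pow (B \<union> C). \<Sum>A'\<in>Pow (B \<union> C). F (\<beta> \<union> \<gamma>) A A')
     = (\<Sum>a\<in>Pow B. \<Sum>b\<in>Pow C. \<Sum>a'\<in>Pow B. \<Sum>b'\<in>Pow C. F \<beta> a a' * F \<gamma> b b')"
    using assms(1-3) by (simp add: sum_Pow_Un F)
  also have "\<dots> = (\<Sum>a\<in>Pow B. \<Sum>a'\<in>Pow B. F \<beta> a a') * (\<Sum>b\<in>Pow C. \<Sum>b'\<in>Pow C. F \<gamma> b b')"
    by (simp add: sum_product)
  finally show ?thesis using assms(1-3)
    unfolding bit_weight_def F_def[symmetric] by (simp add: card_Un_disjoint power_add)
qed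

lemma prob_bits_Un:
  assumes "covariance_on Q (B \<union> C)" "B \<inter> C = {}"
    and orth: "\<And>x y. x \<in> B \<Longrightarrow> y \<in> C \<Longrightarrow> Q x y = 0"
  shows "measure_pmf.prob (bits Q (B \<union> C)) {\<beta>. \<phi> (\<beta> \<inter> B) \<and> \<psi> (\<beta> \<inter> C)}
    = measure_pmf.prob (bits Q B) {\<beta>. \<phi> \<beta>} * measure_pmf.prob (bits Q C) {\<beta>. \<psi> \<beta>}"
proof -
  have cov: "covariance_on Q B" "covariance_on Q C" using assms(1) by (auto intro: covariance_on_subset)
  have fin: "finite B" "finite C" and sym: "\<And>x y. Q x y = Q y x"
    using assms(1) by (auto simp: covariance_on_def)
  have "(a \<union> b) \<inter> B = a" "(a \<union> b) \<inter> C = b" if "a \<in> Pow B" "b \<in> Pow C" for a b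
    using that assms(2) by auto
  then show ?thesis
    unfolding prob_bits_eq_sum[OF assms(1)] prob_bits_eq_sum[OF cov(1)] prob_bits_eq_sum[OF cov(2)]
      sum_Pow_Un[OF fin assms(2)] sum_product
    by (intro sum.cong refl) (simp add: bit_weight_Un[OF fin assms(2) _ _ sym orth])
qed

lemma prob_bits_UN:
  assumes "finite I" "covariance_on Q (\<Union>i\<in>I. B i)" "disjoint_family_on B I"
    and orth: "\<And>i j x y. i \<in> I \<Longrightarrow> j \<in> I \<Longrightarrow> i \<noteq> j \<Longrightarrow> x \<in> B i \<Longrightarrow> y \<in> B j \<Longrightarrow> Q x y = 0"
  shows "measure_pmf.prob (bits Q (\<Union>i\<in>I. B i)) {\<beta>. \<forall>i\<in>I. \<phi> i (\<beta> \<inter> B i)}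
    = (\<Prod>i\<in>I. measure_pmf.prob (bits Q (B i)) {\<beta>. \<phi> i \<beta>})"
  using assms
proof (induction I rule: finite_induct)
  case empty
  then show ?case by simp
next
  case (insert i I)
  have disj: "B i \<inter> (\<Union>i\<in>I. B i) = {}"
    using insert.prems(2) insert.hyps(2) by (auto simp: disjoint_family_on_def)
  have eq: "(\<beta> \<inter> (\<Union>i\<in>I. B i)) \<inter> B j = \<beta> \<inter> B j" if "j \<in> I" for j \<beta> using that by auto
  have "measure_pmf.prob (bits Q (B i \<union> (\<Union>i\<in>I. B i))) {\<beta>. \<phi> i (\<beta> \<inter> B i) \<and> (\<forall>j\<in>I. \<phi> j ((\<beta> \<inter> (\<Union>i\<in>I. B i)) \<inter> B j))}
    = measure_pmf.prob (bits Q (B i)) {\<beta>. \<phi> i \<beta>} *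
      measure_pmf.prob (bits Q (\<Union>i\<in>I. B i)) {\<beta>. \<forall>j\<in>I. \<phi> j (\<beta> \<inter> B j)}"
  proof (rule prob_bits_Un[OF _ disj, where \<psi>="\<lambda>\<beta>. \<forall>j\<in>I. \<phi> j (\<beta> \<inter> B j)"])
    show "covariance_on Q (B i \<union> (\<Union>i\<in>I. B i))" using insert.prems(1) by simp
    show "Q x y = 0" if "x \<in> B i" "y \<in> (\<Union>i\<in>I. B i)" for x y
      using that insert.hyps(2) insert.prems(3)[of i _ x y] by auto
  qed
  also have "measure_pmf.prob (bits Q (\<Union>i\<in>I. B i)) {\<beta>. \<forall>j\<in>I. \<phi> j (\<beta> \<inter> B j)}
    = (\<Prod>i\<in>I. measure_pmf.prob (bits Q (B i)) {\<beta>. \<phi> i \<beta>})"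
    using insert.prems by (intro insert.IH) (auto intro: covariance_on_subset simp: disjoint_family_on_def)
  finally show ?case using insert.hyps by (simp add: eq cong: ball_cong)
qed

text \<open>Invariance under renaming; it makes the law of the bits of one (vertex, label) pair
  independent of the pair.\<close>

lemma bit_weight_image:
  assumes "inj_on f B" "\<beta> \<subseteq> B"
  shows "bit_weight Q (f ` B) (f ` \<beta>) = bit_weight (\<lambda>x y. Q (f x) (f y)) B \<beta>"
proof -
  have P: "(\<Sum>A\<in>Pow (f ` B). g A) = (\<Sum>A\<in>Pow B. g (f ` A))" for g :: "'b set \<Rightarrow> real"
    by (simp add: image_Pow_surj[OF refl, of f B, symmetric] sum.reindex[OF inj_on_image_Pow[OF assms(1)]])
  have k: "kform Q (f ` A) (f ` A') = kform (\<lambda>x y. Q (f x) (f y)) A A'" if "A \<in> Pow B" "A' \<in> Pow B" for A A'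
    using that inj_on_subset[OF assms(1)] by (simp add: kform_def sum.reindex)
  have c: "card (f ` A - f ` \<beta>) = card (A - \<beta>)" if "A \<in> Pow B" for A
  proof -
    have "f ` A - f ` \<beta> = f ` (A - \<beta>)"
      using that assms by (intro inj_on_image_set_diff[symmetric, of f B]) auto
    moreover have "inj_on f (A - \<beta>)" using that by (intro inj_on_subset[OF assms(1)]) auto
    ultimately show ?thesis by (simp add: card_image)
  qed
  have "bit_exponent Q (f ` A) (f ` A') = bit_exponent (\<lambda>x y. Q (f x) (f y)) A A'"
    if "A \<in> Pow B" "A' \<in> Pow B" for A A'
    using that by (simp only: bit_exponent_def k)
  then show ?thesis unfolding bit_weight_def P card_image[OF assms(1)]
    by (intro arg_cong2[where f="(*)"] sum.cong refl) (simp_all only: c)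
qed

lemma bit_weight_cong:
  assumes "\<And>x y. x \<in> B \<Longrightarrow> y \<in> B \<Longrightarrow> Q x y = Q' x y"
  shows "bit_weight Q B \<beta> = bit_weight Q' B \<beta>"
proof -
  have "kform Q A A' = kform Q' A A'" if "A \<in> Pow B" "A' \<in> Pow B" for A A'
    using that assms unfolding kform_def by (intro sum.cong) auto
  then have "bit_exponent Q A A' = bit_exponent Q' A A'" if "A \<in> Pow B" "A' \<in> Pow B" for A A'
    using that by (simp only: bit_exponent_def)
  then show ?thesis unfolding bit_weight_def
    by (intro arg_cong2[where f="(*)"] sum.cong refl) simp
qed

text \<open>Expectation of the product of \<open>(1 + cos g) / 2\<close> and
  \<open>(1 + cos h) / 2\<close> for centred, jointly Gaussian \<open>g\<close> and \<open>h\<close>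
  of variance \<open>V\<close> and covariance \<open>k\<close>: each cosine has mean
  \<open>exp (- V / 2)\<close>, and the product of the cosines is half the sum of
  \<open>cos (g - h)\<close> and \<open>cos (g + h)\<close>.\<close>

definition joint_prob :: "real \<Rightarrow> real \<Rightarrow> real" where
  "joint_prob V k = (1 + 2 * exp (- V / 2) + (exp (- (V - k)) + exp (- (V + k))) / 2) / 4"

lemma prob_bits_one:
  assumes "covariance_on Q B" "x \<in> B" "Q x x = V"
  shows "measure_pmf.prob (bits Q B) {\<beta>. x \<in> \<beta>} = (1 + exp (- V / 2)) / 2"
proof -
  have c: "covariance_on Q {x}" using assms(2) by (intro covariance_on_subset[OF assms(1)]) auto
  have "measure_pmf.prob (bits Q B) {\<beta>. x \<in> \<beta>} = measure_pmf.prob (bits Q {x}) {\<beta>. x \<in> \<beta>}"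
    using assms(2) by (intro prob_bits_marginal[OF assms(1)]) auto
  also have "\<dots> = bit_weight Q {x} {x}"
    unfolding prob_bits_eq_sum[OF c] by (subst sum_Pow_insert) auto
  also have "\<dots> = (1 + exp (- V / 2)) / 2"
    unfolding bit_weight_def by (simp add: sum_Pow_insert bit_exponent_def kform_def assms(3))
  finally show ?thesis .
qed

lemma prob_bits_two:
  assumes "covariance_on Q B" "x \<in> B" "y \<in> B" "x \<noteq> y" "Q x x = V" "Q y y = V"
  shows "measure_pmf.prob (bits Q B) {\<beta>. x \<in> \<beta> \<and> y \<in> \<beta>} = joint_prob V (Q x y)"
proof -
  have sym: "Q y x = Q x y" using assms(1) by (simp add: covariance_on_def)
  have c: "covariance_on Q {x, y}" using assms(2,3) by (intro covariance_on_subset[OF assms(1)]) auto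
  have "measure_pmf.prob (bits Q B) {\<beta>. x \<in> \<beta> \<and> y \<in> \<beta>} = measure_pmf.prob (bits Q {x, y}) {\<beta>. x \<in> \<beta> \<and> y \<in> \<beta>}"
    using assms(2,3) by (intro prob_bits_marginal[OF assms(1)]) auto
  also have "\<dots> = bit_weight Q {x, y} {x, y}"
    unfolding prob_bits_eq_sum[OF c] using assms(4)
    by (subst sum_Pow_insert, simp, simp, subst sum_Pow_insert) auto
  also have "\<dots> = joint_prob V (Q x y)"
    unfolding bit_weight_def joint_prob_def using assms(4)
    by (simp add: sum_Pow_insert bit_exponent_def kform_def assms(5,6) sym algebra_simps
      add_divide_distrib diff_divide_distrib)
  finally show ?thesis .
qed

section \<open>From bits to labels\<close>

lemma prob_pair_pmf_Times:
  "measure_pmf.prob (pair_pmf M N) (A \<times> B) = measure_pmf.prob M A * measure_pmf.prob N B"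
proof -
  have "measure_pmf.prob (pair_pmf M N) (A \<times> B)
      = measure_pmf.prob (pair_pmf M N) ((A \<times> B) \<inter> set_pmf (pair_pmf M N))"
    by (rule measure_Int_set_pmf[symmetric])
  also have "(A \<times> B) \<inter> set_pmf (pair_pmf M N) = (A \<inter> set_pmf M) \<times> (B \<inter> set_pmf N)" by auto
  also have "measure_pmf.prob (pair_pmf M N) \<dots>
      = measure_pmf.prob M (A \<inter> set_pmf M) * measure_pmf.prob N (B \<inter> set_pmf N)"
    by (intro measure_pmf_prob_product) (auto intro: countable_subset[OF _ countable_set_pmf])
  finally show ?thesis by (simp add: measure_Int_set_pmf)
qed

lemma prob_pair_pmf_of_set:
  assumes "finite S" "S \<noteq> {}"
  shows "measure_pmf.prob (pair_pmf (pmf_of_set S) P) {p. \<phi> (fst p) (snd p)}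
    = (\<Sum>s\<in>S. measure_pmf.prob P {x. \<phi> s x}) / card S"
proof -
  let ?M = "pair_pmf (pmf_of_set S) P"
  have "measure_pmf.prob ?M {p. \<phi> (fst p) (snd p)} = measure_pmf.prob ?M ({p. \<phi> (fst p) (snd p)} \<inter> set_pmf ?M)"
    by (rule measure_Int_set_pmf[symmetric])
  also have "{p. \<phi> (fst p) (snd p)} \<inter> set_pmf ?M = (\<Union>s\<in>S. {s} \<times> {x. \<phi> s x}) \<inter> set_pmf ?M"
    using assms by (auto simp: set_pmf_of_set)
  also have "measure_pmf.prob ?M \<dots> = measure_pmf.prob ?M (\<Union>s\<in>S. {s} \<times> {x. \<phi> s x})"
    by (rule measure_Int_set_pmf)
  also have "\<dots> = (\<Sum>s\<in>S. measure_pmf.prob ?M ({s} \<times> {x. \<phi> s x}))"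
    using assms by (intro measure_pmf.finite_measure_finite_Union) (auto simp: disjoint_family_on_def)
  also have "\<dots> = (\<Sum>s\<in>S. measure_pmf.prob P {x. \<phi> s x}) / card S"
    unfolding prob_pair_pmf_Times using assms
    by (simp add: measure_pmf_single sum_divide_distrib)
  finally show ?thesis .
qed

text \<open>The index of the bit is ignored: all bits \<open>(a, n)\<close> of one point
  \<open>a\<close> share one Gaussian and are conditionally independent given it, so the fraction of
  ones among them estimates \<open>(1 + cos g) / 2\<close>.\<close>

definition bit_cov :: "('a \<Rightarrow> 'a \<Rightarrow> real) \<Rightarrow> 'a \<times> nat \<Rightarrow> 'a \<times> nat \<Rightarrow> real" where
  "bit_cov K x y = K (fst x) (fst y)"

lemma covariance_on_bit_cov:
  assumes "covariance_on K A"
  shows "covariance_on (bit_cov K) (A \<times> {..<N})"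
proof -
  obtain L where L: "pos_kernel L" "\<And>x y. x \<in> A \<Longrightarrow> y \<in> A \<Longrightarrow> K x y = L x y"
    using assms by (auto simp: covariance_on_def)
  have "pos_kernel (\<lambda>x y. L (fst x) (fst y))" by (rule pos_kernel_pullback[OF L(1)])
  with L(2) assms show ?thesis unfolding covariance_on_def bit_cov_def
    by (intro conjI exI[of _ "\<lambda>x y. L (fst x) (fst y)"]) auto
qed

definition bit_count :: "nat \<Rightarrow> ('a \<times> nat) set \<Rightarrow> 'a \<Rightarrow> nat" where
  "bit_count N \<beta> a = card {n. n < N \<and> (a, n) \<in> \<beta>}"

text \<open>The threshold \<open>\<tau>\<close> is shared by all vertices, so two vertices disagree about a label only
  with probability proportional to the difference of their counts.\<close>
definition hits :: "nat \<Rightarrow> nat \<Rightarrow> nat \<Rightarrow> (('v \<times> nat) \<times> nat) set \<Rightarrow> 'v \<Rightarrow> nat set" where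
  "hits q N \<tau> \<beta> v = {i. i < q \<and> \<tau> \<le> bit_count N \<beta> (v, i)}"

definition pick :: "nat set \<Rightarrow> nat option" where
  "pick E = (if is_singleton E then Some (the_elem E) else None)"

lemma pick_eq_Some: "pick E = Some i \<longleftrightarrow> E = {i}"
  by (auto simp: pick_def is_singleton_def)

definition round_pmf :: "('v \<times> nat \<Rightarrow> 'v \<times> nat \<Rightarrow> real) \<Rightarrow> nat \<Rightarrow> nat \<Rightarrow> 'v set \<Rightarrow> ('v \<Rightarrow> nat option) pmf" where
  "round_pmf K q N S = map_pmf (\<lambda>p. \<lambda>v\<in>S. pick (hits q N (fst p) (snd p) v))
     (pair_pmf (pmf_of_set {1..N}) (bits (bit_cov K) ((S \<times> {..<q}) \<times> {..<N})))"

fun rounds_pmf :: "('v \<times> nat \<Rightarrow> 'v \<times> nat \<Rightarrow> real) \<Rightarrow> nat \<Rightarrow> nat \<Rightarrow> nat \<Rightarrow> 'v set \<Rightarrow> ('v \<Rightarrow> nat option) pmf" where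
  "rounds_pmf K q N 0 S = return_pmf (\<lambda>v\<in>S. None)"
| "rounds_pmf K q N (Suc R) S =
     map_pmf (\<lambda>p. \<lambda>v\<in>S. case fst p v of None \<Rightarrow> snd p v | Some i \<Rightarrow> Some i)
       (pair_pmf (rounds_pmf K q N R S) (round_pmf K q N S))"

lemma hits_restrict:
  assumes "v \<in> S"
  shows "hits q N \<tau> (\<beta> \<inter> ((S \<times> {..<q}) \<times> {..<N})) v = hits q N \<tau> \<beta> v"
proof -
  have "{n. n < N \<and> ((v, i), n) \<in> \<beta> \<inter> ((S \<times> {..<q}) \<times> {..<N})} = {n. n < N \<and> ((v, i), n) \<in> \<beta>}" if "i < q" for i
    using assms that by auto
  then show ?thesis by (auto simp: hits_def bit_count_def)
qed

text \<open>The picks on \<open>S\<close> read only the threshold and the bits over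
  \<open>S\<close>, so consistency of a round is consistency of the bits.\<close>

lemma round_pmf_marginal:
  assumes cov: "covariance_on K (S' \<times> {..<q})" and "S \<subseteq> S'"
  shows "map_pmf (\<lambda>f. restrict f S) (round_pmf K q N S') = round_pmf K q N S"
proof -
  let ?B = "\<lambda>S. (S \<times> {..<q}) \<times> {..<N}"
  have sub: "?B S \<subseteq> ?B S'" using assms(2) by auto
  have "round_pmf K q N S = map_pmf (\<lambda>p. \<lambda>v\<in>S. pick (hits q N (fst p) (snd p) v))
     (pair_pmf (map_pmf id (pmf_of_set {1..N})) (map_pmf (\<lambda>\<beta>. \<beta> \<inter> ?B S) (bits (bit_cov K) (?B S'))))"
    unfolding round_pmf_def by (simp add: pmf.map_id bits_marginal[OF covariance_on_bit_cov[OF cov] sub])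
  also have "\<dots> = map_pmf (\<lambda>p. \<lambda>v\<in>S. pick (hits q N (fst p) (snd p) v))
      (pair_pmf (pmf_of_set {1..N}) (bits (bit_cov K) (?B S')))"
    unfolding map_pair[symmetric] pmf.map_comp
    by (intro map_pmf_cong) (auto simp: hits_restrict)
  also have "\<dots> = map_pmf (\<lambda>f. restrict f S) (round_pmf K q N S')"
    unfolding round_pmf_def pmf.map_comp using assms(2)
    by (intro map_pmf_cong) (auto simp: Int_absorb1)
  finally show ?thesis ..
qed

lemma rounds_pmf_marginal:
  assumes cov: "covariance_on K (S' \<times> {..<q})" and "S \<subseteq> S'"
  shows "map_pmf (\<lambda>f. restrict f S) (rounds_pmf K q N R S') = rounds_pmf K q N R S"
proof (induction R)
  case 0
  then show ?case using assms(2) by (auto simp: map_return_pmf restrict_def fun_eq_iff)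
next
  case (Suc R)
  show ?case
    unfolding rounds_pmf.simps Suc[symmetric] round_pmf_marginal[OF assms, symmetric]
      map_pair[symmetric] pmf.map_comp
    using assms(2) by (intro map_pmf_cong) (auto simp: fun_eq_iff split: option.split)
qed

lemma set_round_pmf:
  "f \<in> set_pmf (round_pmf K q N S) \<Longrightarrow> v \<in> S \<Longrightarrow> f v \<in> insert None (Some ` {..<q})"
  unfolding round_pmf_def by (cases "f v") (force simp: pick_eq_Some hits_def)+

lemma set_rounds_pmf:
  "f \<in> set_pmf (rounds_pmf K q N R S) \<Longrightarrow> v \<in> S \<Longrightarrow> f v \<in> insert None (Some ` {..<q})"
proof (induction R arbitrary: f)
  case (Suc R)
  then obtain p where p: "p \<in> set_pmf (pair_pmf (rounds_pmf K q N R S) (round_pmf K q N S))"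
    "f = (\<lambda>v\<in>S. case fst p v of None \<Rightarrow> snd p v | Some i \<Rightarrow> Some i)"
    unfolding rounds_pmf.simps set_map_pmf by blast
  then have g: "fst p \<in> set_pmf (rounds_pmf K q N R S)" "snd p \<in> set_pmf (round_pmf K q N S)"
    "f v = (case fst p v of None \<Rightarrow> snd p v | Some i \<Rightarrow> Some i)" using Suc.prems(2) by auto
  show ?case using Suc.IH[OF g(1) Suc.prems(2)] set_round_pmf[OF g(2) Suc.prems(2)] g(3)
    by (auto split: option.splits)
qed simp

lemma prob_None_or_Some:
  fixes q :: nat
  assumes "\<And>f. f \<in> set_pmf p \<Longrightarrow> f v \<in> insert None (Some ` {..<q})"
  shows "measure_pmf.prob p {f. f v = None} + (\<Sum>i<q. measure_pmf.prob p {f. f v = Some i}) = 1"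
proof -
  let ?A = "\<lambda>z. {f. f v = z}"
  have "1 = measure_pmf.prob p (set_pmf p)" by (simp add: measure_pmf_UNIV measure_Int_set_pmf[of p UNIV, simplified])
  also have "\<dots> = measure_pmf.prob p ((\<Union>z\<in>insert None (Some ` {..<q}). ?A z) \<inter> set_pmf p)"
    using assms by (intro arg_cong[where f="measure _"]) auto
  also have "\<dots> = measure_pmf.prob p (\<Union>z\<in>insert None (Some ` {..<q}). ?A z)"
    by (simp add: measure_Int_set_pmf)
  also have "\<dots> = (\<Sum>z\<in>insert None (Some ` {..<q}). measure_pmf.prob p (?A z))"
    by (intro measure_pmf.finite_measure_finite_Union) (auto simp: disjoint_family_on_def)
  also have "\<dots> = measure_pmf.prob p {f. f v = None} + (\<Sum>i<q. measure_pmf.prob p {f. f v = Some i})"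
    by (subst sum.insert) (auto simp: sum.reindex)
  finally show ?thesis ..
qed

lemma prob_rounds_Suc_None:
  assumes "v \<in> S"
  shows "measure_pmf.prob (rounds_pmf K q N (Suc R) S) {f. f v = None} =
    measure_pmf.prob (rounds_pmf K q N R S) {f. f v = None} * measure_pmf.prob (round_pmf K q N S) {f. f v = None}"
  unfolding prob_pair_pmf_Times[symmetric] using assms
  by (auto intro!: arg_cong[where f="measure _"] split: option.splits)

lemma prob_rounds_Suc_Some:
  assumes "v \<in> S"
  shows "measure_pmf.prob (rounds_pmf K q N (Suc R) S) {f. f v = Some i} =
    measure_pmf.prob (rounds_pmf K q N R S) {f. f v = Some i} +
    measure_pmf.prob (rounds_pmf K q N R S) {f. f v = None} * measure_pmf.prob (round_pmf K q N S) {f. f v = Some i}"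
proof -
  let ?P = "pair_pmf (rounds_pmf K q N R S) (round_pmf K q N S)"
  have "measure_pmf.prob (rounds_pmf K q N (Suc R) S) {f. f v = Some i}
    = measure_pmf.prob ?P ({f. f v = Some i} \<times> UNIV \<union> {f. f v = None} \<times> {f. f v = Some i})"
    using assms by (auto intro!: arg_cong[where f="measure _"] split: option.splits)
  also have "\<dots> = measure_pmf.prob ?P ({f. f v = Some i} \<times> UNIV) + measure_pmf.prob ?P ({f. f v = None} \<times> {f. f v = Some i})"
    by (intro measure_pmf.finite_measure_Union) auto
  finally show ?thesis by (simp add: prob_pair_pmf_Times)
qed

text \<open>Rounds are independent and every label succeeds with the same probability
  \<open>c\<close>, so the waiting time is geometric and a vertex that has settled is uniform over
  its \<open>q\<close> labels.\<close>

lemma prob_rounds_pmf: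
  assumes "v \<in> S" "q \<ge> 1"
    and c: "\<And>i. i < q \<Longrightarrow> measure_pmf.prob (round_pmf K q N S) {f. f v = Some i} = c"
  shows "i < q \<Longrightarrow> measure_pmf.prob (rounds_pmf K q N R S) {f. f v = Some i} = (1 - (1 - q * c) ^ R) / q"
    and "measure_pmf.prob (rounds_pmf K q N R S) {f. f v = None} = (1 - q * c) ^ R"
proof -
  have none: "measure_pmf.prob (round_pmf K q N S) {f. f v = None} = 1 - q * c"
    using prob_None_or_Some[of "round_pmf K q N S" v q] set_round_pmf[OF _ assms(1)] c by (simp add: algebra_simps)
  show 1: "measure_pmf.prob (rounds_pmf K q N R S) {f. f v = None} = (1 - q * c) ^ R" for R
  proof (induction R)
    case 0
    then show ?case using assms(1) by simp
  next
    case (Suc R)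
    then show ?case using prob_rounds_Suc_None[OF assms(1)] none by simp
  qed
  show "measure_pmf.prob (rounds_pmf K q N R S) {f. f v = Some i} = (1 - (1 - q * c) ^ R) / q" if "i < q"
  proof (induction R)
    case 0
    then show ?case using assms(1) by simp
  next
    case (Suc R)
    then show ?case using prob_rounds_Suc_Some[OF assms(1)] 1 c[OF that] assms(2) by (simp add: field_simps)
  qed
qed

text \<open>Two vertices that are both still waiting count as shifted, so that agreement in every
  single round implies agreement of the final outcome.\<close>

definition shifted :: "nat \<Rightarrow> nat \<Rightarrow> nat option \<Rightarrow> nat option \<Rightarrow> bool" where
  "shifted q s a b \<longleftrightarrow> b = map_option (\<lambda>i. (i + s) mod q) a"

text \<open>In a round of agreement both ends settle compatibly or both wait. A disagreement in the
  outcome therefore stems from some round of disagreement, and a union bound over the rounds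
  applies.\<close>

lemma prob_rounds_not_shifted:
  assumes "u \<in> S" "v \<in> S"
  shows "measure_pmf.prob (rounds_pmf K q N R S) {f. \<not> shifted q s (f u) (f v)}
    \<le> R * measure_pmf.prob (round_pmf K q N S) {f. \<not> shifted q s (f u) (f v)}"
proof (induction R)
  case 0
  then show ?case using assms by (simp add: shifted_def)
next
  case (Suc R)
  let ?P = "pair_pmf (rounds_pmf K q N R S) (round_pmf K q N S)"
  let ?X = "{f. \<not> shifted q s (f u) (f v)}"
  have "measure_pmf.prob (rounds_pmf K q N (Suc R) S) ?X \<le> measure_pmf.prob ?P (?X \<times> UNIV \<union> UNIV \<times> ?X)"
    using assms by (auto intro!: measure_pmf.finite_measure_mono simp: shifted_def split: option.splits)
  also have "\<dots> \<le> measure_pmf.prob ?P (?X \<times> UNIV) + measure_pmf.prob ?P (UNIV \<times> ?X)"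
    by (intro measure_Un_le) auto
  also have "\<dots> = measure_pmf.prob (rounds_pmf K q N R S) ?X + measure_pmf.prob (round_pmf K q N S) ?X"
    by (simp add: prob_pair_pmf_Times)
  finally show ?case using Suc by (simp add: algebra_simps)
qed

section \<open>Moments of the bit counts\<close>

text \<open>A finite sum instead of an integral, so linearity is plain algebra and positivity of the
  weights enters through monotonicity.\<close>

definition bit_expect :: "('b \<Rightarrow> 'b \<Rightarrow> real) \<Rightarrow> 'b set \<Rightarrow> ('b set \<Rightarrow> real) \<Rightarrow> real" where
  "bit_expect Q B f = (\<Sum>\<beta>\<in>Pow B. bit_weight Q B \<beta> * f \<beta>)"

lemma bit_expect_mono:
  assumes "covariance_on Q B" "\<And>\<beta>. f \<beta> \<le> g \<beta>"
  shows "bit_expect Q B f \<le> bit_expect Q B g"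
  unfolding bit_expect_def using assms bit_weight_nonneg[OF assms(1)]
  by (intro sum_mono mult_left_mono) auto

lemma bit_expect_add: "bit_expect Q B (\<lambda>\<beta>. f \<beta> + g \<beta>) = bit_expect Q B f + bit_expect Q B g"
  by (simp add: bit_expect_def distrib_left sum.distrib)

lemma bit_expect_diff: "bit_expect Q B (\<lambda>\<beta>. f \<beta> - g \<beta>) = bit_expect Q B f - bit_expect Q B g"
  by (simp add: bit_expect_def right_diff_distrib sum_subtractf)

lemma bit_expect_cmult: "bit_expect Q B (\<lambda>\<beta>. c * f \<beta>) = c * bit_expect Q B f"
  by (simp add: bit_expect_def sum_distrib_left mult_ac)

lemma bit_expect_sum: "bit_expect Q B (\<lambda>\<beta>. \<Sum>i\<in>I. f i \<beta>) = (\<Sum>i\<in>I. bit_expect Q B (f i))"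
  unfolding bit_expect_def sum_distrib_left by (rule sum.swap)

lemma bit_expect_const: "covariance_on Q B \<Longrightarrow> bit_expect Q B (\<lambda>\<beta>. c) = c"
  using sum_bit_weight[of B Q] by (simp add: bit_expect_def sum_distrib_right[symmetric] covariance_on_def)

lemma prob_bits_eq_expect:
  assumes "covariance_on Q B"
  shows "measure_pmf.prob (bits Q B) {\<beta>. \<phi> \<beta>} = bit_expect Q B (\<lambda>\<beta>. of_bool (\<phi> \<beta>))"
  unfolding bit_expect_def by (rule prob_bits_eq_sum[OF assms])

lemma bit_count_eq_sum: "real (bit_count N \<beta> a) = (\<Sum>n<N. of_bool ((a, n) \<in> \<beta>))"
  by (auto simp: bit_count_def intro!: arg_cong[where f=card])

lemma bit_count_le: "bit_count N \<beta> a \<le> N"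
proof -
  have "bit_count N \<beta> a \<le> card {..<N}" unfolding bit_count_def by (intro card_mono) auto
  then show ?thesis by simp
qed

context
  fixes K :: "'a \<Rightarrow> 'a \<Rightarrow> real" and A :: "'a set" and N :: nat and V :: real
  assumes cov: "covariance_on K A" and N: "N \<ge> 1" and V: "\<And>a. a \<in> A \<Longrightarrow> K a a = V"
begin

abbreviation (input) "count_expect \<equiv> bit_expect (bit_cov K) (A \<times> {..<N})"

lemma covariance_on_count_bits: "covariance_on (bit_cov K) (A \<times> {..<N})"
  by (rule covariance_on_bit_cov[OF cov])

lemma expect_count_product:
  "count_expect (\<lambda>\<beta>. real (bit_count N \<beta> a) * real (bit_count N \<beta> b)) =
   (\<Sum>n<N. \<Sum>m<N. measure_pmf.prob (bits (bit_cov K) (A \<times> {..<N})) {\<beta>. (a, n) \<in> \<beta> \<and> (b, m) \<in> \<beta>})"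
  unfolding prob_bits_eq_expect[OF covariance_on_count_bits] bit_expect_sum[symmetric] bit_count_eq_sum sum_product of_bool_conj ..

lemma expect_count_cross:
  assumes "a \<in> A" "b \<in> A" "a \<noteq> b"
  shows "count_expect (\<lambda>\<beta>. real (bit_count N \<beta> a) * real (bit_count N \<beta> b)) = (real N)\<^sup>2 * joint_prob V (K a b)"
proof -
  have "measure_pmf.prob (bits (bit_cov K) (A \<times> {..<N})) {\<beta>. (a, n) \<in> \<beta> \<and> (b, m) \<in> \<beta>} = joint_prob V (K a b)"
    if "n < N" "m < N" for n m
    using prob_bits_two[OF covariance_on_count_bits, of "(a, n)" "(b, m)" V] assms that V by (simp add: bit_cov_def)
  then show ?thesis unfolding expect_count_product by (simp add: power2_eq_square)
qed

text \<open>The \<open>N\<close> diagonal pairs see one bit twice instead of two distinct bits over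
  the same Gaussian; they cause the correction of order \<open>N\<close>.\<close>

lemma expect_count_square:
  assumes "a \<in> A"
  shows "count_expect (\<lambda>\<beta>. real (bit_count N \<beta> a) * real (bit_count N \<beta> a))
    = (real N)\<^sup>2 * joint_prob V V + real N * ((1 + exp (- V / 2)) / 2 - joint_prob V V)"
proof -
  let ?e = "(1 + exp (- V / 2)) / 2"
  have *: "measure_pmf.prob (bits (bit_cov K) (A \<times> {..<N})) {\<beta>. (a, n) \<in> \<beta> \<and> (a, m) \<in> \<beta>}
      = joint_prob V V + (if n = m then ?e - joint_prob V V else 0)"
    if "n < N" "m < N" for n m
  proof (cases "n = m")
    case True
    then show ?thesis using prob_bits_one[OF covariance_on_count_bits, of "(a, n)" V] assms that V by (simp add: bit_cov_def)
  next
    case False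
    then show ?thesis using prob_bits_two[OF covariance_on_count_bits, of "(a, n)" "(a, m)" V] assms that V by (simp add: bit_cov_def)
  qed
  have "(\<Sum>n<N. \<Sum>m<N. joint_prob V V + (if n = m then ?e - joint_prob V V else 0))
      = (real N)\<^sup>2 * joint_prob V V + real N * (?e - joint_prob V V)"
    by (simp add: sum.distrib power2_eq_square algebra_simps)
  then show ?thesis unfolding expect_count_product by (simp add: *)
qed

lemma expect_count_diff:
  assumes "a \<in> A" "b \<in> A" "a \<noteq> b"
  shows "count_expect (\<lambda>\<beta>. (real (bit_count N \<beta> a) - real (bit_count N \<beta> b))\<^sup>2)
    = (real N)\<^sup>2 * (2 * (joint_prob V V - joint_prob V (K a b))) + 2 * real N * ((1 + exp (- V / 2)) / 2 - joint_prob V V)"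
proof -
  have "count_expect (\<lambda>\<beta>. (real (bit_count N \<beta> a) - real (bit_count N \<beta> b))\<^sup>2)
    = count_expect (\<lambda>\<beta>. (real (bit_count N \<beta> a) * real (bit_count N \<beta> a) + real (bit_count N \<beta> b) * real (bit_count N \<beta> b))
         - 2 * (real (bit_count N \<beta> a) * real (bit_count N \<beta> b)))"
    by (rule arg_cong[where f=count_expect]) (auto simp: power2_eq_square algebra_simps)
  also have "\<dots> = 2 * ((real N)\<^sup>2 * joint_prob V V + real N * ((1 + exp (- V / 2)) / 2 - joint_prob V V))
      - 2 * ((real N)\<^sup>2 * joint_prob V (K a b))"
    unfolding bit_expect_add bit_expect_diff bit_expect_cmult
    using assms by (simp add: expect_count_square expect_count_cross)
  finally show ?thesis by (simp add: algebra_simps)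
qed

text \<open>Two counts differ for two reasons: sampling noise, which gives \<open>2 / N\<close>, and
  the difference of the Gaussians, which gives \<open>V - K a b\<close> through
  \<open>1 - x \<le> exp (- x)\<close>.\<close>

lemma expect_count_diff_le:
  assumes "a \<in> A" "b \<in> A" "a \<noteq> b" "0 \<le> K a b" "K a b \<le> V"
  shows "count_expect (\<lambda>\<beta>. (real (bit_count N \<beta> a) - real (bit_count N \<beta> b))\<^sup>2) \<le> (real N)\<^sup>2 * (2 / N + (V - K a b) / 4)"
proof -
  have V0: "0 \<le> V" using assms(4,5) by simp
  define h x y z where "h = exp (- V / 2)" "x = exp (- (V - K a b))" "y = exp (- (V + K a b))" "z = exp (- (V + V))"
  have "z \<le> y" using assms(5) by (simp add: h_x_y_z_def)
  moreover have "1 + - (V - K a b) \<le> x" unfolding h_x_y_z_def by (rule exp_ge_add_one_self)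
  moreover have "joint_prob V V = (1 + 2 * h + (1 + z) / 2) / 4" "joint_prob V (K a b) = (1 + 2 * h + (x + y) / 2) / 4"
    by (simp_all add: joint_prob_def h_x_y_z_def)
  ultimately have 1: "2 * (joint_prob V V - joint_prob V (K a b)) \<le> (V - K a b) / 4"
    by (simp add: field_simps)
  have "h \<le> 1" using V0 by (simp add: h_x_y_z_def)
  moreover have "0 \<le> joint_prob V V" by (auto simp: joint_prob_def add_nonneg_nonneg)
  ultimately have 2: "(1 + exp (- V / 2)) / 2 - joint_prob V V \<le> 1"
    unfolding h_x_y_z_def(1)[symmetric] by (simp add: field_simps)
  have "(real N)\<^sup>2 * (2 * (joint_prob V V - joint_prob V (K a b))) + 2 * real N * ((1 + exp (- V / 2)) / 2 - joint_prob V V)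
     \<le> (real N)\<^sup>2 * ((V - K a b) / 4) + 2 * real N * 1"
    using 1 2 by (intro add_mono mult_left_mono) auto
  also have "\<dots> = (real N)\<^sup>2 * (2 / N + (V - K a b) / 4)"
    using N by (simp add: field_simps power2_eq_square)
  finally show ?thesis using expect_count_diff[OF assms(1-3)] by simp
qed

text \<open>For uncorrelated points, with \<open>e = exp (- V)\<close>, the leading coefficient is
  \<open>(1 - e)\<^sup>2 / 4\<close>. Variance at least 1 gives \<open>e \<le> 1 / 2\<close> and
  hence 1/16; the noise term is nonnegative.\<close>

lemma expect_count_diff_ge:
  assumes "a \<in> A" "b \<in> A" "a \<noteq> b" "K a b = 0" "1 \<le> V"
  shows "(real N)\<^sup>2 / 16 \<le> count_expect (\<lambda>\<beta>. (real (bit_count N \<beta> a) - real (bit_count N \<beta> b))\<^sup>2)"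
proof -
  define e where "e = exp (- V)"
  have e: "0 < e" "e \<le> 1 / 2"
  proof -
    have "2 \<le> exp (1::real)" using exp_ge_add_one_self[of 1] by simp
    also have "\<dots> \<le> exp V" using assms(5) by simp
    finally show "e \<le> 1 / 2" by (simp add: e_def exp_minus field_simps)
  qed (simp add: e_def)
  have jV: "joint_prob V V = (1 + 2 * exp (- V / 2) + (1 + e * e) / 2) / 4"
    by (simp add: joint_prob_def e_def exp_add[symmetric])
  have j0: "joint_prob V 0 = (1 + 2 * exp (- V / 2) + e) / 4"
    by (simp add: joint_prob_def e_def)
  have "(1/2) * (1/2) \<le> (1 - e) * (1 - e)" using e by (intro mult_mono) auto
  also have "\<dots> = 1 - 2 * e + e * e" by (simp add: algebra_simps)
  finally have 1: "1 / 16 \<le> 2 * (joint_prob V V - joint_prob V 0)"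
    unfolding jV j0 by (simp add: field_simps)
  have "e * e \<le> 1 * 1" using e by (intro mult_mono) auto
  then have 2: "0 \<le> (1 + exp (- V / 2)) / 2 - joint_prob V V"
    unfolding jV by simp
  have "(real N)\<^sup>2 * (1 / 16) + 0 \<le> (real N)\<^sup>2 * (2 * (joint_prob V V - joint_prob V 0)) + 2 * real N * ((1 + exp (- V / 2)) / 2 - joint_prob V V)"
    using 1 2 by (intro add_mono mult_left_mono mult_nonneg_nonneg) auto
  then show ?thesis using expect_count_diff[OF assms(1-3)] assms(4) by simp
qed

text \<open>The thresholds that separate two counts are those above the smaller and up to the larger
  one. Averaging over a uniform threshold thus turns the probability of disagreement into an L1
  distance of counts.\<close>

lemma sum_threshold_disagree:
  assumes "c \<le> N" "d \<le> N"
  shows "(\<Sum>\<tau>\<in>{1..N}. of_bool ((\<tau> \<le> c) \<noteq> (\<tau> \<le> d))) = \<bar>real c - real d\<bar>"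
proof -
  have "{1..N} \<inter> {\<tau>. (\<tau> \<le> c) \<noteq> (\<tau> \<le> d)} = {min c d<..max c d}" using assms by auto
  then show ?thesis by (auto simp: min_def max_def)
qed

lemma sum_prob_disagree:
  "(\<Sum>\<tau>\<in>{1..N}. measure_pmf.prob (bits (bit_cov K) (A \<times> {..<N}))
      {\<beta>. (\<tau> \<le> bit_count N \<beta> a) \<noteq> (\<tau> \<le> bit_count N \<beta> b)})
   = count_expect (\<lambda>\<beta>. \<bar>real (bit_count N \<beta> a) - real (bit_count N \<beta> b)\<bar>)"
  unfolding prob_bits_eq_expect[OF covariance_on_count_bits] bit_expect_sum[symmetric]
  by (simp only: sum_threshold_disagree[OF bit_count_le bit_count_le])

text \<open>Only second moments are at hand. The inequality
  \<open>|x| \<le> t * N + x\<^sup>2 / (t * N)\<close> passes from L1 to L2 with a free parameter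
  \<open>t\<close>, to be balanced at the end.\<close>

lemma sum_prob_disagree_le:
  assumes "a \<in> A" "b \<in> A" "a \<noteq> b" "0 \<le> K a b" "K a b \<le> V" and t: "t > 0"
  shows "(\<Sum>\<tau>\<in>{1..N}. measure_pmf.prob (bits (bit_cov K) (A \<times> {..<N}))
      {\<beta>. (\<tau> \<le> bit_count N \<beta> a) \<noteq> (\<tau> \<le> bit_count N \<beta> b)}) \<le> N * (t + (2 / N + (V - K a b) / 4) / t)"
proof -
  let ?D = "\<lambda>\<beta>. real (bit_count N \<beta> a) - real (bit_count N \<beta> b)"
  have am: "\<bar>x\<bar> \<le> t * N + (1 / (t * N)) * x\<^sup>2" for x :: real
  proof -
    have tN: "t * N > 0" using t N by simp
    have "0 \<le> (\<bar>x\<bar> - t * N / 2)\<^sup>2" by simp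
    then have "t * N * \<bar>x\<bar> \<le> x\<^sup>2 + (t * N)\<^sup>2 / 4" by (simp add: power2_diff power_divide field_simps)
    also have "\<dots> \<le> x\<^sup>2 + (t * N)\<^sup>2" by simp
    also have "\<dots> = x\<^sup>2 + (t * N) * (t * N)" by (simp add: power2_eq_square)
    also have "\<dots> = t * N * (t * N + (1 / (t * N)) * x\<^sup>2)" using t N
      by (simp only: distrib_left) simp
    finally show ?thesis using tN by (simp only: mult_le_cancel_left_pos)
  qed
  have "count_expect (\<lambda>\<beta>. \<bar>?D \<beta>\<bar>) \<le> count_expect (\<lambda>\<beta>. t * N + (1 / (t * N)) * (?D \<beta>)\<^sup>2)"
    by (intro bit_expect_mono[OF covariance_on_count_bits] am)
  also have "\<dots> = t * N + (1 / (t * N)) * count_expect (\<lambda>\<beta>. (?D \<beta>)\<^sup>2)"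
    unfolding bit_expect_add bit_expect_cmult bit_expect_const[OF covariance_on_count_bits] ..
  also have "\<dots> \<le> t * N + (1 / (t * N)) * ((real N)\<^sup>2 * (2 / N + (V - K a b) / 4))"
    using expect_count_diff_le[OF assms(1-5)] t by (intro add_mono mult_left_mono) auto
  also have "\<dots> = N * (t + (2 / N + (V - K a b) / 4) / t)"
    using t N by (simp add: field_simps power2_eq_square)
  finally show ?thesis unfolding sum_prob_disagree .
qed

text \<open>Counts lie between 0 and \<open>N\<close>, so the square of a difference is at most
  \<open>N\<close> times its absolute value; a lower bound on the second moment becomes one in
  L1.\<close>

lemma sum_prob_disagree_ge:
  assumes "a \<in> A" "b \<in> A" "a \<noteq> b" "K a b = 0" "1 \<le> V"
  shows "N / 16 \<le> (\<Sum>\<tau>\<in>{1..N}. measure_pmf.prob (bits (bit_cov K) (A \<times> {..<N}))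
      {\<beta>. (\<tau> \<le> bit_count N \<beta> a) \<noteq> (\<tau> \<le> bit_count N \<beta> b)})"
proof -
  let ?D = "\<lambda>\<beta>. real (bit_count N \<beta> a) - real (bit_count N \<beta> b)"
  have "(?D \<beta>)\<^sup>2 \<le> N * \<bar>?D \<beta>\<bar>" for \<beta>
  proof -
    have "\<bar>?D \<beta>\<bar> \<le> N" using bit_count_le[of N \<beta> a] bit_count_le[of N \<beta> b] by linarith
    then have "\<bar>?D \<beta>\<bar> * \<bar>?D \<beta>\<bar> \<le> N * \<bar>?D \<beta>\<bar>" by (intro mult_right_mono) auto
    then show ?thesis by (simp add: power2_eq_square)
  qed
  then have "count_expect (\<lambda>\<beta>. (?D \<beta>)\<^sup>2) \<le> count_expect (\<lambda>\<beta>. N * \<bar>?D \<beta>\<bar>)"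
    by (intro bit_expect_mono[OF covariance_on_count_bits])
  then have "(real N)\<^sup>2 / 16 \<le> N * count_expect (\<lambda>\<beta>. \<bar>?D \<beta>\<bar>)"
    using expect_count_diff_ge[OF assms] by (simp add: bit_expect_cmult)
  then show ?thesis unfolding sum_prob_disagree using N by (simp add: power2_eq_square)
qed

text \<open>Within the block of one point all covariances equal \<open>V\<close>, so a constant
  kernel describes the block of every point of \<open>A\<close>.\<close>

definition hit_prob :: "nat \<Rightarrow> real" where
  "hit_prob \<tau> = (\<Sum>\<beta>\<in>Pow {..<N}. bit_weight (\<lambda>_ _. V) {..<N} \<beta> * of_bool (\<tau> \<le> card \<beta>))"

lemma prob_block_hit:
  assumes "a \<in> A"
  shows "measure_pmf.prob (bits (bit_cov K) ({a} \<times> {..<N})) {\<beta>. \<tau> \<le> bit_count N \<beta> a} = hit_prob \<tau>"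
proof -
  have c: "covariance_on (bit_cov K) ({a} \<times> {..<N})" using assms by (intro covariance_on_subset[OF covariance_on_count_bits]) auto
  have inj: "inj_on (Pair a) X" for X by (auto simp: inj_on_def)
  have im: "{a} \<times> {..<N} = Pair a ` {..<N}" by auto
  have "measure_pmf.prob (bits (bit_cov K) ({a} \<times> {..<N})) {\<beta>. \<tau> \<le> bit_count N \<beta> a}
     = (\<Sum>\<beta>\<in>Pow {..<N}. bit_weight (bit_cov K) (Pair a ` {..<N}) (Pair a ` \<beta>) * of_bool (\<tau> \<le> bit_count N (Pair a ` \<beta>) a))"
    unfolding prob_bits_eq_sum[OF c] unfolding im image_Pow_surj[OF refl, symmetric]
    by (subst sum.reindex[OF inj_on_image_Pow[OF inj]]) simp
  also have "\<dots> = hit_prob \<tau>" unfolding hit_prob_def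
  proof (intro sum.cong refl arg_cong2[where f="(*)"])
    fix \<beta> assume "\<beta> \<in> Pow {..<N}"
    then have b: "\<beta> \<subseteq> {..<N}" by simp
    show "bit_weight (bit_cov K) (Pair a ` {..<N}) (Pair a ` \<beta>) = bit_weight (\<lambda>_ _. V) {..<N} \<beta>"
      unfolding bit_weight_image[OF inj b] using V[OF assms] by (intro bit_weight_cong) (simp add: bit_cov_def)
    have "{n. n < N \<and> (a, n) \<in> Pair a ` \<beta>} = \<beta>" using b by auto
    then show "of_bool (\<tau> \<le> bit_count N (Pair a ` \<beta>) a) = of_bool (\<tau> \<le> card \<beta>)" by (simp add: bit_count_def)
  qed
  finally show ?thesis .
qed

lemma prob_block_not_hit:
  assumes "a \<in> A"
  shows "measure_pmf.prob (bits (bit_cov K) ({a} \<times> {..<N})) {\<beta>. \<not> \<tau> \<le> bit_count N \<beta> a} = 1 - hit_prob \<tau>"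
proof -
  have "{\<beta>. \<not> \<tau> \<le> bit_count N \<beta> a} = UNIV - {\<beta>. \<tau> \<le> bit_count N \<beta> a}" by auto
  then show ?thesis 
    using prob_block_hit[OF assms, of \<tau>] measure_pmf.prob_compl[of "{\<beta>. \<tau> \<le> bit_count N \<beta> a}" "bits (bit_cov K) ({a} \<times> {..<N})"]
    by simp
qed

lemma hit_prob_bounds: 
  assumes "A \<noteq> {}" shows "0 \<le> hit_prob \<tau>" "hit_prob \<tau> \<le> 1"
  using assms prob_block_hit by (metis all_not_in_conv measure_nonneg, metis all_not_in_conv measure_pmf.prob_le_1)

lemma bit_count_Int: "bit_count N (\<beta> \<inter> ({a} \<times> {..<N})) a = bit_count N \<beta> a"
  unfolding bit_count_def by (intro arg_cong[where f=card]) auto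

text \<open>Pairwise uncorrelated points have independent blocks of bits, so for a fixed threshold
  the hits are independent trials with one common success probability.\<close>

lemma prob_pattern:
  assumes "finite A" and orth: "\<And>a b. a \<in> A \<Longrightarrow> b \<in> A \<Longrightarrow> a \<noteq> b \<Longrightarrow> K a b = 0" and "I \<subseteq> A"
  shows "measure_pmf.prob (bits (bit_cov K) (A \<times> {..<N})) {\<beta>. \<forall>a\<in>A. \<tau> \<le> bit_count N \<beta> a \<longleftrightarrow> a \<in> I}
    = hit_prob \<tau> ^ card I * (1 - hit_prob \<tau>) ^ card (A - I)"
proof -
  have U: "A \<times> {..<N} = (\<Union>a\<in>A. {a} \<times> {..<N})" by auto
  have "measure_pmf.prob (bits (bit_cov K) (\<Union>a\<in>A. {a} \<times> {..<N}))
      {\<beta>. \<forall>a\<in>A. \<tau> \<le> bit_count N (\<beta> \<inter> ({a} \<times> {..<N})) a \<longleftrightarrow> a \<in> I}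
    = (\<Prod>a\<in>A. measure_pmf.prob (bits (bit_cov K) ({a} \<times> {..<N})) {\<beta>. \<tau> \<le> bit_count N \<beta> a \<longleftrightarrow> a \<in> I})"
    using covariance_on_count_bits orth unfolding U
    by (intro prob_bits_UN[where \<phi>="\<lambda>a \<beta>. \<tau> \<le> bit_count N \<beta> a \<longleftrightarrow> a \<in> I"] assms(1))
      (auto simp: disjoint_family_on_def bit_cov_def)
  also have "\<dots> = (\<Prod>a\<in>A. if a \<in> I then hit_prob \<tau> else 1 - hit_prob \<tau>)"
    by (intro prod.cong) (auto simp: prob_block_hit prob_block_not_hit)
  also have "\<dots> = (\<Prod>a\<in>I. hit_prob \<tau>) * (\<Prod>a\<in>A - I. 1 - hit_prob \<tau>)"
    using assms(1,3) by (subst prod.If_cases) (auto simp: Int_absorb1 Diff_eq)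
  finally show ?thesis by (simp add: bit_count_Int U)
qed

end

section \<open>Success and agreement of a round\<close>

text \<open>Jensen's inequality for the power \<open>n\<close>, obtained from the tangent at
  \<open>y\<close>, that is, from Bernoulli's inequality for \<open>f s / y\<close>.\<close>

lemma average_power_ge:
  fixes f :: "'a \<Rightarrow> real" and y :: real
  assumes "finite S" "S \<noteq> {}" "\<And>s. s \<in> S \<Longrightarrow> 0 \<le> f s" "0 < y" "card S * y \<le> (\<Sum>s\<in>S. f s)"
  shows "card S * y ^ n \<le> (\<Sum>s\<in>S. f s ^ n)"
proof -
  have b: "y ^ n * (1 + n * (f s / y - 1)) \<le> f s ^ n" if "s \<in> S" for s
  proof -
    have "1 + n * (f s / y - 1) \<le> (1 + (f s / y - 1)) ^ n"
      using assms(3)[OF that] assms(4) by (intro Bernoulli_inequality) auto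
    then have "y ^ n * (1 + n * (f s / y - 1)) \<le> y ^ n * (f s / y) ^ n"
      using assms(4) by (intro mult_left_mono) auto
    also have "\<dots> = f s ^ n" using assms(4) by (simp add: power_mult_distrib[symmetric])
    finally show ?thesis .
  qed
  have "card S \<le> (\<Sum>s\<in>S. f s) / y" using assms(4,5) by (simp add: field_simps)
  then have "0 \<le> y ^ n * (n * ((\<Sum>s\<in>S. f s) / y - card S))" using assms(4) by simp
  then have "card S * y ^ n \<le> y ^ n * (card S + n * ((\<Sum>s\<in>S. f s) / y - card S))"
    by (simp only: distrib_left) (simp add: mult.commute)
  also have "\<dots> = (\<Sum>s\<in>S. y ^ n * (1 + n * (f s / y - 1)))"
    by (simp add: sum_distrib_left[symmetric] sum.distrib sum_subtractf sum_divide_distrib[symmetric])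
  also have "\<dots> \<le> (\<Sum>s\<in>S. f s ^ n)" by (intro sum_mono b)
  finally show ?thesis .
qed

text \<open>For a fixed threshold the labels of \<open>v\<close> are hit independently with
  probability \<open>p\<close>, so any given label is the only hit with probability
  \<open>p * (1 - p) ^ (q - 1)\<close>, which is at least \<open>(p * (1 - p)) ^ (q - 1)\<close>.
  Two labels disagree with probability \<open>2 * (p * (1 - p))\<close>, whose mean over the
  thresholds is at least 1/16; hence the 1/32, and convexity allows taking the power after the
  mean.\<close>

lemma round_success:
  fixes K :: "'v \<times> nat \<Rightarrow> 'v \<times> nat \<Rightarrow> real"
  assumes cov: "covariance_on K ({v} \<times> {..<q})" and N: "N \<ge> 1" and q: "q \<ge> 2" and V1: "1 \<le> V"
    and V: "\<And>i. i < q \<Longrightarrow> K (v, i) (v, i) = V"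
    and orth: "\<And>i j. i < q \<Longrightarrow> j < q \<Longrightarrow> i \<noteq> j \<Longrightarrow> K (v, i) (v, j) = 0"
  obtains c where "(1/32) ^ (q - 1) \<le> c" "q * c \<le> 1"
    "\<And>i. i < q \<Longrightarrow> measure_pmf.prob (round_pmf K q N {v}) {f. f v = Some i} = c"
proof -
  let ?A = "{v} \<times> {..<q}"
  let ?P = "bits (bit_cov K) (?A \<times> {..<N})"
  have VA: "\<And>a. a \<in> ?A \<Longrightarrow> K a a = V" using V by auto
  define p where "p \<tau> = hit_prob N V \<tau>" for \<tau>
  have pat: "measure_pmf.prob ?P {\<beta>. \<forall>a\<in>?A. \<tau> \<le> bit_count N \<beta> a \<longleftrightarrow> a \<in> I}
      = p \<tau> ^ card I * (1 - p \<tau>) ^ card (?A - I)" if "I \<subseteq> ?A" for I \<tau>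
    unfolding p_def using orth by (intro prob_pattern[OF cov N VA _ _ that]) auto
  have pb: "0 \<le> p \<tau>" "p \<tau> \<le> 1" for \<tau>
    using hit_prob_bounds[OF cov N VA] q unfolding p_def by (auto simp: lessThan_empty_iff)
  define c where "c = (\<Sum>\<tau>\<in>{1..N}. p \<tau> * (1 - p \<tau>) ^ (q - 1)) / N"
  have pr: "measure_pmf.prob ?P {\<beta>. hits q N \<tau> \<beta> v = {i}} = p \<tau> * (1 - p \<tau>) ^ (q - 1)" if "i < q" for i \<tau>
  proof -
    have "{\<beta>. hits q N \<tau> \<beta> v = {i}} = {\<beta>. \<forall>a\<in>?A. \<tau> \<le> bit_count N \<beta> a \<longleftrightarrow> a \<in> {(v, i)}}"
      using that by (auto simp: hits_def)
    moreover have "card (?A - {(v, i)}) = q - 1" using that by (subst card_Diff_subset) auto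
    ultimately show ?thesis using pat[of "{(v, i)}" \<tau>] that by simp
  qed
  have prob: "measure_pmf.prob (round_pmf K q N {v}) {f. f v = Some i} = c" if "i < q" for i
  proof -
    have "measure_pmf.prob (round_pmf K q N {v}) {f. f v = Some i}
      = measure_pmf.prob (pair_pmf (pmf_of_set {1..N}) ?P) {p. hits q N (fst p) (snd p) v = {i}}"
      unfolding round_pmf_def by (simp add: pick_eq_Some vimage_def)
    also have "\<dots> = c" unfolding c_def using N by (subst prob_pair_pmf_of_set) (simp_all add: pr[OF that])
    finally show ?thesis .
  qed
  have "q * c = (\<Sum>i<q. measure_pmf.prob (round_pmf K q N {v}) {f. f v = Some i})" by (simp add: prob)
  also have "\<dots> \<le> 1"
  proof -
    have "measure_pmf.prob (round_pmf K q N {v}) {f. f v = None} +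
       (\<Sum>i<q. measure_pmf.prob (round_pmf K q N {v}) {f. f v = Some i}) = 1"
      by (rule prob_None_or_Some) (rule set_round_pmf, auto)
    moreover have "0 \<le> measure_pmf.prob (round_pmf K q N {v}) {f. f v = None}" by simp
    ultimately show ?thesis by linarith
  qed
  finally have qc: "q * c \<le> 1" .
  \<comment> \<open>Restricted to two labels, disagreement is the union of two disjoint patterns;
    this links the second-moment bound with \<open>p\<close>.\<close>
  have dis: "measure_pmf.prob ?P {\<beta>. (\<tau> \<le> bit_count N \<beta> (v, 0)) \<noteq> (\<tau> \<le> bit_count N \<beta> (v, 1))} = 2 * (p \<tau> * (1 - p \<tau>))" for \<tau>
  proof -
    let ?C = "{(v, 0::nat), (v, 1)}"
    have C: "?C \<subseteq> ?A" using q by auto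
    have cov': "covariance_on K ?C" by (rule covariance_on_subset[OF cov C])
    have VC: "\<And>a. a \<in> ?C \<Longrightarrow> K a a = V" using C VA by blast
    have oC: "\<And>a b. a \<in> ?C \<Longrightarrow> b \<in> ?C \<Longrightarrow> a \<noteq> b \<Longrightarrow> K a b = 0" using q orth by auto
    have pat': "measure_pmf.prob (bits (bit_cov K) (?C \<times> {..<N})) {\<beta>. \<forall>a\<in>?C. \<tau> \<le> bit_count N \<beta> a \<longleftrightarrow> a \<in> I}
        = p \<tau> ^ card I * (1 - p \<tau>) ^ card (?C - I)" if "I \<subseteq> ?C" for I \<tau>
      unfolding p_def by (rule prob_pattern[OF cov' N VC _ oC that]) auto
    have M1: "measure_pmf.prob ?P {\<beta>. (\<tau> \<le> bit_count N \<beta> (v, 0)) \<noteq> (\<tau> \<le> bit_count N \<beta> (v, 1))}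
      = measure_pmf.prob (bits (bit_cov K) (?C \<times> {..<N})) {\<beta>. (\<tau> \<le> bit_count N \<beta> (v, 0)) \<noteq> (\<tau> \<le> bit_count N \<beta> (v, 1))}"
    proof (rule prob_bits_marginal[OF covariance_on_bit_cov[OF cov]])
      show "?C \<times> {..<N} \<subseteq> ?A \<times> {..<N}" using C by auto
      have "bit_count N (\<beta> \<inter> ?C \<times> {..<N}) a = bit_count N \<beta> a" if "a \<in> ?C" for a \<beta>
        unfolding bit_count_def using that by (intro arg_cong[where f=card]) auto
      then show "((\<tau> \<le> bit_count N \<beta> (v, 0)) \<noteq> (\<tau> \<le> bit_count N \<beta> (v, 1)))
        = ((\<tau> \<le> bit_count N (\<beta> \<inter> ?C \<times> {..<N}) (v, 0)) \<noteq> (\<tau> \<le> bit_count N (\<beta> \<inter> ?C \<times> {..<N}) (v, 1)))" for \<beta>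
        by simp
    qed
    have M2: "{\<beta>. (\<tau> \<le> bit_count N \<beta> (v, 0)) \<noteq> (\<tau> \<le> bit_count N \<beta> (v, 1))}
      = {\<beta>. \<forall>a\<in>?C. \<tau> \<le> bit_count N \<beta> a \<longleftrightarrow> a \<in> {(v, 0)}} \<union> {\<beta>. \<forall>a\<in>?C. \<tau> \<le> bit_count N \<beta> a \<longleftrightarrow> a \<in> {(v, 1)}}"
      by auto
    have M3: "measure_pmf.prob (bits (bit_cov K) (?C \<times> {..<N})) ({\<beta>. \<forall>a\<in>?C. \<tau> \<le> bit_count N \<beta> a \<longleftrightarrow> a \<in> {(v, 0)}} \<union> {\<beta>. \<forall>a\<in>?C. \<tau> \<le> bit_count N \<beta> a \<longleftrightarrow> a \<in> {(v, 1)}})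
      = measure_pmf.prob (bits (bit_cov K) (?C \<times> {..<N})) {\<beta>. \<forall>a\<in>?C. \<tau> \<le> bit_count N \<beta> a \<longleftrightarrow> a \<in> {(v, 0)}}
      + measure_pmf.prob (bits (bit_cov K) (?C \<times> {..<N})) {\<beta>. \<forall>a\<in>?C. \<tau> \<le> bit_count N \<beta> a \<longleftrightarrow> a \<in> {(v, 1)}}"
      by (intro measure_pmf.finite_measure_Union) auto
    have "?C - {(v, 0)} = {(v, 1)}" "?C - {(v, 1)} = {(v, 0)}" by auto
    then have M4: "measure_pmf.prob (bits (bit_cov K) (?C \<times> {..<N})) {\<beta>. \<forall>a\<in>?C. \<tau> \<le> bit_count N \<beta> a \<longleftrightarrow> a \<in> {(v, i)}}
        = p \<tau> * (1 - p \<tau>)" if "i = 0 \<or> i = 1" for i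
      using that pat'[of "{(v, i)}" \<tau>] by auto
    show ?thesis by (subst M1, subst M2, subst M3) (use M4[of 0] M4[of 1] in simp)
  qed
  have "N / 16 \<le> (\<Sum>\<tau>\<in>{1..N}. measure_pmf.prob ?P {\<beta>. (\<tau> \<le> bit_count N \<beta> (v, 0)) \<noteq> (\<tau> \<le> bit_count N \<beta> (v, 1))})"
    using q orth by (intro sum_prob_disagree_ge[OF cov N VA]) (auto intro: V1)
  then have "card {1..N} * (1 / 32) \<le> (\<Sum>\<tau>\<in>{1..N}. p \<tau> * (1 - p \<tau>))"
    unfolding dis by (simp add: sum_distrib_left[symmetric])
  then have "card {1..N} * (1 / 32) ^ (q - 1) \<le> (\<Sum>\<tau>\<in>{1..N}. (p \<tau> * (1 - p \<tau>)) ^ (q - 1))"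
    using N pb by (intro average_power_ge) auto
  also have "\<dots> \<le> (\<Sum>\<tau>\<in>{1..N}. p \<tau> * (1 - p \<tau>) ^ (q - 1))"
  proof (intro sum_mono)
    fix \<tau>
    have "p \<tau> ^ (q - 1) \<le> p \<tau> ^ 1" using pb q by (intro power_decreasing) auto
    then show "(p \<tau> * (1 - p \<tau>)) ^ (q - 1) \<le> p \<tau> * (1 - p \<tau>) ^ (q - 1)"
      using pb[of \<tau>] by (simp add: power_mult_distrib mult_right_mono)
  qed
  finally have "(1/32) ^ (q - 1) \<le> c" unfolding c_def using N by (simp add: field_simps)
  then show thesis using that[OF _ qc prob] by blast
qed

lemma add_mod_cancel:
  fixes i j s q :: nat
  assumes "(i + s) mod q = (j + s) mod q" "i < q" "j < q"
  shows "i = j"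
proof -
  obtain a b where ab: "i + s + q * a = j + s + q * b" using assms(1) unfolding nat_mod_eq_iff by blast
  then have "(i + q * a) mod q = (j + q * b) mod q" by (simp add: add.commute add.left_commute)
  then show "i = j" using assms(2,3) by simp
qed

text \<open>Adding \<open>s\<close> modulo \<open>q\<close> permutes the labels. If every label
  \<open>i\<close> of \<open>u\<close> passes the threshold exactly when the label
  \<open>i + s\<close> of \<open>v\<close> does, then the hit sets are translates of each other and
  \<open>pick\<close> returns translated labels. A union bound over the \<open>q\<close> labels
  remains.\<close>

lemma round_not_shifted:
  fixes K :: "'v \<times> nat \<Rightarrow> 'v \<times> nat \<Rightarrow> real"
  assumes cov: "covariance_on K ({u, v} \<times> {..<q})" and N: "N \<ge> 1" and uv: "u \<noteq> v" and q: "q \<ge> 1"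
    and V: "\<And>x i. i < q \<Longrightarrow> x \<in> {u, v} \<Longrightarrow> K (x, i) (x, i) = V"
    and \<rho>: "\<And>i. i < q \<Longrightarrow> K (u, i) (v, (i + s) mod q) = \<rho>" "0 \<le> \<rho>" "\<rho> \<le> V" and t: "t > 0"
  shows "measure_pmf.prob (round_pmf K q N {u, v}) {f. \<not> shifted q s (f u) (f v)}
    \<le> q * (t + (2 / N + (V - \<rho>) / 4) / t)"
proof -
  let ?A = "{u, v} \<times> {..<q}"
  let ?P = "bits (bit_cov K) (?A \<times> {..<N})"
  have VA: "\<And>a. a \<in> ?A \<Longrightarrow> K a a = V" using V by auto
  define D where "D \<tau> i = {\<beta>. (\<tau> \<le> bit_count N \<beta> (u, i)) \<noteq> (\<tau> \<le> bit_count N \<beta> (v, (i + s) mod q))}" for \<tau> i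
  have inj: "inj_on (\<lambda>i. (i + s) mod q) {..<q}"
    by (auto intro: inj_onI add_mod_cancel)
  have img: "(\<lambda>i. (i + s) mod q) ` {..<q} = {..<q}"
    using q by (intro card_subset_eq) (auto simp: card_image[OF inj])
  have ns: "\<exists>i<q. \<beta> \<in> D \<tau> i" if ns: "\<not> shifted q s (pick (hits q N \<tau> \<beta> u)) (pick (hits q N \<tau> \<beta> v))" for \<tau> \<beta>
  proof (rule ccontr)
    let ?h = "\<lambda>i. (i + s) mod q"
    assume "\<not> (\<exists>i<q. \<beta> \<in> D \<tau> i)"
    then have eq: "\<tau> \<le> bit_count N \<beta> (u, i) \<longleftrightarrow> \<tau> \<le> bit_count N \<beta> (v, ?h i)" if "i < q" for i
      using that by (auto simp: D_def)
    have hv: "hits q N \<tau> \<beta> v = ?h ` hits q N \<tau> \<beta> u"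
    proof (rule set_eqI)
      fix j
      show "j \<in> hits q N \<tau> \<beta> v \<longleftrightarrow> j \<in> ?h ` hits q N \<tau> \<beta> u"
      proof
        assume j: "j \<in> hits q N \<tau> \<beta> v"
        then have "j \<in> ?h ` {..<q}" unfolding img by (simp add: hits_def)
        then obtain i where "i < q" "j = ?h i" by auto
        then show "j \<in> ?h ` hits q N \<tau> \<beta> u" using j eq[of i] by (auto simp: hits_def)
      next
        assume "j \<in> ?h ` hits q N \<tau> \<beta> u"
        then obtain i where "i \<in> hits q N \<tau> \<beta> u" "j = ?h i" by auto
        then show "j \<in> hits q N \<tau> \<beta> v" using eq[of i] q by (simp add: hits_def)
      qed
    qed
    have sub: "hits q N \<tau> \<beta> u \<subseteq> {..<q}" by (auto simp: hits_def)
    have "pick (?h ` E) = map_option ?h (pick E)" if "E \<subseteq> {..<q}" for E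
    proof (cases "is_singleton E")
      case True
      then obtain i where "E = {i}" by (auto simp: is_singleton_def)
      then show ?thesis by (simp add: pick_def)
    next
      case False
      have "card (?h ` E) = card E" by (intro card_image inj_on_subset[OF inj that])
      then have "\<not> is_singleton (?h ` E)" using False by (simp add: is_singleton_altdef)
      then show ?thesis using False by (simp add: pick_def)
    qed
    from this[OF sub] ns show False by (simp add: shifted_def hv)
  qed
  have "measure_pmf.prob (round_pmf K q N {u, v}) {f. \<not> shifted q s (f u) (f v)}
      = measure_pmf.prob (pair_pmf (pmf_of_set {1..N}) ?P)
         {p. \<not> shifted q s (pick (hits q N (fst p) (snd p) u)) (pick (hits q N (fst p) (snd p) v))}"
    unfolding round_pmf_def by (simp add: vimage_def)
  also have "\<dots> = (\<Sum>\<tau>\<in>{1..N}. measure_pmf.prob ?P {\<beta>. \<not> shifted q s (pick (hits q N \<tau> \<beta> u)) (pick (hits q N \<tau> \<beta> v))}) / N"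
    using N by (subst prob_pair_pmf_of_set) auto
  also have "\<dots> \<le> (\<Sum>\<tau>\<in>{1..N}. \<Sum>i<q. measure_pmf.prob ?P (D \<tau> i)) / N"
  proof (rule divide_right_mono, rule sum_mono)
    fix \<tau>
    have "measure_pmf.prob ?P {\<beta>. \<not> shifted q s (pick (hits q N \<tau> \<beta> u)) (pick (hits q N \<tau> \<beta> v))}
       \<le> measure_pmf.prob ?P (\<Union>i<q. D \<tau> i)"
      using ns by (intro measure_pmf.finite_measure_mono) auto
    also have "\<dots> \<le> (\<Sum>i<q. measure_pmf.prob ?P (D \<tau> i))"
      by (intro measure_pmf.finite_measure_subadditive_finite) auto
    finally show "measure_pmf.prob ?P {\<beta>. \<not> shifted q s (pick (hits q N \<tau> \<beta> u)) (pick (hits q N \<tau> \<beta> v))}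
       \<le> (\<Sum>i<q. measure_pmf.prob ?P (D \<tau> i))" .
  qed simp
  also have "\<dots> = (\<Sum>i<q. \<Sum>\<tau>\<in>{1..N}. measure_pmf.prob ?P (D \<tau> i)) / N"
    by (subst sum.swap) (rule refl)
  also have "\<dots> \<le> (\<Sum>i<q. N * (t + (2 / N + (V - \<rho>) / 4) / t)) / N"
  proof (rule divide_right_mono, rule sum_mono)
    fix i assume "i \<in> {..<q}"
    then have i: "i < q" by simp
    have m: "(i + s) mod q < q" using q by simp
    define b where "b = (v, (i + s) mod q)"
    have b: "b \<in> ?A" "(u, i) \<in> ?A" "(u, i) \<noteq> b" using i m uv by (auto simp: b_def)
    have k: "K (u, i) b = \<rho>" using \<rho>(1)[OF i] by (simp add: b_def)
    have "0 \<le> K (u, i) b" "K (u, i) b \<le> V" using \<rho>(2,3) by (simp_all add: k)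
    from sum_prob_disagree_le[OF cov N VA b(2,1,3) this t]
    have "(\<Sum>\<tau>\<in>{1..N}. measure_pmf.prob ?P (D \<tau> i)) \<le> N * (t + (2 / N + (V - \<rho>) / 4) / t)"
      by (simp add: D_def b_def[symmetric] k)
    then show "(\<Sum>\<tau>\<in>{1..N}. measure_pmf.prob ?P (D \<tau> i)) \<le> N * (t + (2 / N + (V - \<rho>) / 4) / t)" .
  qed simp
  finally show ?thesis using N by simp
qed

section \<open>Sherali-Adams solutions from kernels\<close>

lemma finite_assignments: "finite S \<Longrightarrow> finite (assignments T S)"
  by (simp add: assignments_def finite_PiE)

text \<open>The constraints ask for distributions with consistent marginals: the extensions of
  \<open>\<beta>\<close> by assignments on \<open>S' - S\<close> form the fibre of the restriction
  map over \<open>\<beta>\<close>.\<close>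

lemma sa_feasible_pmf:
  assumes fin: "finite (verts I)"
    and sub: "\<And>S. S \<subseteq> verts I \<Longrightarrow> card S \<le> r \<Longrightarrow> set_pmf (L S) \<subseteq> assignments T S"
    and cons: "\<And>S S'. S \<subseteq> S' \<Longrightarrow> S' \<subseteq> verts I \<Longrightarrow> card S' \<le> r \<Longrightarrow>
      map_pmf (\<lambda>f. restrict f S) (L S') = L S"
  shows "sa_feasible T r I (\<lambda>S. pmf (L S))"
  unfolding sa_feasible_def
proof (intro conjI allI impI ballI)
  fix S \<alpha> assume S: "S \<subseteq> verts I \<and> card S \<le> r"
  show "0 \<le> pmf (L S) \<alpha>" by simp
  show "(\<Sum>\<alpha>\<in>assignments T S. pmf (L S) \<alpha>) = 1"
    using S fin sub by (intro sum_pmf_eq_1 finite_assignments) (auto dest: finite_subset)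
next
  fix S S' \<beta> assume S: "S \<subseteq> S' \<and> S' \<subseteq> verts I \<and> card S' \<le> r" and \<beta>: "\<beta> \<in> assignments T S"
  let ?X = "{\<gamma> \<in> assignments T S'. restrict \<gamma> S = \<beta>}"
  have finS': "finite S'" using S fin by (auto dest: finite_subset)
  have finX: "finite ?X" using finite_assignments[OF finS'] by simp
  have setS': "set_pmf (L S') \<subseteq> assignments T S'" using S sub by blast
  have "pmf (L S) \<beta> = pmf (map_pmf (\<lambda>f. restrict f S) (L S')) \<beta>" using S cons by metis
  also have "\<dots> = measure_pmf.prob (L S') ((\<lambda>f. restrict f S) -` {\<beta>})" by (simp add: pmf_map)
  also have "\<dots> = measure_pmf.prob (L S') ((\<lambda>f. restrict f S) -` {\<beta>} \<inter> set_pmf (L S'))"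
    by (rule measure_Int_set_pmf[symmetric])
  also have "(\<lambda>f. restrict f S) -` {\<beta>} \<inter> set_pmf (L S') = ?X \<inter> set_pmf (L S')" using setS' by auto
  also have "measure_pmf.prob (L S') \<dots> = measure_pmf.prob (L S') ?X" by (rule measure_Int_set_pmf)
  also have "\<dots> = (\<Sum>\<gamma>\<in>?X. pmf (L S') \<gamma>)" by (rule measure_measure_pmf_finite[OF finX])
  also have "?X = (\<lambda>\<alpha>. override_on \<alpha> \<beta> S) ` assignments T (S' - S)"
  proof (intro equalityI subsetI)
    fix \<gamma> assume \<gamma>: "\<gamma> \<in> ?X"
    have "\<gamma> = override_on (restrict \<gamma> (S' - S)) \<beta> S"
    proof
      fix z
      show "\<gamma> z = override_on (restrict \<gamma> (S' - S)) \<beta> S z"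
        using \<gamma> by (cases "z \<in> S") (auto simp: override_on_def assignments_def restrict_def PiE_def extensional_def)
    qed
    moreover have "restrict \<gamma> (S' - S) \<in> assignments T (S' - S)"
      using \<gamma> by (auto simp: assignments_def)
    ultimately show "\<gamma> \<in> (\<lambda>\<alpha>. override_on \<alpha> \<beta> S) ` assignments T (S' - S)" by blast
  next
    fix \<gamma> assume "\<gamma> \<in> (\<lambda>\<alpha>. override_on \<alpha> \<beta> S) ` assignments T (S' - S)"
    then obtain \<alpha> where \<alpha>: "\<alpha> \<in> assignments T (S' - S)" "\<gamma> = override_on \<alpha> \<beta> S" by blast
    have "restrict \<gamma> S = \<beta>"
    proof
      fix z show "restrict \<gamma> S z = \<beta> z"
        using \<alpha> \<beta> by (auto simp: override_on_def assignments_def PiE_def extensional_def)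
    qed
    moreover have "\<gamma> \<in> assignments T S'" unfolding assignments_def
    proof (rule PiE_I)
      show "\<gamma> z \<in> {0..T}" if "z \<in> S'" for z
        using that \<alpha> \<beta> by (cases "z \<in> S") (auto simp: override_on_def assignments_def dest: PiE_mem)
      show "\<gamma> z = undefined" if "z \<notin> S'" for z
        using that \<alpha> S by (auto simp: override_on_def assignments_def PiE_def extensional_def)
    qed
    ultimately show "\<gamma> \<in> ?X" by simp
  qed
  also have "(\<Sum>\<gamma>\<in>(\<lambda>\<alpha>. override_on \<alpha> \<beta> S) ` assignments T (S' - S). pmf (L S') \<gamma>)
      = (\<Sum>\<alpha>\<in>assignments T (S' - S). pmf (L S') (override_on \<alpha> \<beta> S))"
  proof (subst sum.reindex)
    show "inj_on (\<lambda>\<alpha>. override_on \<alpha> \<beta> S) (assignments T (S' - S))"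
    proof (rule inj_onI)
      fix \<alpha> \<alpha>' assume a: "\<alpha> \<in> assignments T (S' - S)" "\<alpha>' \<in> assignments T (S' - S)"
        and eq: "override_on \<alpha> \<beta> S = override_on \<alpha>' \<beta> S"
      show "\<alpha> = \<alpha>'"
      proof
        fix z
        show "\<alpha> z = \<alpha>' z"
        proof (cases "z \<in> S")
          case True
          then show ?thesis using a by (simp add: assignments_def PiE_def extensional_def)
        next
          case False
          then show ?thesis using fun_cong[OF eq, of z] by (simp add: override_on_def)
        qed
      qed
    qed
  qed simp
  finally show "(\<Sum>\<alpha>\<in>assignments T (S' - S). pmf (L S') (override_on \<alpha> \<beta> S)) = pmf (L S) \<beta>" ..
qed

text \<open>Bounds the objective on the feasible set, so that the supremum in \<open>sa_opt\<close>
  dominates every feasible value. The bound \<open>r \<ge> 2\<close> places the pairs of ends under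
  the constraints.\<close>

lemma sa_objective_le_one:
  assumes I: "gmd_instance T I" and x: "sa_feasible T r I x" and r: "r \<ge> 2"
  shows "sa_objective I x \<le> 1"
proof -
  have le: "x {fst a, snd a} (arc_assignment I a) \<le> 1" if a: "a \<in> arcs I" for a
  proof -
    let ?S = "{fst a, snd a}"
    have S: "?S \<subseteq> verts I" using I a by (auto simp: gmd_instance_def)
    have c: "card ?S \<le> r" using r card_insert_le_m1[of 2 "{snd a}" "fst a"] by simp
    have ne: "fst a \<noteq> snd a" using I a by (cases a) (auto simp: gmd_instance_def irrefl_def)
    have l: "elabel I a \<in> {1..T}" using I a by (auto simp: gmd_instance_def)
    have m: "arc_assignment I a \<in> assignments T ?S"
      unfolding arc_assignment_def assignments_def using l by auto
    have nn: "\<And>\<alpha>. \<alpha> \<in> assignments T ?S \<Longrightarrow> 0 \<le> x ?S \<alpha>" and s1: "(\<Sum>\<alpha>\<in>assignments T ?S. x ?S \<alpha>) = 1"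
      using x S c unfolding sa_feasible_def by blast+
    have "x ?S (arc_assignment I a) \<le> (\<Sum>\<alpha>\<in>assignments T ?S. x ?S \<alpha>)"
      using m nn by (intro member_le_sum finite_assignments) auto
    then show ?thesis using s1 by simp
  qed
  have "sa_objective I x \<le> (\<Sum>a\<in>arcs I. weight I a * 1)"
    unfolding sa_objective_def using I le
    by (intro sum_mono mult_left_mono) (auto simp: gmd_instance_def intro: less_imp_le)
  also have "\<dots> = 1" using I by (simp add: gmd_instance_def)
  finally show ?thesis .
qed

lemma sa_opt_ge:
  assumes "gmd_instance T I" "sa_feasible T r I x" "r \<ge> 2"
  shows "sa_objective I x \<le> sa_opt T r I"
  unfolding sa_opt_def using assms sa_objective_le_one
  by (intro cSUP_upper) (auto intro!: bdd_aboveI2)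

text \<open>A vertex that is still waiting after all rounds receives the default label 0.\<close>

definition decode :: "nat option \<Rightarrow> nat" where
  "decode z = (case z of None \<Rightarrow> 0 | Some i \<Rightarrow> i)"

text \<open>Vertices with the same image under \<open>h\<close> share one label; \<open>h\<close>
  will send a vertex of the layered graph to its base vertex.\<close>

definition label_pmf ::
  "('x \<Rightarrow> 'v) \<Rightarrow> ('v \<times> nat \<Rightarrow> 'v \<times> nat \<Rightarrow> real) \<Rightarrow> nat \<Rightarrow> nat \<Rightarrow> nat \<Rightarrow> 'x set \<Rightarrow> ('x \<Rightarrow> nat) pmf" where
  "label_pmf h K q N R S = map_pmf (\<lambda>f. \<lambda>z\<in>S. decode (f (h z))) (rounds_pmf K q N R (h ` S))"

lemma label_pmf_marginal:
  assumes "covariance_on K (h ` S' \<times> {..<q})" "S \<subseteq> S'"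
  shows "map_pmf (\<lambda>f. restrict f S) (label_pmf h K q N R S') = label_pmf h K q N R S"
proof -
  have hS: "h ` S \<subseteq> h ` S'" using assms(2) by auto
  show ?thesis
    unfolding label_pmf_def rounds_pmf_marginal[OF assms(1) hS, symmetric] pmf.map_comp
    using assms(2) by (intro map_pmf_cong) (auto simp: fun_eq_iff)
qed

lemma set_label_pmf: "set_pmf (label_pmf h K (T + 1) N R S) \<subseteq> assignments T S"
proof
  fix g assume "g \<in> set_pmf (label_pmf h K (T + 1) N R S)"
  then obtain f where f: "f \<in> set_pmf (rounds_pmf K (T + 1) N R (h ` S))" "g = (\<lambda>z\<in>S. decode (f (h z)))"
    by (auto simp: label_pmf_def)
  have "decode (f (h z)) \<le> T" if "z \<in> S" for z
  proof -
    have "f (h z) \<in> insert None (Some ` {..<T + 1})" using that by (intro set_rounds_pmf[OF f(1)]) auto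
    then show ?thesis by (auto simp: decode_def)
  qed
  then show "g \<in> assignments T S" unfolding f(2) assignments_def by auto
qed

text \<open>By consistency the event \<open>f u = Some 0\<close> can be evaluated on
  \<open>{u}\<close> alone. It forces \<open>f v = Some s\<close> unless the outcome is not shifted,
  which costs the subtracted term.\<close>

lemma prob_label_arc:
  fixes K :: "'v \<times> nat \<Rightarrow> 'v \<times> nat \<Rightarrow> real"
  assumes cov: "covariance_on K ({u, v} \<times> {..<q})" and N: "N \<ge> 1" and uv: "u \<noteq> v" and q: "q \<ge> 2" and V1: "1 \<le> V"
    and V: "\<And>x i. i < q \<Longrightarrow> x \<in> {u, v} \<Longrightarrow> K (x, i) (x, i) = V"
    and orth: "\<And>i j. i < q \<Longrightarrow> j < q \<Longrightarrow> i \<noteq> j \<Longrightarrow> K (u, i) (u, j) = 0"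
    and \<rho>: "\<And>i. i < q \<Longrightarrow> K (u, i) (v, (i + s) mod q) = \<rho>" "0 \<le> \<rho>" "\<rho> \<le> V" and t: "t > 0" and s: "s < q"
  shows "(1 - (1 - (1/32) ^ (q - 1)) ^ R) / q - R * (q * (t + (2 / N + (V - \<rho>) / 4) / t))
    \<le> measure_pmf.prob (rounds_pmf K q N R {u, v}) {f. f u = Some 0 \<and> f v = Some s}"
proof -
  let ?P = "rounds_pmf K q N R {u, v}"
  have cov_u: "covariance_on K ({u} \<times> {..<q})" by (rule covariance_on_subset[OF cov]) auto
  obtain c :: real where c: "(1/32) ^ (q - 1) \<le> c" "q * c \<le> 1"
    "\<And>i. i < q \<Longrightarrow> measure_pmf.prob (round_pmf K q N {u}) {f. f u = Some i} = c"
    using round_success[OF cov_u N q V1] V orth by auto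
  have "measure_pmf.prob ?P {f. f u = Some 0} = measure_pmf.prob (rounds_pmf K q N R {u}) {f. f u = Some 0}"
    by (simp add: rounds_pmf_marginal[OF cov, of "{u}", symmetric] vimage_def)
  also have "\<dots> = (1 - (1 - q * c) ^ R) / q"
    using q c by (intro prob_rounds_pmf) auto
  also have "\<dots> \<ge> (1 - (1 - (1/32) ^ (q - 1)) ^ R) / q"
  proof -
    have "0 \<le> c" using c(1) by (rule order_trans[rotated]) simp
    then have "1 * c \<le> q * c" using q by (intro mult_right_mono) auto
    then have "(1 - q * c) ^ R \<le> (1 - (1/32) ^ (q - 1)) ^ R" using c(1,2) by (intro power_mono) auto
    then show ?thesis by (intro divide_right_mono) auto
  qed
  finally have 1: "(1 - (1 - (1/32) ^ (q - 1)) ^ R) / q \<le> measure_pmf.prob ?P {f. f u = Some 0}" .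
  have "measure_pmf.prob ?P {f. f u = Some 0}
      \<le> measure_pmf.prob ?P ({f. f u = Some 0 \<and> f v = Some s} \<union> {f. \<not> shifted q s (f u) (f v)})"
    using s by (intro measure_pmf.finite_measure_mono) (auto simp: shifted_def)
  also have "\<dots> \<le> measure_pmf.prob ?P {f. f u = Some 0 \<and> f v = Some s} + measure_pmf.prob ?P {f. \<not> shifted q s (f u) (f v)}"
    by (intro measure_Un_le) auto
  finally have 2: "measure_pmf.prob ?P {f. f u = Some 0}
    \<le> measure_pmf.prob ?P {f. f u = Some 0 \<and> f v = Some s} + measure_pmf.prob ?P {f. \<not> shifted q s (f u) (f v)}" .
  have "measure_pmf.prob ?P {f. \<not> shifted q s (f u) (f v)} \<le> R * measure_pmf.prob (round_pmf K q N {u, v}) {f. \<not> shifted q s (f u) (f v)}"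
    by (intro prob_rounds_not_shifted) auto
  also have "\<dots> \<le> R * (q * (t + (2 / N + (V - \<rho>) / 4) / t))"
    using q by (intro mult_left_mono round_not_shifted[OF cov N uv _ V \<rho> t]) auto
  finally show ?thesis using 1 2 by simp
qed

text \<open>Every arc is satisfied locally with at least the same probability, and the weights sum
  to 1. A set of at most \<open>r\<close> vertices has an image of at most \<open>r\<close> points
  under \<open>h\<close>, so positivity on small sets suffices.\<close>

lemma sa_opt_ge_of_kernel:
  fixes K :: "'v \<times> nat \<Rightarrow> 'v \<times> nat \<Rightarrow> real" and I :: "'x gmd_instance" and N R :: nat and V t \<rho> :: real
  assumes I: "gmd_instance T I" and T: "T \<ge> 1" and r: "r \<ge> 2" and N: "N \<ge> 1" and V1: "1 \<le> V" and t: "t > 0"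
    and cov: "\<And>S. S \<subseteq> h ` verts I \<Longrightarrow> card S \<le> r \<Longrightarrow> covariance_on K (S \<times> {..<T + 1})"
    and V: "\<And>v i. i < T + 1 \<Longrightarrow> v \<in> h ` verts I \<Longrightarrow> K (v, i) (v, i) = V"
    and orth: "\<And>v i j. i < T + 1 \<Longrightarrow> j < T + 1 \<Longrightarrow> i \<noteq> j \<Longrightarrow> v \<in> h ` verts I \<Longrightarrow> K (v, i) (v, j) = 0"
    and \<rho>: "\<And>a i. a \<in> arcs I \<Longrightarrow> i < T + 1 \<Longrightarrow> K (h (fst a), i) (h (snd a), (i + elabel I a) mod (T + 1)) = \<rho>"
      "0 \<le> \<rho>" "\<rho> \<le> V"
    and ne: "\<And>a. a \<in> arcs I \<Longrightarrow> h (fst a) \<noteq> h (snd a)"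
  shows "(1 - (1 - (1/32) ^ T) ^ R) / (T + 1) - R * ((T + 1) * (t + (2 / N + (V - \<rho>) / 4) / t)) \<le> sa_opt T r I"
proof -
  let ?q = "T + 1"
  define L where "L = label_pmf h K ?q N R"
  have covh: "covariance_on K (h ` S \<times> {..<?q})" if "S \<subseteq> verts I" "card S \<le> r" for S
  proof (rule cov)
    have "finite S" using that(1) I by (auto simp: gmd_instance_def dest: finite_subset)
    then show "card (h ` S) \<le> r" using card_image_le[of S h] that(2) by linarith
  qed (use that in auto)
  have feas: "sa_feasible T r I (\<lambda>S. pmf (L S))"
    unfolding L_def
  proof (rule sa_feasible_pmf)
    show "finite (verts I)" using I by (simp add: gmd_instance_def)
    show "set_pmf (label_pmf h K ?q N R S) \<subseteq> assignments T S" for S by (rule set_label_pmf)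
    show "map_pmf (\<lambda>f. restrict f S) (label_pmf h K ?q N R S') = label_pmf h K ?q N R S"
      if "S \<subseteq> S'" "S' \<subseteq> verts I" "card S' \<le> r" for S S'
      by (rule label_pmf_marginal[OF covh[OF that(2,3)] that(1)])
  qed
  let ?c = "(1 - (1 - (1/32) ^ T) ^ R) / (real T + 1) - R * ((real T + 1) * (t + (2 / N + (V - \<rho>) / 4) / t))"
  have arc: "?c \<le> pmf (L {fst a, snd a}) (arc_assignment I a)" if a: "a \<in> arcs I" for a
  proof -
    let ?u = "h (fst a)" and ?v = "h (snd a)" and ?s = "elabel I a"
    have S: "{fst a, snd a} \<subseteq> verts I" using I a by (auto simp: gmd_instance_def)
    have c2: "card {fst a, snd a} \<le> r" using r card_insert_le_m1[of 2 "{snd a}" "fst a"] by simp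
    have "?s \<in> {1..T}" using I a by (auto simp: gmd_instance_def)
    then have s: "?s < ?q" by simp
    have "?c \<le> measure_pmf.prob (rounds_pmf K ?q N R {?u, ?v}) {f. f ?u = Some 0 \<and> f ?v = Some ?s}"
    proof -
      have cov2: "covariance_on K ({?u, ?v} \<times> {..<?q})" using covh[OF S c2] by simp
      have V2: "K (x, i) (x, i) = V" if "i < ?q" "x \<in> {?u, ?v}" for x i using that V S by auto
      have orth2: "K (?u, i) (?u, j) = 0" if "i < ?q" "j < ?q" "i \<noteq> j" for i j using that orth S by auto
      have q2: "2 \<le> ?q" using T by simp
      show ?thesis
        using prob_label_arc[OF cov2 N ne[OF a] q2 V1 V2 orth2 \<rho>(1)[OF a] \<rho>(2,3) t s, of R] by (simp add: add.commute)
    qed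
    \<comment> \<open>Only an inclusion, since a waiting tail is decoded as 0 as well.\<close>
    also have "\<dots> \<le> measure_pmf.prob (rounds_pmf K ?q N R {?u, ?v})
        ((\<lambda>f. \<lambda>z\<in>{fst a, snd a}. decode (f (h z))) -` {arc_assignment I a})"
      using ne[OF a] by (intro measure_pmf.finite_measure_mono)
        (auto simp: arc_assignment_def decode_def restrict_def fun_eq_iff)
    also have "\<dots> = pmf (L {fst a, snd a}) (arc_assignment I a)"
      by (simp add: L_def label_pmf_def pmf_map)
    finally show ?thesis .
  qed
  have "?c = (\<Sum>a\<in>arcs I. weight I a * ?c)"
    using I by (simp add: gmd_instance_def sum_distrib_right[symmetric])
  also have "\<dots> \<le> sa_objective I (\<lambda>S. pmf (L S))"
    unfolding sa_objective_def using I
    by (intro sum_mono mult_left_mono arc) (auto simp: gmd_instance_def intro: less_imp_le)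
  also have "\<dots> \<le> sa_opt T r I" by (rule sa_opt_ge[OF I feas r])
  finally show ?thesis .
qed

section \<open>Paths and percolation\<close>

definition is_path :: "('a \<Rightarrow> 'a \<Rightarrow> bool) \<Rightarrow> 'a list \<Rightarrow> bool" where
  "is_path adj p \<longleftrightarrow> p \<noteq> [] \<and> distinct p \<and> successively adj p"

text \<open>The minimum is 3 because under a symmetric relation any edge, traversed back and forth,
  would pass as a cycle with two vertices.\<close>

definition no_short_cycle :: "('a \<Rightarrow> 'a \<Rightarrow> bool) \<Rightarrow> nat \<Rightarrow> bool" where
  "no_short_cycle adj m \<longleftrightarrow>
     \<not> (\<exists>c. 3 \<le> length c \<and> length c \<le> m \<and> distinct c \<and> successively adj c \<and> adj (last c) (hd c))"

lemma successively_rev_sym: "symp adj \<Longrightarrow> successively adj (rev p) = successively adj p"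
  by (induction p) (auto simp: successively_append_iff successively_Cons last_rev dest: sympD)

lemma is_path_rev: "symp adj \<Longrightarrow> is_path adj p \<Longrightarrow> is_path adj (rev p)"
  using successively_rev_sym[of adj p] by (simp add: is_path_def del: successively_rev)

text \<open>If the paths differ after a common start, follow the first up to its first meeting with the
  second and return along the second: this is a short cycle.\<close>
lemma path_unique:
  assumes "symp adj" "no_short_cycle adj (2 * l)"
    and "is_path adj p" "is_path adj p'" "hd p = hd p'" "last p = last p'"
    and "length p \<le> l + 1" "length p' \<le> l + 1"
  shows "p = p'"
  using assms(3-8)
proof (induction p arbitrary: p')
  case Nil
  then show ?case by (simp add: is_path_def)
next
  case (Cons x r)
  then obtain r' where p': "p' = x # r'" by (cases p') (auto simp: is_path_def)
  show ?case
  proof (cases "r = [] \<or> r' = []")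
    case True
    have "r = [] \<longleftrightarrow> r' = []"
      using Cons.prems(1,2,4) p' by (auto simp: is_path_def split: if_splits dest: last_in_set)
    then show ?thesis using True p' by simp
  next
    case ne: False
    then obtain y s y' s' where r: "r = y # s" "r' = y' # s'" by (meson neq_Nil_conv)
    show ?thesis
    proof (cases "y = y'")
      case True
      have "r = r'"
        using Cons.prems p' r True by (intro Cons.IH) (auto simp: is_path_def successively_Cons)
      then show ?thesis using p' by simp
    next
      case False
      have last: "last r \<in> set r'" using Cons.prems(4) p' ne by (metis last_ConsR last_in_set)
      then have "\<exists>z\<in>set r. z \<in> set r'" using ne last_in_set[of r] by blast
      then obtain ps z rest where ps: "r = ps @ z # rest" "z \<in> set r'" "\<forall>w\<in>set ps. w \<notin> set r'"
        using split_list_first_prop[of r "\<lambda>z. z \<in> set r'"] by blast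
      from split_list[OF ps(2)] obtain qs rest' where qs: "r' = qs @ z # rest'" by blast
      let ?c = "(x # ps) @ z # rev qs"
      have s1: "successively adj ((x # ps @ [z]) @ rest)" and s2: "successively adj ((x # qs @ [z]) @ rest')"
        using Cons.prems(1,2) p' ps(1) qs by (simp_all add: is_path_def)
      then have s: "successively adj (x # ps @ [z])" "successively adj (x # qs @ [z])"
        unfolding successively_append_iff by blast+
      have "successively adj (rev (x # qs @ [z]))" using s(2) assms(1) by (simp only: successively_rev_sym)
      moreover have "rev (x # qs @ [z]) = z # rev qs @ [x]" by simp
      ultimately have s3: "successively adj (z # rev qs @ [x])" by metis
      have d: "distinct (x # ps @ z # rest)" "distinct (x # qs @ z # rest')"
        using Cons.prems(1,2) p' ps(1) qs by (simp_all add: is_path_def)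
      have "distinct ?c" using d ps(3) qs by auto
      moreover have a: "successively adj (x # ps)" "adj (last (x # ps)) z"
        using s(1) successively_append_iff[of adj "x # ps" "[z]"] by simp_all
      have b: "successively adj (z # rev qs)" "adj (last (z # rev qs)) x"
        using s3 successively_append_iff[of adj "z # rev qs" "[x]"] by simp_all
      have "successively adj ?c"
        unfolding successively_append_iff using a b by simp
      moreover have "adj (last ?c) (hd ?c)" using b(2) by simp
      moreover have "3 \<le> length ?c"
      proof (rule ccontr)
        assume "\<not> 3 \<le> length ?c"
        then have "ps = []" "qs = []" by (simp_all add: Suc_le_eq)
        then show False using False r ps(1) qs by simp
      qed
      \<comment> \<open>The two pieces from \<open>x\<close> to \<open>z\<close> have at most
        \<open>l + 1\<close> vertices each and share \<open>x\<close> and \<open>z\<close>.\<close>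
      moreover have "length ?c \<le> 2 * l"
        using Cons.prems(5,6) p' ps(1) qs by simp
      ultimately show ?thesis using assms(2) unfolding no_short_cycle_def by blast
    qed
  qed
qed

fun pedges :: "'a list \<Rightarrow> 'a set set" where
  "pedges (x # y # r) = insert {x, y} (pedges (y # r))"
| "pedges _ = {}"

lemma pedges_vertices: "e \<in> pedges p \<Longrightarrow> e \<subseteq> set p"
  by (induction p rule: pedges.induct) auto

lemma finite_pedges: "finite (pedges p)"
  by (induction p rule: pedges.induct) auto

lemma card_pedges: "distinct p \<Longrightarrow> card (pedges p) = length p - 1"
proof (induction p rule: pedges.induct)
  case (1 x y r)
  have "{x, y} \<notin> pedges (y # r)" using pedges_vertices[of "{x, y}" "y # r"] 1(2) by auto
  then show ?case using 1 by (simp add: finite_pedges)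
qed auto

lemma successively_pedges: "successively (\<lambda>x y. {x, y} \<in> F) p \<longleftrightarrow> pedges p \<subseteq> F"
  by (induction p rule: pedges.induct) auto

lemma pedges_adj: "symp adj \<Longrightarrow> successively adj p \<Longrightarrow> {a, b} \<in> pedges p \<Longrightarrow> adj a b"
  by (induction p rule: pedges.induct) (auto simp: doubleton_eq_iff dest: sympD)

lemma last_in_pedges: "2 \<le> length p \<Longrightarrow> last p \<in> \<Union> (pedges p)"
proof (induction p rule: pedges.induct)
  case (1 x y r)
  show ?case
  proof (cases "r = []")
    case False
    then have "last (y # r) \<in> \<Union> (pedges (y # r))" using 1 by (cases r) auto
    moreover have "last (x # y # r) = last (y # r)" by simp
    ultimately show ?thesis unfolding pedges.simps(1) by (metis UnionE UnionI insertCI)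
  qed simp
qed simp_all

section \<open>Connectivity through open edges\<close>

definition connected_in :: "'a set set \<Rightarrow> 'a \<Rightarrow> 'a \<Rightarrow> bool" where
  "connected_in F = (\<lambda>x y. {x, y} \<in> F)\<^sup>*\<^sup>*"

lemma connected_in_refl: "connected_in F x x"
  by (simp add: connected_in_def)

lemma connected_in_trans: "connected_in F x y \<Longrightarrow> connected_in F y z \<Longrightarrow> connected_in F x z"
  by (simp add: connected_in_def)

lemma connected_in_sym: "connected_in F x y \<Longrightarrow> connected_in F y x"
  unfolding connected_in_def by (rule sympD[OF symp_rtranclp]) (auto intro: sympI simp: insert_commute)

text \<open>A path is extended edge by edge. When the new vertex already lies on it, the path is cut
  off there, which keeps its vertices distinct.\<close>

lemma connected_in_path:
  assumes "connected_in F x y"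
  obtains p where "is_path (\<lambda>x y. {x, y} \<in> F) p" "hd p = x" "last p = y"
proof -
  let ?adj = "\<lambda>x y. {x, y} \<in> F"
  have "\<exists>p. is_path ?adj p \<and> hd p = x \<and> last p = y"
    using assms unfolding connected_in_def
  proof (induction rule: rtranclp_induct)
    case base
    show ?case by (rule exI[of _ "[x]"]) (simp add: is_path_def)
  next
    case (step y z)
    then obtain p where p: "is_path ?adj p" "hd p = x" "last p = y" by blast
    show ?case
    proof (cases "z \<in> set p")
      case True
      then obtain a b where ab: "p = a @ z # b" by (meson split_list)
      have "is_path ?adj (a @ [z])" using p(1) unfolding ab is_path_def
        by (auto simp: successively_append_iff)
      moreover have "hd (a @ [z]) = x" using p(2) ab by (cases a) auto
      ultimately show ?thesis by (intro exI[of _ "a @ [z]"]) simp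
    next
      case False
      then have "is_path ?adj (p @ [z])" using p(1,3) step(2) by (simp add: is_path_def successively_append_iff)
      moreover have "hd (p @ [z]) = x" using p(1,2) by (simp add: is_path_def)
      ultimately show ?thesis by (intro exI[of _ "p @ [z]"]) simp
    qed
  qed
  then show thesis using that by blast
qed

lemma path_connected_in:
  assumes "p \<noteq> []" "pedges p \<subseteq> F" shows "connected_in F (hd p) (last p)"
  using assms
proof (induction p rule: pedges.induct)
  case (1 x y r)
  then have "connected_in F y (last (y # r))" by auto
  moreover have "connected_in F x y" using 1(3) by (auto simp: connected_in_def)
  ultimately show ?case using connected_in_trans by fastforce
qed (auto simp: connected_in_refl)

text \<open>Probability that \<open>F\<close> is exactly the set of open edges in bond percolation
  on \<open>H\<close> with parameter \<open>\<rho>\<close>.\<close>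

definition open_weight :: "real \<Rightarrow> 'e set \<Rightarrow> 'e set \<Rightarrow> real" where
  "open_weight \<rho> H F = \<rho> ^ card F * (1 - \<rho>) ^ card (H - F)"

lemma open_weight_nonneg: "0 \<le> \<rho> \<Longrightarrow> \<rho> \<le> 1 \<Longrightarrow> 0 \<le> open_weight \<rho> H F"
  by (simp add: open_weight_def)

text \<open>The edges outside \<open>P\<close> sum out, by induction on \<open>H\<close>. With
  \<open>P\<close> empty this is the total mass 1.\<close>

lemma sum_open_weight_superset:
  assumes "finite H" "P \<subseteq> H"
  shows "(\<Sum>F\<in>Pow H. open_weight \<rho> H F * of_bool (P \<subseteq> F)) = \<rho> ^ card P"
  using assms
proof (induction H arbitrary: P rule: finite_induct)
  case empty
  then show ?case by (simp add: open_weight_def)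
next
  case (insert e H)
  have w1: "open_weight \<rho> (insert e H) F = (1 - \<rho>) * open_weight \<rho> H F" if "F \<in> Pow H" for F
  proof -
    have "insert e H - F = insert e (H - F)" using that insert.hyps(2) by auto
    then show ?thesis using insert.hyps by (simp add: open_weight_def)
  qed
  have w2: "open_weight \<rho> (insert e H) (insert e F) = \<rho> * open_weight \<rho> H F" if "F \<in> Pow H" for F
  proof -
    have "insert e H - insert e F = H - F" "e \<notin> F" "finite F"
      using that insert.hyps by (auto dest: finite_subset)
    then show ?thesis by (simp add: open_weight_def)
  qed
  have "(\<Sum>F\<in>Pow (insert e H). open_weight \<rho> (insert e H) F * of_bool (P \<subseteq> F))
    = (\<Sum>F\<in>Pow H. (1 - \<rho>) * open_weight \<rho> H F * of_bool (P \<subseteq> F) + \<rho> * open_weight \<rho> H F * of_bool (P \<subseteq> insert e F))"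
    unfolding sum_Pow_insert[OF insert.hyps]
    by (intro sum.cong refl) (simp only: w1 w2)
  also have "(\<Sum>F\<in>Pow H. (1 - \<rho>) * open_weight \<rho> H F * of_bool (P \<subseteq> F) + \<rho> * open_weight \<rho> H F * of_bool (P \<subseteq> insert e F)) = \<rho> ^ card P"
    (is "?s = _")
  proof (cases "e \<in> P")
    case True
    have "?s = (\<Sum>F\<in>Pow H. \<rho> * (open_weight \<rho> H F * of_bool (P - {e} \<subseteq> F)))"
      using True insert.hyps(2) by (intro sum.cong refl) auto
    also have "\<dots> = \<rho> * \<rho> ^ card (P - {e})"
      unfolding sum_distrib_left[symmetric] using insert.prems by (subst insert.IH) auto
    also have "\<dots> = \<rho> ^ card P"
      using card_Suc_Diff1[of P e] True insert.prems insert.hyps(1) by (metis finite_insert finite_subset power_Suc)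
    finally show ?thesis .
  next
    case False
    then have "P \<subseteq> H" using insert.prems by auto
    have "?s = (\<Sum>F\<in>Pow H. open_weight \<rho> H F * of_bool (P \<subseteq> F))"
      using False by (intro sum.cong refl) (auto simp: algebra_simps subset_insert)
    then show ?thesis using insert.IH[OF \<open>P \<subseteq> H\<close>] by simp
  qed
  finally show ?case .
qed

text \<open>At most one witness exists, so the event is that one fixed set of \<open>k\<close> edges
  is open; the inequality covers the case of no such set inside \<open>H\<close>.\<close>

lemma sum_open_weight_unique_le:
  assumes "finite H" "0 \<le> \<rho>" "\<rho> \<le> 1"
    and "\<And>p p'. \<phi> p \<Longrightarrow> \<phi> p' \<Longrightarrow> p = p'" "\<And>p. \<phi> p \<Longrightarrow> card (f p) = k"
  shows "(\<Sum>F\<in>Pow H. open_weight \<rho> H F * of_bool (\<exists>p. \<phi> p \<and> f p \<subseteq> F)) \<le> \<rho> ^ k"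
proof (cases "\<exists>p. \<phi> p \<and> f p \<subseteq> H")
  case True
  then obtain p where p: "\<phi> p" "f p \<subseteq> H" by blast
  then have "(\<exists>p. \<phi> p \<and> f p \<subseteq> F) \<longleftrightarrow> f p \<subseteq> F" for F using assms(4) by blast
  then show ?thesis using sum_open_weight_superset[OF assms(1) p(2), of \<rho>] assms(5)[OF p(1)] by simp
next
  case False
  then have "(\<Sum>F\<in>Pow H. open_weight \<rho> H F * of_bool (\<exists>p. \<phi> p \<and> f p \<subseteq> F)) = 0"
    by (intro sum.neutral) auto
  then show ?thesis using assms(2) by simp
qed

text \<open>The indicator of an equivalence relation is the sum over its classes of rank-one
  kernels. Only the classes that meet \<open>S\<close> are taken, so that the sum is finite.\<close>

lemma pos_kernel_connected_in:
  assumes "finite S"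
  obtains L where "pos_kernel L" "\<And>x y. x \<in> S \<Longrightarrow> y \<in> S \<Longrightarrow> L x y = of_bool (connected_in F x y)"
proof -
  define C where "C = (\<lambda>x. {y. connected_in F x y}) ` S"
  define L where "L x y = (\<Sum>c\<in>C. of_bool (x \<in> c) * of_bool (y \<in> c) :: real)" for x y
  have "pos_kernel L" unfolding L_def using assms
    by (intro pos_kernel_sum) (auto simp: C_def intro: pos_kernel_square)
  moreover have "L x y = of_bool (connected_in F x y)" if "x \<in> S" "y \<in> S" for x y
  proof -
    let ?c = "{y. connected_in F x y}"
    have "c = ?c" if "c \<in> C" "x \<in> c" for c
      using that unfolding C_def by (auto intro: connected_in_trans connected_in_sym)
    then have "L x y = (\<Sum>c\<in>C. if c = ?c then of_bool (x \<in> c) * of_bool (y \<in> c) else 0)"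
      unfolding L_def by (intro sum.cong refl) auto
    also have "\<dots> = of_bool (connected_in F x y)"
      using that assms by (simp add: C_def connected_in_refl)
    finally show ?thesis .
  qed
  ultimately show thesis using that by blast
qed

text \<open>Decomposition of a weighted graph Laplacian: \<open>L1\<close> carries the slack of the
  row sums on the diagonal, and \<open>L2\<close> adds for each pair the square of a difference of
  unit vectors. The weight is \<open>e x y / 2\<close> because each unordered pair occurs
  twice.\<close>

lemma pos_kernel_diagonally_dominant:
  fixes e :: "'a \<Rightarrow> 'a \<Rightarrow> real"
  assumes "finite S" and e: "\<And>x y. x \<in> S \<Longrightarrow> y \<in> S \<Longrightarrow> 0 \<le> e x y" "\<And>x y. e x y = e y x" "\<And>x. x \<in> S \<Longrightarrow> e x x = 0"
    and \<theta>: "\<And>x. x \<in> S \<Longrightarrow> (\<Sum>y\<in>S. e x y) \<le> \<theta>"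
  obtains L where "pos_kernel L" "\<And>x y. x \<in> S \<Longrightarrow> y \<in> S \<Longrightarrow> L x y = (if x = y then \<theta> else 0) - e x y"
proof -
  define u where "u x a = (of_bool (x = a) :: real)" for x a :: 'a
  define L1 where "L1 a b = (\<Sum>x\<in>S. (\<theta> - (\<Sum>y\<in>S. e x y)) * (u x a * u x b))" for a b
  define L2 where "L2 a b = (\<Sum>x\<in>S. \<Sum>y\<in>S. (e x y / 2) * ((u x a - u y a) * (u x b - u y b)))" for a b
  have "pos_kernel L1" unfolding L1_def using assms(1) \<theta>
    by (intro pos_kernel_sum pos_kernel_scale pos_kernel_square) auto
  moreover have "pos_kernel L2" unfolding L2_def using assms(1) e(1)
    by (intro pos_kernel_sum pos_kernel_scale pos_kernel_square) auto
  ultimately have "pos_kernel (\<lambda>a b. L1 a b + L2 a b)" by (rule pos_kernel_add)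
  moreover have "L1 a b + L2 a b = (if a = b then \<theta> else 0) - e a b" if ab: "a \<in> S" "b \<in> S" for a b
  proof -
    have 1: "L1 a b = (if a = b then \<theta> - (\<Sum>y\<in>S. e a y) else 0)"
    proof -
      have "L1 a b = (\<Sum>x\<in>S. if x = a then (\<theta> - (\<Sum>y\<in>S. e x y)) * u x b else 0)"
        unfolding L1_def by (intro sum.cong refl) (auto simp: u_def)
      then show ?thesis using ab assms(1) by (auto simp: u_def)
    qed
    have s1: "(\<Sum>x\<in>S. \<Sum>y\<in>S. e x y * (u x a * u x b)) = (if a = b then (\<Sum>y\<in>S. e a y) else 0)"
    proof -
      have "(\<Sum>x\<in>S. \<Sum>y\<in>S. e x y * (u x a * u x b)) = (\<Sum>x\<in>S. if x = a then (\<Sum>y\<in>S. e x y) * u x b else 0)"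
        by (intro sum.cong refl) (auto simp: u_def sum_distrib_right)
      then show ?thesis using ab assms(1) by (auto simp: u_def)
    qed
    have s2: "(\<Sum>x\<in>S. \<Sum>y\<in>S. e x y * (u x a * u y b)) = e a b" if "a \<in> S" "b \<in> S" for a b
    proof -
      have "(\<Sum>x\<in>S. \<Sum>y\<in>S. e x y * (u x a * u y b)) = (\<Sum>x\<in>S. if x = a then (\<Sum>y\<in>S. if y = b then e x y else 0) else 0)"
        by (intro sum.cong refl) (auto simp: u_def intro!: sum.cong)
      then show ?thesis using that assms(1) by simp
    qed
    have "(\<Sum>x\<in>S. \<Sum>y\<in>S. e x y * (u y a * u y b)) = (\<Sum>x\<in>S. \<Sum>y\<in>S. e x y * (u x a * u x b))"
      by (subst sum.swap) (simp add: e(2))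
    then have s3: "(\<Sum>x\<in>S. \<Sum>y\<in>S. e x y * (u y a * u y b)) = (if a = b then (\<Sum>y\<in>S. e a y) else 0)"
      using s1 by simp
    have "2 * L2 a b = (\<Sum>x\<in>S. \<Sum>y\<in>S. e x y * (u x a * u x b) - e x y * (u x a * u y b) - e x y * (u x b * u y a) + e x y * (u y a * u y b))"
      unfolding L2_def sum_distrib_left by (intro sum.cong refl) (simp add: algebra_simps)
    also have "\<dots> = 2 * ((if a = b then (\<Sum>y\<in>S. e a y) else 0) - e a b)"
      using s1 s2[OF ab] s2[OF ab(2,1)] s3 e(2)[of a b] by (simp add: sum.distrib sum_subtractf)
    finally show ?thesis using 1 e(3)[OF ab(1)] by auto
  qed
  ultimately show thesis using that by blast
qed

section \<open>The truncated path kernel\<close>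

text \<open>\<open>length\<close> counts vertices, so the bound means fewer than \<open>l\<close>
  edges.\<close>

definition short_path :: "('a \<Rightarrow> 'a \<Rightarrow> bool) \<Rightarrow> nat \<Rightarrow> 'a \<Rightarrow> 'a \<Rightarrow> 'a list \<Rightarrow> bool" where
  "short_path adj l x y p \<longleftrightarrow> is_path adj p \<and> hd p = x \<and> last p = y \<and> length p \<le> l"

text \<open>Under the girth condition short paths are unique, so \<open>SOME\<close> denotes the
  only one and the exponent is the distance.\<close>

definition path_kernel :: "('a \<Rightarrow> 'a \<Rightarrow> bool) \<Rightarrow> nat \<Rightarrow> real \<Rightarrow> 'a \<Rightarrow> 'a \<Rightarrow> real" where
  "path_kernel adj l \<rho> x y =
     (if \<exists>p. short_path adj l x y p then \<rho> ^ (length (SOME p. short_path adj l x y p) - 1) else 0)"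

context
  fixes adj :: "'a \<Rightarrow> 'a \<Rightarrow> bool" and l :: nat and \<rho> :: real
  assumes sym: "symp adj" and girth: "no_short_cycle adj (2 * l)" and l: "1 \<le> l" and \<rho>: "0 \<le> \<rho>" "\<rho> \<le> 1"
begin

lemma short_path_unique: "short_path adj l x y p \<Longrightarrow> short_path adj l x y p' \<Longrightarrow> p = p'"
  unfolding short_path_def by (intro path_unique[OF sym girth]) auto

lemma path_kernel_eq: 
  assumes "short_path adj l x y p" shows "path_kernel adj l \<rho> x y = \<rho> ^ (length p - 1)"
proof -
  have "(SOME p. short_path adj l x y p) = p" using assms short_path_unique by (metis someI)
  then show ?thesis using assms by (auto simp: path_kernel_def)
qed

lemma path_kernel_self: "path_kernel adj l \<rho> x x = 1"
  using path_kernel_eq[of x x "[x]"] l by (simp add: short_path_def is_path_def)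

lemma path_kernel_adj: "2 \<le> l \<Longrightarrow> adj x y \<Longrightarrow> x \<noteq> y \<Longrightarrow> path_kernel adj l \<rho> x y = \<rho>"
  using path_kernel_eq[of x y "[x, y]"] by (simp add: short_path_def is_path_def)

lemma path_kernel_sym: "path_kernel adj l \<rho> x y = path_kernel adj l \<rho> y x"
proof -
  have *: "short_path adj l y x (rev p)" if "short_path adj l x y p" for x y p
    using that is_path_rev[OF sym] by (auto simp: short_path_def hd_rev last_rev is_path_def)
  show ?thesis
  proof (cases "\<exists>p. short_path adj l x y p")
    case True
    then obtain p where p: "short_path adj l x y p" by blast
    show ?thesis using path_kernel_eq[OF p] path_kernel_eq[OF *[OF p]] by simp
  next
    case False
    moreover from this * have "\<nexists>p. short_path adj l y x p" by blast
    ultimately show ?thesis by (simp add: path_kernel_def)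
  qed
qed

context
  fixes S :: "'a set"
  assumes S: "finite S"
begin

text \<open>By uniqueness at most \<open>(card S)\<^sup>2\<close> paths contribute, so percolation
  lives on a finite edge set whose number of vertices is bounded in terms of \<open>card S\<close>
  and \<open>l\<close> only.\<close>

definition hull_edges :: "'a set set" where
  "hull_edges = (\<Union>x\<in>S. \<Union>y\<in>S. \<Union>p\<in>{p. short_path adj l x y p}. pedges p)"

lemma short_path_cases: "{p. short_path adj l x y p} = {} \<or> (\<exists>p. {p. short_path adj l x y p} = {p})"
  using short_path_unique[of x y] by blast

lemma hull_edges_vertices:
  "finite (\<Union> hull_edges)" "card (\<Union> hull_edges) \<le> (card S)\<^sup>2 * l"
proof -
  define W where "W x y = \<Union> (\<Union>p\<in>{p. short_path adj l x y p}. pedges p)" for x y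
  have W: "finite (W x y) \<and> card (W x y) \<le> l" for x y
    using short_path_cases[of x y]
  proof
    assume "\<exists>p. {p. short_path adj l x y p} = {p}"
    then obtain p where p: "{p. short_path adj l x y p} = {p}" by blast
    then have "length p \<le> l" by (auto simp: short_path_def)
    moreover have "W x y \<subseteq> set p" unfolding W_def p using pedges_vertices[of _ p] by blast
    ultimately show ?thesis
      using card_mono[of "set p" "W x y"] card_length[of p] by (auto dest: finite_subset)
  qed (simp add: W_def)
  have gen: "\<Union> (\<Union>x\<in>S. \<Union>y\<in>S. A x y) = (\<Union>z\<in>S \<times> S. \<Union> (A (fst z) (snd z)))" for A :: "'a \<Rightarrow> 'a \<Rightarrow> 'a set set"
    by (auto; blast)
  have eq: "\<Union> hull_edges = (\<Union>z\<in>S \<times> S. W (fst z) (snd z))"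
    unfolding hull_edges_def W_def by (rule gen)
  show "finite (\<Union> hull_edges)" unfolding eq using S W by auto
  have "card (\<Union> hull_edges) \<le> (\<Sum>z\<in>S \<times> S. card (W (fst z) (snd z)))"
    unfolding eq using S by (intro card_UN_le) auto
  also have "\<dots> \<le> (\<Sum>z\<in>S \<times> S. l)" using W by (intro sum_mono) auto
  also have "\<dots> = (card S)\<^sup>2 * l" by (simp add: card_cartesian_product power2_eq_square)
  finally show "card (\<Union> hull_edges) \<le> (card S)\<^sup>2 * l" .
qed

lemma finite_hull_edges: "finite hull_edges"
proof (rule finite_subset)
  show "hull_edges \<subseteq> Pow (\<Union> hull_edges)" by auto
qed (simp add: hull_edges_vertices)

lemma hull_edges_adj: "{a, b} \<in> hull_edges \<Longrightarrow> adj a b"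
proof -
  assume "{a, b} \<in> hull_edges"
  then obtain x y p where "short_path adj l x y p" "{a, b} \<in> pedges p"
    unfolding hull_edges_def by blast
  then show "adj a b" by (intro pedges_adj[OF sym, of p]) (simp_all add: short_path_def is_path_def)
qed

definition open_kernel :: "'a \<Rightarrow> 'a \<Rightarrow> real" where
  "open_kernel x y = (\<Sum>F\<in>Pow hull_edges. open_weight \<rho> hull_edges F * of_bool (connected_in F x y))"

text \<open>The points are connected as soon as their short path is open, and this has probability
  exactly \<open>path_kernel\<close>.\<close>

lemma open_kernel_ge:
  assumes "x \<in> S" "y \<in> S"
  shows "path_kernel adj l \<rho> x y \<le> open_kernel x y"
proof (cases "\<exists>p. short_path adj l x y p")
  case True
  then obtain p where p: "short_path adj l x y p" by blast
  have sub: "pedges p \<subseteq> hull_edges" using p assms unfolding hull_edges_def by blast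
  have d: "distinct p" "p \<noteq> []" "hd p = x" "last p = y" using p by (auto simp: short_path_def is_path_def)
  have "path_kernel adj l \<rho> x y = \<rho> ^ card (pedges p)" using path_kernel_eq[OF p] card_pedges[OF d(1)] by simp
  also have "\<dots> = (\<Sum>F\<in>Pow hull_edges. open_weight \<rho> hull_edges F * of_bool (pedges p \<subseteq> F))"
    using sum_open_weight_superset[OF finite_hull_edges sub] by simp
  also have "\<dots> \<le> open_kernel x y" unfolding open_kernel_def
    using path_connected_in[OF d(2)] d(3,4) open_weight_nonneg[OF \<rho>]
    by (intro sum_mono mult_left_mono) auto
  finally show ?thesis .
next
  case False
  then show ?thesis unfolding open_kernel_def path_kernel_def using open_weight_nonneg[OF \<rho>]
    by (auto intro!: sum_nonneg)
qed

lemma open_kernel_self: "open_kernel x x = 1"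
  unfolding open_kernel_def using sum_open_weight_superset[OF finite_hull_edges, of "{}"]
  by (simp add: connected_in_refl)

text \<open>An open path with more than \<open>l - 1\<close> edges starts with an open path with exactly \<open>l\<close> edges,
  and there are at most as many of these as possible endpoints.\<close>
lemma open_kernel_le:
  assumes "x \<in> S" "y \<in> S"
  shows "open_kernel x y \<le> path_kernel adj l \<rho> x y + card (\<Union> hull_edges) * \<rho> ^ l"
proof -
  define long where "long z p \<longleftrightarrow> is_path adj p \<and> hd p = x \<and> last p = z \<and> length p = l + 1" for z p
  let ?w = "open_weight \<rho> hull_edges"
  have b: "of_bool (connected_in F x y) \<le> of_bool (\<exists>p. short_path adj l x y p \<and> pedges p \<subseteq> F) +
      (\<Sum>z\<in>\<Union> hull_edges. of_bool (\<exists>p. long z p \<and> pedges p \<subseteq> F) :: real)"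
    if F: "F \<in> Pow hull_edges" for F
  proof (cases "connected_in F x y")
    case True
    then obtain p where p: "is_path (\<lambda>x y. {x, y} \<in> F) p" "hd p = x" "last p = y"
      by (rule connected_in_path)
    have sF: "successively (\<lambda>x y. {x, y} \<in> F) p" using p(1) by (simp add: is_path_def)
    have "successively adj p"
      using sF by (rule successively_mono) (use F hull_edges_adj in auto)
    then have path: "is_path adj p" using p(1) by (simp add: is_path_def)
    have pF: "pedges p \<subseteq> F" using sF by (simp add: successively_pedges)
    show ?thesis
    proof (cases "length p \<le> l")
      case True
      then have "short_path adj l x y p" using path p by (simp add: short_path_def)
      then have "\<exists>p. short_path adj l x y p \<and> pedges p \<subseteq> F" using pF by blast
      then show ?thesis by (simp add: sum_nonneg)
    next
      case False
      define p' where "p' = take (l + 1) p"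
      have len: "length p' = l + 1" using False by (simp add: p'_def)
      have app: "p = p' @ drop (l + 1) p" by (simp add: p'_def)
      have "is_path adj p'" using path len app unfolding is_path_def
        by (metis distinct_append list.size(3) add_is_0 one_neq_zero successively_append_iff)
      moreover have "hd p' = x" using p(2) len by (simp add: p'_def)
      ultimately have lng: "long (last p') p'" using len by (simp add: long_def)
      have "successively (\<lambda>x y. {x, y} \<in> F) p'" using sF app by (metis successively_append_iff)
      then have p'F: "pedges p' \<subseteq> F" by (simp add: successively_pedges)
      have "last p' \<in> \<Union> (pedges p')" using len l by (intro last_in_pedges) simp
      then have z: "last p' \<in> \<Union> hull_edges" using p'F F by auto
      have "1 \<le> (\<Sum>z\<in>{last p'}. of_bool (\<exists>p. long z p \<and> pedges p \<subseteq> F) :: real)"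
      proof -
        have "\<exists>p. long (last p') p \<and> pedges p \<subseteq> F" using lng p'F by blast
        then show ?thesis by simp
      qed
      also have "\<dots> \<le> (\<Sum>z\<in>\<Union> hull_edges. of_bool (\<exists>p. long z p \<and> pedges p \<subseteq> F))"
        using z by (intro sum_mono2 hull_edges_vertices) auto
      finally show ?thesis by (simp add: of_bool_def)
    qed
  qed (simp add: sum_nonneg)
  have "open_kernel x y \<le> (\<Sum>F\<in>Pow hull_edges. ?w F * (of_bool (\<exists>p. short_path adj l x y p \<and> pedges p \<subseteq> F) +
      (\<Sum>z\<in>\<Union> hull_edges. of_bool (\<exists>p. long z p \<and> pedges p \<subseteq> F))))"
    unfolding open_kernel_def by (rule sum_mono, rule mult_left_mono[OF b open_weight_nonneg[OF \<rho>]])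
  also have "\<dots> = (\<Sum>F\<in>Pow hull_edges. ?w F * of_bool (\<exists>p. short_path adj l x y p \<and> pedges p \<subseteq> F)) +
      (\<Sum>z\<in>\<Union> hull_edges. \<Sum>F\<in>Pow hull_edges. ?w F * of_bool (\<exists>p. long z p \<and> pedges p \<subseteq> F))"
    unfolding distrib_left sum.distrib sum_distrib_left by (subst sum.swap) (rule refl)
  also have "(\<Sum>F\<in>Pow hull_edges. ?w F * of_bool (\<exists>p. short_path adj l x y p \<and> pedges p \<subseteq> F)) \<le> path_kernel adj l \<rho> x y"
  proof (cases "\<exists>p. short_path adj l x y p")
    case True
    then obtain p where p: "short_path adj l x y p" by blast
    have "(\<Sum>F\<in>Pow hull_edges. ?w F * of_bool (\<exists>p. short_path adj l x y p \<and> pedges p \<subseteq> F)) \<le> \<rho> ^ (length p - 1)"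
    proof (rule sum_open_weight_unique_le[OF finite_hull_edges \<rho>])
      show "card (pedges p') = length p - 1" if "short_path adj l x y p'" for p'
        using short_path_unique[OF p that] that by (auto simp: card_pedges short_path_def is_path_def)
    qed (rule short_path_unique)
    then show ?thesis using path_kernel_eq[OF p] by simp
  next
    case False
    then show ?thesis by (simp add: path_kernel_def)
  qed
  also have "(\<Sum>z\<in>\<Union> hull_edges. \<Sum>F\<in>Pow hull_edges. ?w F * of_bool (\<exists>p. long z p \<and> pedges p \<subseteq> F)) \<le> (\<Sum>z\<in>\<Union> hull_edges. \<rho> ^ l)"
  proof (rule sum_mono)
    fix z
    show "(\<Sum>F\<in>Pow hull_edges. ?w F * of_bool (\<exists>p. long z p \<and> pedges p \<subseteq> F)) \<le> \<rho> ^ l"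
    proof (rule sum_open_weight_unique_le[OF finite_hull_edges \<rho>])
      \<comment> \<open>These paths have \<open>l + 1\<close> vertices, the largest number that
        \<open>path_unique\<close> admits.\<close>
      show "p = p'" if "long z p" "long z p'" for p p'
        using that unfolding long_def by (intro path_unique[OF sym girth]) auto
      show "card (pedges p) = l" if "long z p" for p
        using that by (simp add: long_def card_pedges is_path_def)
    qed
  qed
  finally show ?thesis by simp
qed

lemma open_kernel_sym: "open_kernel x y = open_kernel y x"
proof -
  have "connected_in F x y = connected_in F y x" for F by (meson connected_in_sym)
  then show ?thesis by (simp add: open_kernel_def)
qed

lemma pos_kernel_open_kernel:
  "\<exists>L. pos_kernel L \<and> (\<forall>x\<in>S. \<forall>y\<in>S. L x y = open_kernel x y)"
proof -
  have ex: "\<exists>L. pos_kernel L \<and> (\<forall>x\<in>S. \<forall>y\<in>S. L x y = of_bool (connected_in F x y))" for F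
    by (rule pos_kernel_connected_in[OF S, of F], rule exI, rule conjI, assumption, blast)
  have "\<forall>F. \<exists>L. pos_kernel L \<and> (\<forall>x\<in>S. \<forall>y\<in>S. L x y = of_bool (connected_in F x y))"
    by (rule allI) (rule ex)
  from choice[OF this] obtain L where
    L: "\<forall>F. pos_kernel (L F) \<and> (\<forall>x\<in>S. \<forall>y\<in>S. L F x y = of_bool (connected_in F x y))" ..
  let ?M = "\<lambda>x y. \<Sum>F\<in>Pow hull_edges. open_weight \<rho> hull_edges F * L F x y"
  have "pos_kernel ?M"
  proof (rule pos_kernel_sum)
    show "pos_kernel (\<lambda>x y. open_weight \<rho> hull_edges F * L F x y)" for F
      using L by (intro pos_kernel_scale open_weight_nonneg \<rho>) blast
  qed (simp add: finite_hull_edges)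
  moreover have "\<forall>x\<in>S. \<forall>y\<in>S. ?M x y = open_kernel x y"
    using L by (simp add: open_kernel_def)
  ultimately show ?thesis by (intro exI[of _ ?M] conjI)
qed

text \<open>The kernel is \<open>open_kernel\<close> plus the matrix with \<open>\<theta>\<close> on
  the diagonal minus the error \<open>e\<close>, and that matrix is diagonally dominant. Each of the
  \<open>card S\<close> errors in a row is at most the number of hull vertices times
  \<open>\<rho> ^ l\<close>, so the condition on \<open>\<theta>\<close> is cubic in
  \<open>card S\<close>.\<close>

lemma covariance_on_path_kernel:
  assumes \<theta>: "card S * ((card S)\<^sup>2 * l * \<rho> ^ l) \<le> \<theta>"
  shows "covariance_on (\<lambda>x y. path_kernel adj l \<rho> x y + (if x = y then \<theta> else 0)) S"
proof -
  from pos_kernel_open_kernel obtain L where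
    L: "pos_kernel L" "\<And>x y. x \<in> S \<Longrightarrow> y \<in> S \<Longrightarrow> L x y = open_kernel x y"
    by blast
  define e where "e x y = open_kernel x y - path_kernel adj l \<rho> x y" for x y
  have le: "e x y \<le> (card S)\<^sup>2 * l * \<rho> ^ l" if "x \<in> S" "y \<in> S" for x y
  proof -
    have "e x y \<le> card (\<Union> hull_edges) * \<rho> ^ l" using open_kernel_le[OF that] by (simp add: e_def)
    also have "\<dots> \<le> real ((card S)\<^sup>2 * l) * \<rho> ^ l"
      using hull_edges_vertices(2) \<rho> by (intro mult_right_mono of_nat_mono) auto
    finally show ?thesis by simp
  qed
  have e1: "0 \<le> e x y" if "x \<in> S" "y \<in> S" for x y
    unfolding e_def diff_ge_0_iff_ge by (rule open_kernel_ge) (rule that)+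
  have e2: "e x y = e y x" for x y
    unfolding e_def by (simp only: open_kernel_sym[of x y] path_kernel_sym[of x y])
  have e3: "e x x = 0" for x by (simp add: e_def open_kernel_self path_kernel_self)
  have e4: "(\<Sum>y\<in>S. e x y) \<le> \<theta>" if "x \<in> S" for x
  proof -
    have "(\<Sum>y\<in>S. e x y) \<le> (\<Sum>y\<in>S. (card S)\<^sup>2 * l * \<rho> ^ l)" using le[OF that] by (rule sum_mono)
    then show ?thesis using \<theta> by simp
  qed
  have "\<exists>M. pos_kernel M \<and> (\<forall>x\<in>S. \<forall>y\<in>S. M x y = (if x = y then \<theta> else 0) - e x y)"
  proof (rule pos_kernel_diagonally_dominant[OF S, of e \<theta>])
    show "0 \<le> e x y" if "x \<in> S" "y \<in> S" for x y by (rule e1[OF that])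
    show "e x y = e y x" for x y by (rule e2)
    show "e x x = 0" for x by (rule e3)
    show "(\<Sum>y\<in>S. e x y) \<le> \<theta>" if "x \<in> S" for x by (rule e4[OF that])
  qed (rule exI, rule conjI, assumption, blast)
  then obtain M where M: "pos_kernel M" "\<And>x y. x \<in> S \<Longrightarrow> y \<in> S \<Longrightarrow> M x y = (if x = y then \<theta> else 0) - e x y"
    by blast
  have "pos_kernel (\<lambda>x y. L x y + M x y)" by (rule pos_kernel_add[OF L(1) M(1)])
  then show ?thesis unfolding covariance_on_def using S
    by (intro conjI exI[of _ "\<lambda>x y. L x y + M x y"]) (auto simp: L(2) M(2) e_def path_kernel_sym)
qed

end

end

section \<open>Random arcs without short cycles\<close>

text \<open>Chernoff bound for \<open>m\<close> independent uniform draws from \<open>E\<close>, as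
  a sum over all samples. Since \<open>exp h \<le> 1 + h + h\<^sup>2\<close> for
  \<open>0 \<le> h \<le> 1\<close>, one draw contributes an exponent of at most
  \<open>h\<^sup>2 - h * \<eta>\<close>, which is minimal at \<open>h = \<eta> / 2\<close>.\<close>

lemma exp_moment_PiE:
  fixes Y :: "'e set" and p :: real
  assumes "finite E" "E \<noteq> {}" "Y \<subseteq> E" and p: "card Y = p * card E" and \<eta>: "0 < \<eta>" "\<eta> \<le> 1"
  shows "(\<Sum>\<omega>\<in>{..<m} \<rightarrow>\<^sub>E E. exp (\<eta> / 2 * (real (card {i. i < m \<and> \<omega> i \<in> Y}) - m * (p + \<eta>))))
    \<le> real (card E) ^ m * exp (- (m * \<eta>\<^sup>2 / 4))"
proof -
  let ?h = "\<eta> / 2"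
  define X where "X e = (of_bool (e \<in> Y) :: real)" for e
  have finY: "finite Y" using assms(1,3) by (rule finite_subset[rotated])
  have cE: "0 < real (card E)" using assms(1,2) by (simp add: card_gt_0_iff)
  have "real (card Y) \<le> real (card E)" using card_mono[OF assms(1,3)] by simp
  then have "p * card E \<le> 1 * real (card E)" "0 * real (card E) \<le> p * card E" unfolding p[symmetric] by simp_all
  then have p01: "0 \<le> p" "p \<le> 1" using cE by (simp_all only: mult_le_cancel_right_pos)
  have ex: "exp ?h \<le> 1 + ?h + ?h\<^sup>2" using \<eta> by (intro exp_bound) auto
  have one: "(\<Sum>e\<in>E. exp (?h * (X e - (p + \<eta>)))) \<le> card E * exp (- (\<eta>\<^sup>2 / 4))"
  proof -
    have "(\<Sum>e\<in>E. exp (?h * X e)) = (\<Sum>e\<in>E. 1 + (exp ?h - 1) * X e)"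
      by (intro sum.cong refl) (auto simp: X_def)
    also have "\<dots> = card E + (exp ?h - 1) * card Y"
    proof -
      have "(\<Sum>e\<in>E. X e) = card Y"
        using assms(1,3) by (simp add: X_def Int_absorb1)
      then show ?thesis by (simp add: sum.distrib sum_distrib_left[symmetric])
    qed
    also have "\<dots> = card E * (1 + p * (exp ?h - 1))" by (simp add: p algebra_simps)
    also have "\<dots> \<le> card E * exp (p * (exp ?h - 1))"
      by (intro mult_left_mono exp_ge_add_one_self) auto
    also have "\<dots> \<le> card E * exp (?h * p + ?h\<^sup>2)"
    proof -
      have "p * (exp ?h - 1) \<le> p * (?h + ?h\<^sup>2)" using ex p01 by (intro mult_left_mono) auto
      also have "\<dots> \<le> ?h * p + 1 * ?h\<^sup>2"
        using mult_right_mono[OF p01(2), of "?h\<^sup>2"] by (simp add: algebra_simps)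
      finally show ?thesis by (intro mult_left_mono) auto
    qed
    finally have le: "(\<Sum>e\<in>E. exp (?h * X e)) \<le> card E * exp (?h * p + ?h\<^sup>2)" .
    have "(\<Sum>e\<in>E. exp (?h * (X e - (p + \<eta>)))) = (\<Sum>e\<in>E. exp (?h * X e)) * exp (- (?h * (p + \<eta>)))"
      unfolding sum_distrib_right by (intro sum.cong refl) (simp add: exp_add[symmetric] algebra_simps)
    also have "\<dots> \<le> card E * exp (?h * p + ?h\<^sup>2) * exp (- (?h * (p + \<eta>)))"
      using le by (intro mult_right_mono) auto
    also have "\<dots> = card E * exp (- (\<eta>\<^sup>2 / 4))"
      by (simp add: exp_add[symmetric] mult.assoc power2_eq_square algebra_simps)
    finally show ?thesis .
  qed
  have "(\<Sum>\<omega>\<in>{..<m} \<rightarrow>\<^sub>E E. exp (?h * (real (card {i. i < m \<and> \<omega> i \<in> Y}) - m * (p + \<eta>))))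
      = (\<Sum>\<omega>\<in>{..<m} \<rightarrow>\<^sub>E E. \<Prod>i<m. exp (?h * (X (\<omega> i) - (p + \<eta>))))"
  proof (intro sum.cong refl)
    fix \<omega> assume "\<omega> \<in> {..<m} \<rightarrow>\<^sub>E E"
    have "{..<m} \<inter> {i. \<omega> i \<in> Y} = {i. i < m \<and> \<omega> i \<in> Y}" by auto
    then have cardX: "real (card {i. i < m \<and> \<omega> i \<in> Y}) = (\<Sum>i<m. X (\<omega> i))"
      by (simp add: X_def)
    show "exp (?h * (real (card {i. i < m \<and> \<omega> i \<in> Y}) - m * (p + \<eta>))) = (\<Prod>i<m. exp (?h * (X (\<omega> i) - (p + \<eta>))))"
    proof -
      have "(\<Sum>i<m. ?h * (X (\<omega> i) - (p + \<eta>))) = ?h * ((\<Sum>i<m. X (\<omega> i)) - m * (p + \<eta>))"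
        unfolding sum_distrib_left[symmetric] sum_subtractf by simp
      then show ?thesis by (simp only: cardX exp_sum[symmetric] finite_lessThan)
    qed
  qed
  also have "\<dots> = (\<Prod>i<m. \<Sum>e\<in>E. exp (?h * (X e - (p + \<eta>))))"
    using assms(1) by (subst prod_sum_PiE) auto
  also have "\<dots> \<le> (\<Prod>i<m. card E * exp (- (\<eta>\<^sup>2 / 4)))"
    using one by (intro prod_mono) (auto intro!: sum_nonneg)
  also have "\<dots> = real (card E) ^ m * exp (- (m * \<eta>\<^sup>2 / 4))"
    by (simp add: power_mult_distrib exp_of_nat_mult[symmetric])
  finally show ?thesis .
qed

section \<open>Short cycles in the random sample\<close>

definition joins :: "nat \<times> nat \<times> nat \<Rightarrow> nat \<Rightarrow> nat \<Rightarrow> bool" where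
  "joins e a b \<longleftrightarrow> (fst e = a \<and> fst (snd e) = b) \<or> (fst e = b \<and> fst (snd e) = a)"

text \<open>The sample consists of \<open>m\<close> random labelled arcs, and \<open>cyclic \<omega> w is\<close> says that the arcs with the
  indices \<open>is\<close> close up to a cycle through the vertices \<open>w\<close>; loops and repeated arcs are covered as cycles
  of length 1 and 2.\<close>
definition cyclic :: "(nat \<Rightarrow> nat \<times> nat \<times> nat) \<Rightarrow> nat list \<Rightarrow> nat list \<Rightarrow> bool" where
  "cyclic \<omega> w is \<longleftrightarrow> (\<forall>j<length is. joins (\<omega> (is ! j)) (w ! j) (w ! (Suc j mod length is)))"

text \<open>Vertices may repeat, but the arc indices are distinct, so that the conditions in
  \<open>cyclic\<close> fall on independent coordinates of the sample.\<close>

definition cycle_candidates :: "nat \<Rightarrow> nat \<Rightarrow> nat \<Rightarrow> (nat list \<times> nat list) set" where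
  "cycle_candidates n m t = {w. set w \<subseteq> {..<n} \<and> length w = t} \<times> {is. set is \<subseteq> {..<m} \<and> length is = t \<and> distinct is}"

definition short_cycles :: "nat \<Rightarrow> nat \<Rightarrow> nat \<Rightarrow> (nat \<Rightarrow> nat \<times> nat \<times> nat) \<Rightarrow> (nat list \<times> nat list) set" where
  "short_cycles n m k \<omega> = {c \<in> (\<Union>t\<in>{1..k}. cycle_candidates n m t). cyclic \<omega> (fst c) (snd c)}"

definition labelled_pairs :: "nat \<Rightarrow> nat \<Rightarrow> (nat \<times> nat \<times> nat) set" where
  "labelled_pairs n T = {..<n} \<times> {..<n} \<times> {1..T}"

lemma finite_cycle_candidates: "finite (cycle_candidates n m t)"
proof -
  have "finite {is. set is \<subseteq> {..<m} \<and> length is = t \<and> distinct is}"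
    by (rule finite_subset[OF _ finite_lists_length_eq[of "{..<m}" t]]) auto
  then show ?thesis
    unfolding cycle_candidates_def by (intro finite_cartesian_product finite_lists_length_eq) simp_all
qed

lemma card_cycle_candidates: "card (cycle_candidates n m t) \<le> n ^ t * m ^ t"
proof -
  have "card {is. set is \<subseteq> {..<m} \<and> length is = t \<and> distinct is} \<le> card {is. set is \<subseteq> {..<m} \<and> length is = t}"
    by (intro card_mono finite_lists_length_eq) auto
  also have "\<dots> = m ^ t" using card_lists_length_eq[of "{..<m}" t] by simp
  finally show ?thesis
    using card_lists_length_eq[of "{..<n}" t] by (simp add: cycle_candidates_def card_cartesian_product)
qed

text \<open>Each of the \<open>t\<close> prescribed coordinates must join two given vertices, which
  leaves at most \<open>2 * T\<close> of the \<open>n\<^sup>2 * T\<close> labelled pairs: two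
  directions and \<open>T\<close> labels. The other coordinates are free.\<close>

lemma card_cyclic_le:
  assumes "c \<in> cycle_candidates n m t" "t \<ge> 1" "T \<ge> 1" "n \<ge> 1"
  shows "real (card {\<omega> \<in> {..<m} \<rightarrow>\<^sub>E labelled_pairs n T. cyclic \<omega> (fst c) (snd c)})
    \<le> real (card (labelled_pairs n T)) ^ m * (2 / (real n)\<^sup>2) ^ t"
proof -
  obtain w "is" where c: "c = (w, is)" by (cases c)
  have w: "length w = t" and s: "set is \<subseteq> {..<m}" "length is = t" "distinct is"
    using assms(1) by (auto simp: c cycle_candidates_def)
  define E where "E = labelled_pairs n T"
  have E: "real (card E) = (real n)\<^sup>2 * T" by (simp add: E_def labelled_pairs_def card_cartesian_product power2_eq_square)
  define pos where "pos i = (THE j. j < t \<and> is ! j = i)" for i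
  have pos: "pos (is ! j) = j" if "j < t" for j
    unfolding pos_def using that s by (intro the_equality) (auto simp: nth_eq_iff_index_eq)
  define J where "J i = (if i \<in> set is then {e \<in> E. joins e (w ! pos i) (w ! (Suc (pos i) mod t))} else E)" for i
  have cJ: "card (J i) \<le> 2 * T" if "i \<in> set is" for i
  proof -
    let ?a = "w ! pos i" and ?b = "w ! (Suc (pos i) mod t)"
    have "J i \<subseteq> {?a} \<times> {?b} \<times> {1..T} \<union> {?b} \<times> {?a} \<times> {1..T}"
      using that by (auto simp: J_def E_def labelled_pairs_def joins_def)
    then have "card (J i) \<le> card ({?a} \<times> {?b} \<times> {1..T} \<union> {?b} \<times> {?a} \<times> {1..T})"
      by (intro card_mono) auto
    also have "\<dots> \<le> card ({?a} \<times> {?b} \<times> {1..T}) + card ({?b} \<times> {?a} \<times> {1..T})" by (rule card_Un_le)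
    finally show ?thesis by (simp add: card_cartesian_product)
  qed
  have "{\<omega> \<in> {..<m} \<rightarrow>\<^sub>E E. cyclic \<omega> w is} \<subseteq> (\<Pi>\<^sub>E i\<in>{..<m}. J i)"
  proof
    fix \<omega> assume \<omega>: "\<omega> \<in> {\<omega> \<in> {..<m} \<rightarrow>\<^sub>E E. cyclic \<omega> w is}"
    show "\<omega> \<in> (\<Pi>\<^sub>E i\<in>{..<m}. J i)"
    proof (rule PiE_I)
      fix i assume i: "i \<in> {..<m}"
      show "\<omega> i \<in> J i"
      proof (cases "i \<in> set is")
        case True
        then obtain j where "j < t" "i = is ! j" using s(2) by (metis in_set_conv_nth)
        then show ?thesis using \<omega> i True s(2) pos by (auto simp: J_def cyclic_def)
      next
        case False
        then show ?thesis using \<omega> i by (auto simp: J_def)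
      qed
    qed (use \<omega> in auto)
  qed
  moreover have finE: "finite E" by (simp add: E_def labelled_pairs_def)
  moreover have "finite (J i)" for i using finE by (simp add: J_def)
  ultimately have "card {\<omega> \<in> {..<m} \<rightarrow>\<^sub>E E. cyclic \<omega> w is} \<le> card (\<Pi>\<^sub>E i\<in>{..<m}. J i)"
    by (intro card_mono finite_PiE) auto
  also have "\<dots> = (\<Prod>i<m. card (J i))" by (simp add: card_PiE)
  also have "\<dots> = (\<Prod>i\<in>set is. card (J i)) * (\<Prod>i\<in>{..<m} - set is. card (J i))"
    using s(1) by (subst prod.subset_diff[of "set is"]) (auto simp: mult.commute)
  also have "\<dots> \<le> (2 * T) ^ t * card E ^ (m - t)"
  proof (rule mult_mono)
    have "(\<Prod>i\<in>set is. card (J i)) \<le> (\<Prod>i\<in>set is. 2 * T)" using cJ by (intro prod_mono) auto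
    then show "(\<Prod>i\<in>set is. card (J i)) \<le> (2 * T) ^ t" using s by (simp add: distinct_card)
    have "(\<Prod>i\<in>{..<m} - set is. card (J i)) = (\<Prod>i\<in>{..<m} - set is. card E)"
      by (intro prod.cong) (auto simp: J_def)
    also have "\<dots> = card E ^ (m - t)" using s by (simp add: card_Diff_subset distinct_card)
    finally show "(\<Prod>i\<in>{..<m} - set is. card (J i)) \<le> card E ^ (m - t)" by simp
  qed auto
  finally have "real (card {\<omega> \<in> {..<m} \<rightarrow>\<^sub>E E. cyclic \<omega> w is}) \<le> real ((2 * T) ^ t * card E ^ (m - t))"
    by (rule of_nat_mono)
  also have "\<dots> = real (card E) ^ m * (2 / (real n)\<^sup>2) ^ t"
  proof -
    have "t \<le> m" using s card_mono[of "{..<m}" "set is"] by (simp add: distinct_card)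
    then have "m = (m - t) + t" by simp
    then have 1: "real (card E) ^ m = real (card E) ^ (m - t) * real (card E) ^ t" by (metis power_add)
    have "real (card E) * (2 / (real n)\<^sup>2) = 2 * real T" using assms(4) by (simp add: E)
    then have 2: "real (card E) ^ t * (2 / (real n)\<^sup>2) ^ t = (2 * real T) ^ t"
      by (simp only: power_mult_distrib[symmetric])
    show ?thesis unfolding 1 mult.assoc 2 by (simp add: mult.commute)
  qed
  finally show ?thesis by (simp add: c E_def)
qed

lemma sum_power_le:
  fixes x :: real assumes "2 \<le> x" shows "(\<Sum>t\<in>{1..k}. x ^ t) \<le> x ^ (k + 1)"
proof (induction k)
  case (Suc k)
  have "(\<Sum>t\<in>{1..Suc k}. x ^ t) \<le> x ^ (k + 1) + x ^ (k + 1)" using Suc by simp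
  also have "\<dots> = 2 * x ^ (k + 1)" by simp
  also have "\<dots> \<le> x * x ^ (k + 1)" using assms by (intro mult_right_mono) auto
  finally show ?case by simp
qed (use assms in simp)

text \<open>With \<open>m = C * n\<close> the number \<open>(n * m) ^ t\<close> of candidates meets
  the probability \<open>(2 / n\<^sup>2) ^ t\<close>, so the expected number of cycles of length
  \<open>t\<close> is at most \<open>(2 * C) ^ t\<close>, independently of \<open>n\<close>.\<close>

lemma sum_card_short_cycles_le:
  assumes "T \<ge> 1" "n \<ge> 1" "C \<ge> 1" "m = C * n"
  shows "(\<Sum>\<omega>\<in>{..<m} \<rightarrow>\<^sub>E labelled_pairs n T. real (card (short_cycles n m k \<omega>)))
    \<le> real (card (labelled_pairs n T)) ^ m * (2 * real C) ^ (k + 1)"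
proof -
  let ?\<Omega> = "{..<m} \<rightarrow>\<^sub>E labelled_pairs n T"
  let ?N = "real (card (labelled_pairs n T)) ^ m"
  have fin\<Omega>: "finite ?\<Omega>" by (intro finite_PiE) (auto simp: labelled_pairs_def)
  have "(\<Sum>\<omega>\<in>?\<Omega>. real (card (short_cycles n m k \<omega>)))
      \<le> (\<Sum>\<omega>\<in>?\<Omega>. \<Sum>t\<in>{1..k}. \<Sum>c\<in>cycle_candidates n m t. of_bool (cyclic \<omega> (fst c) (snd c)))"
  proof (rule sum_mono)
    fix \<omega>
    have "short_cycles n m k \<omega> = (\<Union>t\<in>{1..k}. {c \<in> cycle_candidates n m t. cyclic \<omega> (fst c) (snd c)})"
      by (auto simp: short_cycles_def)
    then have "card (short_cycles n m k \<omega>) \<le> (\<Sum>t\<in>{1..k}. card {c \<in> cycle_candidates n m t. cyclic \<omega> (fst c) (snd c)})"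
      using card_UN_le[of "{1..k}" "\<lambda>t. {c \<in> cycle_candidates n m t. cyclic \<omega> (fst c) (snd c)}"] by simp
    then have "real (card (short_cycles n m k \<omega>)) \<le> real (\<Sum>t\<in>{1..k}. card {c \<in> cycle_candidates n m t. cyclic \<omega> (fst c) (snd c)})"
      by (rule of_nat_mono)
    then show "real (card (short_cycles n m k \<omega>)) \<le> (\<Sum>t\<in>{1..k}. \<Sum>c\<in>cycle_candidates n m t. of_bool (cyclic \<omega> (fst c) (snd c)))"
      by (simp add: finite_cycle_candidates Collect_conj_eq)
  qed
  also have "\<dots> = (\<Sum>t\<in>{1..k}. \<Sum>c\<in>cycle_candidates n m t. \<Sum>\<omega>\<in>?\<Omega>. of_bool (cyclic \<omega> (fst c) (snd c)))"
    by (subst sum.swap, rule sum.cong[OF refl], rule sum.swap)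
  also have "\<dots> \<le> (\<Sum>t\<in>{1..k}. \<Sum>c\<in>cycle_candidates n m t. ?N * (2 / (real n)\<^sup>2) ^ t)"
  proof (rule sum_mono, rule sum_mono)
    fix t c assume "t \<in> {1..k}" "c \<in> cycle_candidates n m t"
    then show "(\<Sum>\<omega>\<in>?\<Omega>. of_bool (cyclic \<omega> (fst c) (snd c))) \<le> ?N * (2 / (real n)\<^sup>2) ^ t"
      using card_cyclic_le[of c n m t T] assms(1,2) fin\<Omega> by (simp add: Collect_conj_eq)
  qed
  also have "\<dots> \<le> (\<Sum>t\<in>{1..k}. ?N * (2 * real C) ^ t)"
  proof (rule sum_mono)
    fix t
    have "(\<Sum>c\<in>cycle_candidates n m t. ?N * (2 / (real n)\<^sup>2) ^ t) = card (cycle_candidates n m t) * (?N * (2 / (real n)\<^sup>2) ^ t)" by simp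
    also have "\<dots> \<le> real (n ^ t * m ^ t) * (?N * (2 / (real n)\<^sup>2) ^ t)"
      using card_cycle_candidates[of n m t] by (intro mult_right_mono of_nat_mono) auto
    also have "\<dots> = ?N * (2 * real C) ^ t"
    proof -
      have "(real n * real m) * (2 / (real n)\<^sup>2) = 2 * real C"
        using assms(2,4) by (simp add: power2_eq_square)
      then have "(2 * real C) ^ t = real (n ^ t * m ^ t) * (2 / (real n)\<^sup>2) ^ t"
        by (simp only: power_mult_distrib[symmetric] of_nat_power of_nat_mult)
      then show ?thesis by (simp only: mult_ac)
    qed
    finally show "(\<Sum>c\<in>cycle_candidates n m t. ?N * (2 / (real n)\<^sup>2) ^ t) \<le> ?N * (2 * real C) ^ t" .
  qed
  also have "\<dots> = ?N * (\<Sum>t\<in>{1..k}. (2 * real C) ^ t)" by (simp add: sum_distrib_left)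
  also have "\<dots> \<le> ?N * (2 * real C) ^ (k + 1)"
    using assms(3) by (intro mult_left_mono sum_power_le) auto
  finally show ?thesis .
qed

section \<open>Quasirandomness of the sample\<close>

definition zero_frac :: "nat \<Rightarrow> (nat \<Rightarrow> nat) \<Rightarrow> real" where
  "zero_frac n f = card {v. v < n \<and> f v = 0} / n"

text \<open>Tails and heads are judged by different labelings, because in the layered graph the two
  ends of an arc lie in different layers.\<close>

definition hit_pairs :: "nat \<Rightarrow> nat \<Rightarrow> (nat \<Rightarrow> nat) \<Rightarrow> (nat \<Rightarrow> nat) \<Rightarrow> (nat \<times> nat \<times> nat) set" where
  "hit_pairs n T f g = {e \<in> labelled_pairs n T. f (fst e) = 0 \<and> g (fst (snd e)) = snd (snd e)}"

lemma card_labelled_pairs: "real (card (labelled_pairs n T)) = (real n)\<^sup>2 * T"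
  by (simp add: labelled_pairs_def card_cartesian_product power2_eq_square)

text \<open>The head \<open>v\<close> determines the arc label as \<open>g v\<close>, which must be
  nonzero; hence one label for each pair of a zero of \<open>f\<close> and a nonzero of
  \<open>g\<close>.\<close>

lemma card_hit_pairs:
  assumes "n \<ge> 1" "T \<ge> 1" "\<And>v. v < n \<Longrightarrow> g v \<le> T"
  shows "real (card (hit_pairs n T f g)) = zero_frac n f * (1 - zero_frac n g) / T * card (labelled_pairs n T)"
proof -
  let ?U = "{v. v < n \<and> f v = 0}" and ?Z = "{v. v < n \<and> g v = 0}" and ?W = "{v. v < n \<and> g v \<noteq> 0}"
  have "hit_pairs n T f g = (\<lambda>(u, v). (u, v, g v)) ` (?U \<times> ?W)"
  proof (intro equalityI subsetI)
    fix e assume "e \<in> hit_pairs n T f g"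
    then show "e \<in> (\<lambda>(u, v). (u, v, g v)) ` (?U \<times> ?W)"
      by (intro image_eqI[of _ _ "(fst e, fst (snd e))"]) (auto simp: hit_pairs_def labelled_pairs_def)
  next
    fix e assume "e \<in> (\<lambda>(u, v). (u, v, g v)) ` (?U \<times> ?W)"
    then show "e \<in> hit_pairs n T f g" using assms(3) by (auto simp: hit_pairs_def labelled_pairs_def Suc_le_eq)
  qed
  then have c: "card (hit_pairs n T f g) = card ?U * card ?W"
    by (simp add: card_image inj_on_def card_cartesian_product)
  have "card (?Z \<union> ?W) = card ?Z + card ?W" by (intro card_Un_disjoint) auto
  moreover have "?Z \<union> ?W = {..<n}" by auto
  ultimately have W: "real (card ?W) = n - real (card ?Z)" by simp
  have "1 - zero_frac n g = card ?W / n" unfolding W zero_frac_def using assms(1) by (simp add: diff_divide_distrib)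
  then show ?thesis using assms(1,2)
    by (simp add: c zero_frac_def[of n f] card_labelled_pairs power2_eq_square)
qed

lemma zero_frac_bounds: "0 \<le> zero_frac n f" "zero_frac n f \<le> 1"
proof -
  have "card {v. v < n \<and> f v = 0} \<le> card {..<n}" by (intro card_mono) auto
  then show "zero_frac n f \<le> 1" by (cases "n = 0") (simp_all add: zero_frac_def)
qed (simp add: zero_frac_def)

text \<open>First-moment argument for one function \<open>Z\<close> that joins all requirements:
  \<open>Z \<omega> < 1\<close> makes every exponential less than 1, hence every deviation negative,
  and keeps the cycles below \<open>D\<close>, four times the bound on their mean. The condition
  \<open>big\<close> lets the Chernoff rate \<open>C * \<eta>\<^sup>2 / 4\<close> per vertex beat
  the \<open>(T + 1) ^ (2 * n)\<close> pairs of labelings.\<close>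

lemma sample_exists:
  fixes T n m C k :: nat and \<eta> :: real
  assumes T: "T \<ge> 1" and n: "n \<ge> 1" and C: "C \<ge> 1" and m: "m = C * n" and \<eta>: "0 < \<eta>" "\<eta> \<le> 1"
    and big: "2 * ln (T + 1) + 2 \<le> C * \<eta>\<^sup>2 / 4"
  obtains \<omega> where "\<omega> \<in> {..<m} \<rightarrow>\<^sub>E labelled_pairs n T"
    "\<And>f g. f \<in> {..<n} \<rightarrow>\<^sub>E {0..T} \<Longrightarrow> g \<in> {..<n} \<rightarrow>\<^sub>E {0..T} \<Longrightarrow>
       card {i. i < m \<and> \<omega> i \<in> hit_pairs n T f g} \<le> m * (zero_frac n f * (1 - zero_frac n g) / T + \<eta>)"
    "card (short_cycles n m k \<omega>) \<le> 4 * (2 * real C) ^ (k + 1)"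
proof -
  define \<Omega> where "\<Omega> = {..<m} \<rightarrow>\<^sub>E labelled_pairs n T"
  define G where "G = {..<n} \<rightarrow>\<^sub>E {0..T}"
  define M where "M = real (card (labelled_pairs n T)) ^ m"
  define D where "D = 4 * (2 * real C) ^ (k + 1)"
  define X where "X f g \<omega> = exp (\<eta> / 2 * (real (card {i. i < m \<and> \<omega> i \<in> hit_pairs n T f g})
      - m * (zero_frac n f * (1 - zero_frac n g) / T + \<eta>)))" for f g \<omega>
  have finE: "finite (labelled_pairs n T)" and E: "labelled_pairs n T \<noteq> {}"
    using T n by (auto simp: labelled_pairs_def lessThan_empty_iff)
  have fin: "finite \<Omega>" "finite G" unfolding \<Omega>_def G_def using finE by (auto intro!: finite_PiE)
  have card\<Omega>: "real (card \<Omega>) = M" by (simp add: \<Omega>_def M_def card_PiE)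
  have M: "0 < M" using finE E by (simp add: M_def card_gt_0_iff)
  have D: "0 < D" using C by (simp add: D_def)
  have cardG: "real (card G) = (real T + 1) ^ n" by (simp add: G_def card_PiE add.commute)
  have Xsum: "(\<Sum>\<omega>\<in>\<Omega>. X f g \<omega>) \<le> M * exp (- (m * \<eta>\<^sup>2 / 4))" if "f \<in> G" "g \<in> G" for f g
  proof -
    have g: "g v \<le> T" if "v < n" for v using PiE_mem[of g "{..<n}" "\<lambda>_. {0..T}" v] \<open>g \<in> G\<close> that by (simp add: G_def)
    show ?thesis unfolding X_def \<Omega>_def M_def
    proof (rule exp_moment_PiE[OF finE E _ _ \<eta>])
      show "hit_pairs n T f g \<subseteq> labelled_pairs n T" by (auto simp: hit_pairs_def)
      show "real (card (hit_pairs n T f g)) = zero_frac n f * (1 - zero_frac n g) / T * card (labelled_pairs n T)"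
        by (rule card_hit_pairs[OF n T g])
    qed
  qed
  define Z where "Z \<omega> = (\<Sum>f\<in>G. \<Sum>g\<in>G. X f g \<omega>) + card (short_cycles n m k \<omega>) / D" for \<omega>
  have small: "real (card G) * (card G * exp (- (m * \<eta>\<^sup>2 / 4))) \<le> 1 / 4"
  proof -
    have "real (card G) = exp (n * ln (T + 1))" unfolding cardG by (simp add: exp_of_nat_mult add.commute)
    then have "real (card G) * (card G * exp (- (m * \<eta>\<^sup>2 / 4))) = exp (n * (2 * ln (T + 1) - C * \<eta>\<^sup>2 / 4))"
      by (simp add: m exp_add[symmetric] algebra_simps)
    also have "\<dots> \<le> exp (- 2)"
    proof -
      have "n * (2 * ln (T + 1) - C * \<eta>\<^sup>2 / 4) \<le> real n * (- 2)" using big by (intro mult_left_mono) auto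
      also have "\<dots> \<le> - 2" using n by simp
      finally show ?thesis by simp
    qed
    also have "\<dots> \<le> 1 / 4"
    proof -
      have "2 \<le> exp (1::real)" using exp_ge_add_one_self[of 1] by simp
      then have "2 * 2 \<le> exp (1::real) * exp 1" by (intro mult_mono) auto
      then show ?thesis by (simp add: exp_add[symmetric] exp_minus field_simps)
    qed
    finally show ?thesis .
  qed
  have "(\<Sum>\<omega>\<in>\<Omega>. Z \<omega>) = (\<Sum>f\<in>G. \<Sum>g\<in>G. \<Sum>\<omega>\<in>\<Omega>. X f g \<omega>) + (\<Sum>\<omega>\<in>\<Omega>. real (card (short_cycles n m k \<omega>))) / D"
  proof -
    have "(\<Sum>\<omega>\<in>\<Omega>. \<Sum>f\<in>G. \<Sum>g\<in>G. X f g \<omega>) = (\<Sum>f\<in>G. \<Sum>g\<in>G. \<Sum>\<omega>\<in>\<Omega>. X f g \<omega>)"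
      by (subst sum.swap, rule sum.cong[OF refl], rule sum.swap)
    then show ?thesis by (simp add: Z_def sum.distrib sum_divide_distrib)
  qed
  also have "\<dots> \<le> (\<Sum>f\<in>G. \<Sum>g\<in>G. M * exp (- (m * \<eta>\<^sup>2 / 4))) + (M * (2 * real C) ^ (k + 1)) / D"
  proof (rule add_mono)
    show "(\<Sum>f\<in>G. \<Sum>g\<in>G. \<Sum>\<omega>\<in>\<Omega>. X f g \<omega>) \<le> (\<Sum>f\<in>G. \<Sum>g\<in>G. M * exp (- (m * \<eta>\<^sup>2 / 4)))"
      by (rule sum_mono, rule sum_mono, rule Xsum)
    show "(\<Sum>\<omega>\<in>\<Omega>. real (card (short_cycles n m k \<omega>))) / D \<le> (M * (2 * real C) ^ (k + 1)) / D"
      using sum_card_short_cycles_le[OF T n C m, of k] D unfolding \<Omega>_def M_def by (intro divide_right_mono) auto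
  qed
  also have "\<dots> = M * (real (card G) * (card G * exp (- (m * \<eta>\<^sup>2 / 4)))) + M * (1 / 4)"
    using D C by (simp add: D_def)
  also have "\<dots> \<le> M * (1 / 4) + M * (1 / 4)"
    using small M by (intro add_mono mult_left_mono) auto
  also have "\<dots> < M * 1" using M by simp
  finally have lt: "(\<Sum>\<omega>\<in>\<Omega>. Z \<omega>) < (\<Sum>\<omega>\<in>\<Omega>. 1)" by (simp add: card\<Omega>)
  obtain \<omega> where \<omega>: "\<omega> \<in> \<Omega>" "Z \<omega> < 1"
  proof (rule ccontr)
    assume "\<not> thesis"
    then have "\<And>\<omega>. \<omega> \<in> \<Omega> \<Longrightarrow> 1 \<le> Z \<omega>" using that by (meson not_le)
    then have "(\<Sum>\<omega>\<in>\<Omega>. 1) \<le> (\<Sum>\<omega>\<in>\<Omega>. Z \<omega>)" by (rule sum_mono)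
    then show False using lt by simp
  qed
  have Xpos: "0 \<le> X f g \<omega>" for f g by (simp add: X_def)
  have XX: "0 \<le> (\<Sum>f\<in>G. \<Sum>g\<in>G. X f g \<omega>)" by (intro sum_nonneg Xpos)
  show thesis
  proof (rule that)
    show "\<omega> \<in> {..<m} \<rightarrow>\<^sub>E labelled_pairs n T" using \<omega>(1) by (simp add: \<Omega>_def)
    have "card (short_cycles n m k \<omega>) / D < 1" using \<omega>(2) XX unfolding Z_def by linarith
    then show "card (short_cycles n m k \<omega>) \<le> 4 * (2 * real C) ^ (k + 1)"
      using D by (simp add: D_def)
  next
    fix f g assume "f \<in> {..<n} \<rightarrow>\<^sub>E {0..T}" "g \<in> {..<n} \<rightarrow>\<^sub>E {0..T}"
    then have fg: "f \<in> G" "g \<in> G" by (simp_all add: G_def)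
    have "X f g \<omega> \<le> (\<Sum>g\<in>G. X f g \<omega>)" using fg fin Xpos by (intro member_le_sum) auto
    also have "\<dots> \<le> (\<Sum>f\<in>G. \<Sum>g\<in>G. X f g \<omega>)"
      using fg fin Xpos by (intro member_le_sum[of f G "\<lambda>f. \<Sum>g\<in>G. X f g \<omega>"]) (auto intro: sum_nonneg)
    also have "\<dots> < 1"
    proof -
      have "0 \<le> card (short_cycles n m k \<omega>) / D" using D by simp
      then show ?thesis using \<omega>(2) unfolding Z_def by linarith
    qed
    finally have "\<eta> / 2 * (real (card {i. i < m \<and> \<omega> i \<in> hit_pairs n T f g})
      - m * (zero_frac n f * (1 - zero_frac n g) / T + \<eta>)) < 0"
      unfolding X_def by (simp only: exp_less_one_iff)
    then show "card {i. i < m \<and> \<omega> i \<in> hit_pairs n T f g} \<le> m * (zero_frac n f * (1 - zero_frac n g) / T + \<eta>)"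
      using \<eta>(1) by (simp add: mult_less_0_iff)
  qed
qed

section \<open>Deletion of short cycles\<close>

definition arc_adj :: "('v \<times> 'v) set \<Rightarrow> 'v \<Rightarrow> 'v \<Rightarrow> bool" where
  "arc_adj A u v \<longleftrightarrow> (u, v) \<in> A \<or> (v, u) \<in> A"

text \<open>Guarantees that the arc indices chosen along a cycle of the graph are distinct, as a
  candidate requires. With two vertices both positions span the same pair, whence
  \<open>3 \<le> t\<close>.\<close>

lemma cyclic_edges_distinct:
  assumes t: "3 \<le> t" and j: "j < t" "j' < t" and c: "length c = t" "distinct c"
    and J: "joins e (c ! j) (c ! (Suc j mod t))" "joins e (c ! j') (c ! (Suc j' mod t))"
  shows "j = j'"
proof -
  have nth: "c ! a = c ! b \<longleftrightarrow> a = b" if "a < t" "b < t" for a b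
    using that c by (simp add: nth_eq_iff_index_eq)
  have m: "Suc j mod t < t" "Suc j' mod t < t" using t by simp_all
  have "c ! j = c ! j' \<or> (c ! j = c ! (Suc j' mod t) \<and> c ! j' = c ! (Suc j mod t))"
    using J unfolding joins_def by (elim disjE conjE) simp_all
  then consider "j = j'" | "j = Suc j' mod t" "j' = Suc j mod t"
    unfolding nth[OF j] nth[OF j(1) m(2)] nth[OF j(2) m(1)] by blast
  then show ?thesis
  proof cases
    case 2
    have "Suc a mod t = (if Suc a = t then 0 else Suc a)" if "a < t" for a
      using that by (simp add: mod_Suc)
    note mod_t = this[OF j(1)] this[OF j(2)]
    have "Suc j' = t \<and> j = 0 \<or> j = Suc j'" using 2(1) unfolding mod_t by (simp split: if_splits)
    moreover have "Suc j = t \<and> j' = 0 \<or> j' = Suc j" using 2(2) unfolding mod_t by (simp split: if_splits)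
    ultimately show ?thesis using t by linarith
  qed
qed

text \<open>\<open>J\<close> drops the first index of every short cycle. Loops and repeated pairs
  are such cycles, so the kept arcs form a simple oriented graph and \<open>ends\<close> is
  injective on \<open>J\<close>. A longer short cycle among the kept arcs would itself be a recorded
  cycle whose first index lies in \<open>J\<close>.\<close>

lemma delete_short_cycles:
  fixes \<omega> :: "nat \<Rightarrow> nat \<times> nat \<times> nat"
  assumes \<omega>: "\<omega> \<in> {..<m} \<rightarrow>\<^sub>E labelled_pairs n T" and k: "2 \<le> k"
  obtains A lab where "A \<subseteq> {..<n} \<times> {..<n}" "lab \<in> A \<rightarrow> {1..T}" "no_short_cycle (arc_adj A) k"
    "\<And>u v. (u, v) \<in> A \<Longrightarrow> u \<noteq> v \<and> (v, u) \<notin> A"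
    "m \<le> card A + card (short_cycles n m k \<omega>)"
    "\<And>f g. card {a \<in> A. f (fst a) = 0 \<and> g (snd a) = lab a} \<le> card {i. i < m \<and> \<omega> i \<in> hit_pairs n T f g}"
proof -
  let ?B = "short_cycles n m k \<omega>"
  define J where "J = {..<m} - (\<lambda>c. hd (snd c)) ` ?B"
  define ends where "ends i = (fst (\<omega> i), fst (snd (\<omega> i)))" for i
  have \<omega>i: "fst (\<omega> i) < n" "fst (snd (\<omega> i)) < n" "snd (snd (\<omega> i)) \<in> {1..T}" if "i < m" for i
    using PiE_mem[OF \<omega>, of i] that by (auto simp: labelled_pairs_def)
  have bad: "is ! 0 \<notin> J" if "length is = t" "length w = t" "set is \<subseteq> {..<m}" "distinct is" "set w \<subseteq> {..<n}"
    "cyclic \<omega> w is" "1 \<le> t" "t \<le> k" for t w "is"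
  proof -
    have "(w, is) \<in> cycle_candidates n m t" using that(1-5) by (simp add: cycle_candidates_def)
    then have "(w, is) \<in> (\<Union>t\<in>{1..k}. cycle_candidates n m t)" using that(7,8) by (intro UN_I[of t]) simp_all
    then have "(w, is) \<in> ?B" using that(6) unfolding short_cycles_def by simp
    from imageI[OF this, of "\<lambda>c. hd (snd c)"] have "hd is \<in> (\<lambda>c. hd (snd c)) ` ?B" by simp
    moreover have "is ! 0 = hd is" using that(1,7) by (cases "is") auto
    ultimately show ?thesis unfolding J_def by simp
  qed
  have loop: "fst (\<omega> i) \<noteq> fst (snd (\<omega> i))" if "i \<in> J" for i
  proof
    assume eq: "fst (\<omega> i) = fst (snd (\<omega> i))"
    have i: "i < m" using that by (simp add: J_def)
    have "[i] ! 0 \<notin> J"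
      using eq \<omega>i[OF i] i k by (intro bad[of "[i]" 1 "[fst (\<omega> i)]"]) (auto simp: cyclic_def joins_def)
    then show False using that by simp
  qed
  have double: "i = j" if ij: "i \<in> J" "j \<in> J" and e: "joins (\<omega> j) (fst (\<omega> i)) (fst (snd (\<omega> i)))" for i j
  proof (rule ccontr)
    assume ne: "i \<noteq> j"
    have i: "i < m" "j < m" using ij by (simp_all add: J_def)
    have "cyclic \<omega> [fst (\<omega> i), fst (snd (\<omega> i))] [i, j]"
      using e unfolding cyclic_def by (auto simp: less_Suc_eq joins_def)
    then have "[i, j] ! 0 \<notin> J"
      using ne \<omega>i[OF i(1)] i k by (intro bad[of "[i, j]" 2 "[fst (\<omega> i), fst (snd (\<omega> i))]"]) auto
    then show False using ij by simp
  qed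
  have inj: "inj_on ends J"
    by (rule inj_onI, rule double) (auto simp: ends_def joins_def)
  define A where "A = ends ` J"
  define lab where "lab a = snd (snd (\<omega> (the_inv_into J ends a)))" for a
  have lab: "lab (ends i) = snd (snd (\<omega> i))" if "i \<in> J" for i
    unfolding lab_def using the_inv_into_f_f[OF inj that] by simp
  have finB: "finite ?B" unfolding short_cycles_def using finite_cycle_candidates by auto
  show thesis
  proof (rule that)
    show "A \<subseteq> {..<n} \<times> {..<n}" using \<omega>i by (auto simp: A_def ends_def J_def)
    show "lab \<in> A \<rightarrow> {1..T}"
    proof
      fix a assume "a \<in> A"
      then obtain i where "i \<in> J" "a = ends i" by (auto simp: A_def)
      then show "lab a \<in> {1..T}" using \<omega>i(3)[of i] lab by (simp add: J_def)
    qed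
    show "u \<noteq> v \<and> (v, u) \<notin> A" if uv: "(u, v) \<in> A" for u v
    proof -
      obtain i where i: "i \<in> J" "u = fst (\<omega> i)" "v = fst (snd (\<omega> i))" using uv by (auto simp: A_def ends_def)
      have "(v, u) \<notin> A"
      proof
        assume "(v, u) \<in> A"
        then obtain j where j: "j \<in> J" "v = fst (\<omega> j)" "u = fst (snd (\<omega> j))" by (auto simp: A_def ends_def)
        have "i = j" using i j by (intro double) (auto simp: joins_def)
        then show False using i j loop[OF i(1)] by simp
      qed
      then show ?thesis using loop[OF i(1)] i by simp
    qed
    show "m \<le> card A + card ?B"
    proof -
      have "card A = card J" using inj by (simp add: A_def card_image)
      moreover have "m - card ((\<lambda>c. hd (snd c)) ` ?B) \<le> card J"
        using diff_card_le_card_Diff[of "(\<lambda>c. hd (snd c)) ` ?B" "{..<m}"] finB by (simp add: J_def)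
      moreover have "card ((\<lambda>c. hd (snd c)) ` ?B) \<le> card ?B" using finB by (rule card_image_le)
      ultimately show ?thesis by simp
    qed
    show "card {a \<in> A. f (fst a) = 0 \<and> g (snd a) = lab a} \<le> card {i. i < m \<and> \<omega> i \<in> hit_pairs n T f g}" for f g
    proof -
      have "{a \<in> A. f (fst a) = 0 \<and> g (snd a) = lab a} \<subseteq> ends ` {i. i < m \<and> \<omega> i \<in> hit_pairs n T f g}"
      proof
        fix a assume a: "a \<in> {a \<in> A. f (fst a) = 0 \<and> g (snd a) = lab a}"
        then obtain i where i: "i \<in> J" "a = ends i" by (auto simp: A_def)
        have im: "i < m" using i(1) by (simp add: J_def)
        have "\<omega> i \<in> labelled_pairs n T" using PiE_mem[OF \<omega>] im by simp
        then have "\<omega> i \<in> hit_pairs n T f g" using a lab[OF i(1)] unfolding hit_pairs_def i(2)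
          by (simp add: ends_def)
        then show "a \<in> ends ` {i. i < m \<and> \<omega> i \<in> hit_pairs n T f g}" using i im by blast
      qed
      then have "card {a \<in> A. f (fst a) = 0 \<and> g (snd a) = lab a} \<le> card (ends ` {i. i < m \<and> \<omega> i \<in> hit_pairs n T f g})"
        by (intro card_mono) auto
      also have "\<dots> \<le> card {i. i < m \<and> \<omega> i \<in> hit_pairs n T f g}" by (intro card_image_le) auto
      finally show ?thesis .
    qed
    show "no_short_cycle (arc_adj A) k"
      unfolding no_short_cycle_def
    proof
      assume "\<exists>c. 3 \<le> length c \<and> length c \<le> k \<and> distinct c \<and> successively (arc_adj A) c \<and> arc_adj A (last c) (hd c)"
      then obtain c where c: "3 \<le> length c" "length c \<le> k" "distinct c" "successively (arc_adj A) c" "arc_adj A (last c) (hd c)"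
        by blast
      define t where "t = length c"
      have adj: "arc_adj A (c ! j) (c ! (Suc j mod t))" if "j < t" for j
      proof (cases "Suc j < t")
        case True
        then show ?thesis using c(4) by (simp add: successively_conv_nth t_def)
      next
        case False
        then have "Suc j = t" using that by simp
        then have "j = length c - 1" "Suc j mod t = 0" by (simp_all add: t_def[symmetric])
        moreover have "c \<noteq> []" using c(1) by auto
        ultimately show ?thesis using c(5) by (simp add: last_conv_nth hd_conv_nth)
      qed
      have "\<exists>i\<in>J. joins (\<omega> i) a b" if "arc_adj A a b" for a b
        using that unfolding arc_adj_def A_def ends_def joins_def by auto
      then have ex: "\<exists>i. i \<in> J \<and> joins (\<omega> i) (c ! j) (c ! (Suc j mod t))" if "j < t" for j using adj[OF that] by blast
      define h where "h j = (SOME i. i \<in> J \<and> joins (\<omega> i) (c ! j) (c ! (Suc j mod t)))" for j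
      have h: "h j \<in> J \<and> joins (\<omega> (h j)) (c ! j) (c ! (Suc j mod t))" if "j < t" for j
        unfolding h_def using someI_ex[OF ex[OF that]] .
      have t0: "0 < t" using c(1) by (auto simp: t_def)
      let ?is = "map h [0..<t]"
      have "h 0 \<in> J" using h[OF t0] ..
      moreover have "?is ! 0 \<notin> J"
      proof (rule bad[of _ t c])
        show "set ?is \<subseteq> {..<m}" using h by (auto simp: J_def)
        show "distinct ?is"
        proof -
          have "inj_on h {0..<t}"
          proof (rule inj_onI)
            fix j j' assume j: "j \<in> {0..<t}" "j' \<in> {0..<t}" "h j = h j'"
            have jt: "j < t" "j' < t" using j by simp_all
            have J': "joins (\<omega> (h j)) (c ! j') (c ! (Suc j' mod t))"
              unfolding j(3) using h[OF jt(2)] ..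
            show "j = j'"
              by (rule cyclic_edges_distinct[OF _ jt _ c(3) conjunct2[OF h[OF jt(1)]] J']) (use c(1) in \<open>simp_all add: t_def\<close>)
          qed
          then show ?thesis by (simp add: distinct_map)
        qed
        show "set c \<subseteq> {..<n}"
        proof
          fix x assume "x \<in> set c"
          then obtain j where j: "j < t" "x = c ! j" by (auto simp: in_set_conv_nth t_def)
          have "h j < m" using h[OF j(1)] by (simp add: J_def)
          have "joins (\<omega> (h j)) (c ! j) (c ! (Suc j mod t))" using h[OF j(1)] ..
          then have "x = fst (\<omega> (h j)) \<or> x = fst (snd (\<omega> (h j)))" unfolding joins_def j(2) by (elim disjE conjE) simp_all
          then show "x \<in> {..<n}" using \<omega>i(1,2)[OF \<open>h j < m\<close>] by auto
        qed
        show "cyclic \<omega> c ?is" using h by (simp add: cyclic_def)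
      qed (use c in \<open>simp_all add: t_def\<close>)
      moreover have "?is ! 0 = h 0" using t0 by simp
      ultimately show False by simp
    qed
  qed
qed

lemma random_instance:
  fixes T :: nat and \<eta> :: real
  assumes T: "T \<ge> 1" and \<eta>: "0 < \<eta>" "\<eta> \<le> 1"
  obtains B l0 :: nat where "B \<ge> 2"
    "\<And>l. l \<ge> l0 \<Longrightarrow> \<exists>A lab. A \<subseteq> {..<B ^ l} \<times> {..<B ^ l} \<and> A \<noteq> {} \<and> lab \<in> A \<rightarrow> {1..T} \<and>
       no_short_cycle (arc_adj A) (2 * l) \<and> (\<forall>u v. (u, v) \<in> A \<longrightarrow> u \<noteq> v \<and> (v, u) \<notin> A) \<and>
       (\<forall>f\<in>{..<B ^ l} \<rightarrow>\<^sub>E {0..T}. \<forall>g\<in>{..<B ^ l} \<rightarrow>\<^sub>E {0..T}.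
         card {a \<in> A. f (fst a) = 0 \<and> g (snd a) = lab a}
           \<le> card A * (zero_frac (B ^ l) f * (1 - zero_frac (B ^ l) g) / T + \<eta>))"
proof -
  \<comment> \<open>Deleting a fraction \<open>e\<close> of the arcs inflates relative counts by at
    most \<open>1 / (1 - e)\<close>; the margin between \<open>e\<close> and \<open>4 * e\<close>
    pays for it.\<close>
  define e where "e = \<eta> / 4"
  have e: "0 < e" "e \<le> 1" "e \<le> 1 / 4" using \<eta> by (simp_all add: e_def)
  obtain C0 :: nat where C0: "(2 * ln (T + 1) + 2) / (e\<^sup>2 / 4) < C0" using reals_Archimedean2 by blast
  define C where "C = C0 + 1"
  have C: "C \<ge> 1" by (simp add: C_def)
  have "(2 * ln (T + 1) + 2) / (e\<^sup>2 / 4) \<le> C" using C0 by (simp add: C_def)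
  then have big: "2 * ln (T + 1) + 2 \<le> C * e\<^sup>2 / 4"
    using e(1) by (simp add: pos_divide_le_eq)
  \<comment> \<open>At most \<open>8 * C * (4 * C\<^sup>2) ^ l\<close> cycles have length up to
    \<open>2 * l\<close>, and with this base \<open>m = C * 2 ^ l * (4 * C\<^sup>2) ^ l\<close>; so
    the deleted fraction is at most \<open>8 / 2 ^ l\<close>.\<close>
  define B where "B = 8 * C\<^sup>2"
  obtain l1 :: nat where l1: "8 / e < 2 ^ l1" using real_arch_pow[of 2 "8 / e"] by auto
  have B: "B \<ge> 2" 
  proof -
    have "1 \<le> C\<^sup>2" using C by simp
    then show ?thesis by (simp add: B_def)
  qed
  show thesis
  proof (rule that[OF B, of "l1 + 1"])
    fix l assume l: "l1 + 1 \<le> l"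
    define n where "n = B ^ l"
    define m where "m = C * n"
    have n: "n \<ge> 1" using B by (simp add: n_def)
    obtain \<omega> where \<omega>: "\<omega> \<in> {..<m} \<rightarrow>\<^sub>E labelled_pairs n T"
      "\<And>f g. f \<in> {..<n} \<rightarrow>\<^sub>E {0..T} \<Longrightarrow> g \<in> {..<n} \<rightarrow>\<^sub>E {0..T} \<Longrightarrow>
         card {i. i < m \<and> \<omega> i \<in> hit_pairs n T f g} \<le> m * (zero_frac n f * (1 - zero_frac n g) / T + e)"
      "card (short_cycles n m (2 * l) \<omega>) \<le> 4 * (2 * real C) ^ (2 * l + 1)"
      using sample_exists[OF T n C m_def e(1,2) big, of "2 * l"] by blast
    have "2 \<le> 2 * l" using l by simp
    from delete_short_cycles[OF \<omega>(1) this] obtain A lab where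
      A: "A \<subseteq> {..<n} \<times> {..<n}" "lab \<in> A \<rightarrow> {1..T}" "no_short_cycle (arc_adj A) (2 * l)"
        "\<And>u v. (u, v) \<in> A \<Longrightarrow> u \<noteq> v \<and> (v, u) \<notin> A"
        "m \<le> card A + card (short_cycles n m (2 * l) \<omega>)"
        "\<And>f g. card {a \<in> A. f (fst a) = 0 \<and> g (snd a) = lab a} \<le> card {i. i < m \<and> \<omega> i \<in> hit_pairs n T f g}"
      by blast
    have short: "real (card (short_cycles n m (2 * l) \<omega>)) \<le> e * m"
    proof -
      have "8 / e \<le> 2 ^ l"
      proof -
        have "(2::real) ^ l1 \<le> 2 ^ l" using l by (intro power_increasing) auto
        then show ?thesis using l1 by linarith
      qed
      then have 8: "8 \<le> e * 2 ^ l" using e(1) by (simp add: field_simps)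
      have "4 * (2 * real C) ^ (2 * l + 1) = 8 * (C * (4 * (real C)\<^sup>2) ^ l)"
        by (simp add: power_mult power_mult_distrib power2_eq_square)
      also have "\<dots> \<le> (e * 2 ^ l) * (C * (4 * (real C)\<^sup>2) ^ l)" using 8 by (intro mult_right_mono) auto
      also have "\<dots> = e * m"
      proof -
        have "(2::real) ^ l * (4 * (real C)\<^sup>2) ^ l = real B ^ l"
          unfolding power_mult_distrib[symmetric] by (simp add: B_def)
        then show ?thesis by (simp add: m_def n_def)
      qed
      finally show ?thesis using \<omega>(3) by linarith
    qed
    have cA: "(1 - e) * m \<le> card A"
    proof -
      have "real m \<le> real (card A + card (short_cycles n m (2 * l) \<omega>))" using A(5) by (rule of_nat_mono)
      then show ?thesis using short by (simp add: algebra_simps)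
    qed
    have "0 < m" using n C by (simp add: m_def)
    then have "0 < (1 - e) * m" using e by simp
    then have A0: "A \<noteq> {}" using cA by auto
    have cnt: "card {a \<in> A. f (fst a) = 0 \<and> g (snd a) = lab a} \<le> card A * (zero_frac n f * (1 - zero_frac n g) / T + \<eta>)"
      if fg: "f \<in> {..<n} \<rightarrow>\<^sub>E {0..T}" "g \<in> {..<n} \<rightarrow>\<^sub>E {0..T}" for f g
    proof -
      define p where "p = zero_frac n f * (1 - zero_frac n g) / T"
      have "zero_frac n f * (1 - zero_frac n g) \<le> 1 * 1"
        using zero_frac_bounds[of n f] zero_frac_bounds[of n g] by (intro mult_mono) auto
      then have p: "0 \<le> p" "p \<le> 1"
        using zero_frac_bounds[of n f] zero_frac_bounds[of n g] T by (simp_all add: p_def divide_le_eq_1)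
      have "real (card {a \<in> A. f (fst a) = 0 \<and> g (snd a) = lab a}) \<le> m * (p + e)"
        using \<omega>(2)[OF fg] of_nat_mono[OF A(6)[of f g], where 'a=real] unfolding p_def by linarith
      also have "\<dots> \<le> m * ((1 - e) * (p + 4 * e))"
      proof (rule mult_left_mono)
        have "e * p \<le> e * 1" "e * e \<le> e * (1/4)" using e p by (auto intro!: mult_left_mono)
        moreover have "(1 - e) * (p + 4 * e) = p + 4 * e - e * p - 4 * (e * e)" by (simp add: algebra_simps)
        ultimately show "p + e \<le> (1 - e) * (p + 4 * e)" using e(1) by linarith
      qed simp
      also have "\<dots> = ((1 - e) * m) * (p + 4 * e)" by simp
      also have "\<dots> \<le> card A * (p + 4 * e)" using cA p e by (intro mult_right_mono) auto
      finally show ?thesis by (simp add: p_def e_def)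
    qed
    show "\<exists>A lab. A \<subseteq> {..<B ^ l} \<times> {..<B ^ l} \<and> A \<noteq> {} \<and> lab \<in> A \<rightarrow> {1..T} \<and>
       no_short_cycle (arc_adj A) (2 * l) \<and> (\<forall>u v. (u, v) \<in> A \<longrightarrow> u \<noteq> v \<and> (v, u) \<notin> A) \<and>
       (\<forall>f\<in>{..<B ^ l} \<rightarrow>\<^sub>E {0..T}. \<forall>g\<in>{..<B ^ l} \<rightarrow>\<^sub>E {0..T}.
         card {a \<in> A. f (fst a) = 0 \<and> g (snd a) = lab a}
           \<le> card A * (zero_frac (B ^ l) f * (1 - zero_frac (B ^ l) g) / T + \<eta>))"
      unfolding n_def[symmetric] using A(1-4) A0 cnt by (intro exI[of _ A] exI[of _ lab] conjI) auto
  qed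
qed

section \<open>Lifting the labels\<close>

text \<open>The cyclic cover of the base graph with voltages \<open>lab\<close> in the integers
  modulo \<open>q\<close>: an edge joins the labels at the ends of an arc that go together when a
  label is propagated along it.\<close>

definition lift_adj :: "(nat \<times> nat) set \<Rightarrow> (nat \<times> nat \<Rightarrow> nat) \<Rightarrow> nat \<Rightarrow> nat \<times> nat \<Rightarrow> nat \<times> nat \<Rightarrow> bool" where
  "lift_adj A lab q x y \<longleftrightarrow> snd x < q \<and> snd y < q \<and>
     ((fst x, fst y) \<in> A \<and> snd y = (snd x + lab (fst x, fst y)) mod q \<or>
      (fst y, fst x) \<in> A \<and> snd x = (snd y + lab (fst y, fst x)) mod q)"

lemma symp_lift_adj: "symp (lift_adj A lab q)"
  by (rule sympI) (auto simp: lift_adj_def)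

lemma lift_adj_arc_adj: "lift_adj A lab q x y \<Longrightarrow> arc_adj A (fst x) (fst y)"
  by (auto simp: lift_adj_def arc_adj_def)

context
  fixes A :: "(nat \<times> nat) set" and lab :: "nat \<times> nat \<Rightarrow> nat" and q k :: nat
  assumes girth: "no_short_cycle (arc_adj A) k"
    and A: "\<And>u v. (u, v) \<in> A \<Longrightarrow> u \<noteq> v \<and> (v, u) \<notin> A"
begin

lemma successively_lift_adj: "successively (lift_adj A lab q) p \<Longrightarrow> successively (arc_adj A) (map fst p)"
  unfolding successively_map by (erule successively_mono) (rule lift_adj_arc_adj)

text \<open>Between two base vertices there is only one arc, in one direction, and translation
  modulo \<open>q\<close> is injective, so an edge has a unique lift at a given end.\<close>

lemma lift_adj_backtrack:
  assumes "lift_adj A lab q x y" "lift_adj A lab q y z" "fst x = fst z"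
  shows "x = z"
proof -
  have b: "snd x < q" "snd z < q" using assms(1,2) by (simp_all add: lift_adj_def)
  consider "(fst x, fst y) \<in> A" | "(fst y, fst x) \<in> A" using assms(1) by (auto simp: lift_adj_def)
  then have "snd x = snd z"
  proof cases
    case 1
    then have "(fst y, fst x) \<notin> A" using A by blast
    then have "(snd x + lab (fst x, fst y)) mod q = (snd z + lab (fst x, fst y)) mod q"
      using assms unfolding lift_adj_def by simp
    then show ?thesis by (rule add_mod_cancel) (fact b)+
  next
    case 2
    then have "(fst x, fst y) \<notin> A" using A by blast
    then show ?thesis using assms unfolding lift_adj_def by simp
  qed
  then show ?thesis using assms(3) by (simp add: prod_eq_iff)
qed

text \<open>Induction by dropping the first or the last vertex. If the two ends had the same
  projection, the projected path would close up: into a loop, a backtracking step, or a cycle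
  excluded by the girth.\<close>

lemma distinct_lift_path:
  assumes "successively (lift_adj A lab q) p" "distinct p" "length p \<le> k"
  shows "distinct (map fst p)"
  using assms
proof (induction "length p" arbitrary: p rule: less_induct)
  case less
  show ?case
  proof (cases "length p \<le> 1")
    case True
    then show ?thesis by (cases p) auto
  next
    case False
    then obtain x r where p: "p = x # r" "r \<noteq> []" by (cases p) auto
    define b z where "b = butlast r" "z = last r"
    have r: "r = b @ [z]" using p(2) by (simp add: b_z_def)
    have s: "successively (lift_adj A lab q) r" "successively (lift_adj A lab q) (x # b)"
      "lift_adj A lab q (last (x # b)) z"
    proof -
      show "successively (lift_adj A lab q) r" using less.prems(1) p by (auto simp: successively_Cons)
      have "successively (lift_adj A lab q) ((x # b) @ [z])" using less.prems(1) p(1) r by simp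
      then show "successively (lift_adj A lab q) (x # b)" "lift_adj A lab q (last (x # b)) z"
        unfolding successively_append_iff by simp_all
    qed
    have d: "distinct (map fst r)" "distinct (map fst (x # b))"
      using less.prems p r s by (intro less.hyps; simp)+
    have "fst x \<noteq> fst z"
    proof
      assume xz: "fst x = fst z"
      let ?c = "map fst (x # b)"
      have "successively (arc_adj A) ?c" using successively_lift_adj[OF s(2)] .
      moreover have "last ?c = fst (last (x # b))" by (rule last_map) simp
      then have "arc_adj A (last ?c) (hd ?c)" using lift_adj_arc_adj[OF s(3)] xz by simp
      moreover have "length ?c \<le> k" using less.prems(3) p(1) r by simp
      ultimately have "length ?c < 3" using girth d(2) unfolding no_short_cycle_def by (meson not_le)
      then consider "b = []" | y where "b = [y]" by (cases b rule: remdups_adj.cases) auto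
      then show False
      proof cases
        case 1
        then have "arc_adj A (fst x) (fst x)" using lift_adj_arc_adj[OF s(3)] xz by simp
        then show False using A by (auto simp: arc_adj_def)
      next
        case 2
        then have "x = z" using s(2,3) xz by (intro lift_adj_backtrack[of x y z]) simp_all
        then show False using less.prems(2) p(1) r by simp
      qed
    qed
    then show ?thesis using d p(1) r by auto
  qed
qed

lemma no_short_cycle_lift: "no_short_cycle (lift_adj A lab q) k"
  unfolding no_short_cycle_def
proof
  assume "\<exists>c. 3 \<le> length c \<and> length c \<le> k \<and> distinct c \<and> successively (lift_adj A lab q) c \<and> lift_adj A lab q (last c) (hd c)"
  then obtain c where c: "3 \<le> length c" "length c \<le> k" "distinct c" "successively (lift_adj A lab q) c"
    "lift_adj A lab q (last c) (hd c)" by blast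
  have ne: "c \<noteq> []" using c(1) by auto
  have "distinct (map fst c)" using c by (intro distinct_lift_path) auto
  moreover have "successively (arc_adj A) (map fst c)" by (rule successively_lift_adj[OF c(4)])
  moreover have "arc_adj A (last (map fst c)) (hd (map fst c))"
    using lift_adj_arc_adj[OF c(5)] ne by (simp add: last_map hd_map)
  ultimately show False using girth c(1,2) unfolding no_short_cycle_def by (metis length_map)
qed

text \<open>Supplies the uncorrelated labels that \<open>round_success\<close> requires: a short
  path between two labels of one vertex would project to a path that returns to its start.\<close>

lemma path_kernel_fibre:
  assumes "i \<noteq> j" "l \<le> k"
  shows "path_kernel (lift_adj A lab q) l \<rho> (v, i) (v, j) = 0"
proof -
  have "\<not> short_path (lift_adj A lab q) l (v, i) (v, j) p" for p
  proof
    assume p: "short_path (lift_adj A lab q) l (v, i) (v, j) p"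
    then have d: "distinct (map fst p)"
      using assms(2) by (intro distinct_lift_path) (auto simp: short_path_def is_path_def)
    obtain x r where r: "p = x # r" using p by (cases p) (auto simp: short_path_def is_path_def)
    have "r \<noteq> []" using p assms(1) r by (auto simp: short_path_def)
    then have "(v, j) \<in> set r" "x = (v, i)" using p r by (auto simp: short_path_def dest: last_in_set)
    then show False using d r by force
  qed
  then show ?thesis by (simp add: path_kernel_def)
qed

end

section \<open>Acyclic layering\<close>

text \<open>A shift by one exchanges a single boundary term at either end, which costs at most
  2.\<close>

lemma sum_shift_diff_le:
  fixes y :: "nat \<Rightarrow> real"
  assumes y: "\<And>a. \<bar>y a\<bar> \<le> 1"
  shows "(\<Sum>c<M. y (c + i)) - (\<Sum>c<M. y (c + (i + d))) \<le> 2 * real d"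
proof (induction d)
  case (Suc d)
  let ?f = "\<lambda>c. y (c + (i + d))"
  have "(\<Sum>c<M. ?f (Suc c)) - (\<Sum>c<M. ?f c) = ?f M - ?f 0"
    unfolding sum_subtractf[symmetric] by (rule sum_lessThan_telescope)
  then have "(\<Sum>c<M. ?f c) - (\<Sum>c<M. y (c + (i + Suc d))) = ?f 0 - ?f M" by simp
  also have "\<dots> \<le> 2" using y[of "0 + (i + d)"] y[of "M + (i + d)"] by linarith
  finally show ?case using Suc by simp
qed simp

lemma sum_pairs_product:
  fixes y :: "nat \<Rightarrow> real"
  shows "2 * (\<Sum>j<D. \<Sum>i<j. y i * y j) = (\<Sum>j<D. y j)\<^sup>2 - (\<Sum>j<D. (y j)\<^sup>2)"
proof (induction D)
  case (Suc D)
  have "(\<Sum>i<D. y i * y D) = (\<Sum>i<D. y i) * y D" by (simp add: sum_distrib_right)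
  then show ?case using Suc by (simp add: power2_eq_square algebra_simps)
qed simp

text \<open>With \<open>p = (1 + y) / 2\<close> the product \<open>p a * (1 - p b)\<close> is \<open>(1 + y a - y b - y a * y b) / 4\<close>. The
  antisymmetric part telescopes over the windows, and within a window the symmetric part is
  a square up to its diagonal.\<close>
lemma window_sum_le:
  fixes p :: "nat \<Rightarrow> real"
  assumes p: "\<And>a. 0 \<le> p a" "\<And>a. p a \<le> 1"
  shows "(\<Sum>c<M. \<Sum>j<D. \<Sum>i<j. p (c + i) * (1 - p (c + j)))
    \<le> (M * (\<Sum>j<D. real j) + M * real D / 2 + 2 * real D ^ 3) / 4"
proof -
  define y where "y a = 2 * p a - 1" for a
  have y: "\<bar>y a\<bar> \<le> 1" for a using p[of a] by (simp add: y_def abs_le_iff)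
  have eq: "p a * (1 - p b) = (1 + (y a - y b) - y a * y b) / 4" for a b
    by (simp add: y_def algebra_simps)
  have "(\<Sum>c<M. \<Sum>j<D. \<Sum>i<j. p (c + i) * (1 - p (c + j)))
      = ((\<Sum>c<M. \<Sum>j<D. \<Sum>i<j. 1) + (\<Sum>c<M. \<Sum>j<D. \<Sum>i<j. y (c + i) - y (c + j))
          - (\<Sum>c<M. \<Sum>j<D. \<Sum>i<j. y (c + i) * y (c + j))) / 4"
    unfolding eq sum_divide_distrib[symmetric] sum_subtractf[symmetric] sum.distrib[symmetric] ..
  moreover have "(\<Sum>c<M. \<Sum>j<D. \<Sum>i<j. (1::real)) = M * (\<Sum>j<D. real j)" by simp
  moreover have "(\<Sum>c<M. \<Sum>j<D. \<Sum>i<j. y (c + i) - y (c + j)) \<le> 2 * real D ^ 3"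
  proof -
    have "(\<Sum>c<M. \<Sum>j<D. \<Sum>i<j. y (c + i) - y (c + j)) = (\<Sum>j<D. \<Sum>i<j. \<Sum>c<M. y (c + i) - y (c + j))"
      by (subst sum.swap, rule sum.cong[OF refl], rule sum.swap)
    also have "\<dots> \<le> (\<Sum>j<D. \<Sum>i<j. 2 * real D)"
    proof (rule sum_mono, rule sum_mono)
      fix j i assume ij: "j \<in> {..<D}" "i \<in> {..<j}"
      have "(\<Sum>c<M. y (c + i)) - (\<Sum>c<M. y (c + (i + (j - i)))) \<le> 2 * real (j - i)"
        by (rule sum_shift_diff_le[OF y])
      also have "\<dots> \<le> 2 * real D" using ij by simp
      finally show "(\<Sum>c<M. y (c + i) - y (c + j)) \<le> 2 * real D" using ij by (simp add: sum_subtractf)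
    qed
    also have "\<dots> \<le> (\<Sum>j<D. \<Sum>i<D. 2 * real D)" by (intro sum_mono sum_mono2) auto
    also have "\<dots> = 2 * real D ^ 3" by (simp add: power3_eq_cube)
    finally show ?thesis .
  qed
  moreover have "- (\<Sum>c<M. \<Sum>j<D. \<Sum>i<j. y (c + i) * y (c + j)) \<le> M * real D / 2"
  proof -
    have "- (real D / 2) \<le> (\<Sum>j<D. \<Sum>i<j. y (c + i) * y (c + j))" for c
    proof -
      have "(\<Sum>j<D. (y (c + j))\<^sup>2) \<le> (\<Sum>j<D. 1)"
        using y by (intro sum_mono) (simp add: abs_square_le_1)
      moreover have "0 \<le> (\<Sum>j<D. y (c + j))\<^sup>2" by simp
      ultimately show ?thesis using sum_pairs_product[of "\<lambda>i. y (c + i)" D] by (simp only: sum_constant card_lessThan)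
    qed
    then have "(\<Sum>c<M. - (real D / 2)) \<le> (\<Sum>c<M. \<Sum>j<D. \<Sum>i<j. y (c + i) * y (c + j))" by (intro sum_mono)
    then show ?thesis by simp
  qed
  ultimately show ?thesis by simp
qed

section \<open>Layers and windows\<close>

definition windows :: "nat \<Rightarrow> nat \<Rightarrow> nat \<Rightarrow> nat \<Rightarrow> nat" where
  "windows M D a b = card {c. c < M \<and> c \<le> a \<and> b < c + D}"

definition layer_pairs :: "nat \<Rightarrow> nat \<Rightarrow> (nat \<times> nat) set" where
  "layer_pairs M D = {(a, b). a < b \<and> 0 < windows M D a b}"

lemma windows_pos_bound: "0 < windows M D a b \<Longrightarrow> b < M + D"
  unfolding windows_def by (auto simp: card_gt_0_iff)

lemma finite_layer_pairs: "finite (layer_pairs M D)"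
proof (rule finite_subset)
  show "layer_pairs M D \<subseteq> {..<M + D} \<times> {..<M + D}"
  proof
    fix z assume "z \<in> layer_pairs M D"
    then have "fst z < snd z" "snd z < M + D"
      using windows_pos_bound[of M D "fst z" "snd z"] by (auto simp: layer_pairs_def)
    then show "z \<in> {..<M + D} \<times> {..<M + D}" by (simp add: mem_Times_iff)
  qed
qed simp

text \<open>Double counting: \<open>windows M D a b\<close> is the number of windows
  \<open>{c..<c + D}\<close> with \<open>c < M\<close> that contain both layers, so a weighted sum
  over pairs is a sum over windows of unweighted pairs.\<close>

lemma sum_layer_pairs:
  fixes \<psi> :: "nat \<Rightarrow> nat \<Rightarrow> real"
  shows "(\<Sum>ab\<in>layer_pairs M D. windows M D (fst ab) (snd ab) * \<psi> (fst ab) (snd ab))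
    = (\<Sum>c<M. \<Sum>j<D. \<Sum>i<j. \<psi> (c + i) (c + j))"
proof -
  define W where "W c = {(a, b). a < b \<and> c \<le> a \<and> b < c + D}" for c :: nat
  have W: "(\<Sum>ab\<in>W c. \<psi> (fst ab) (snd ab)) = (\<Sum>j<D. \<Sum>i<j. \<psi> (c + i) (c + j))" for c
  proof -
    have "(\<Sum>j<D. \<Sum>i<j. \<psi> (c + i) (c + j)) = (\<Sum>z\<in>(SIGMA j:{..<D}. {..<j}). \<psi> (c + snd z) (c + fst z))"
      by (subst sum.Sigma) (auto simp: case_prod_beta)
    also have "\<dots> = (\<Sum>ab\<in>W c. \<psi> (fst ab) (snd ab))"
      by (rule sum.reindex_bij_witness[of _ "\<lambda>ab. (snd ab - c, fst ab - c)" "\<lambda>z. (c + snd z, c + fst z)"])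
        (auto simp: W_def)
    finally show ?thesis ..
  qed
  have finW: "finite (W c)" for c by (rule finite_subset[of _ "{..<c + D} \<times> {..<c + D}"]) (auto simp: W_def)
  have sub: "W c \<subseteq> layer_pairs M D" if "c < M" for c
    using that by (auto simp: W_def layer_pairs_def windows_def card_gt_0_iff)
  have "(\<Sum>ab\<in>layer_pairs M D. windows M D (fst ab) (snd ab) * \<psi> (fst ab) (snd ab))
    = (\<Sum>ab\<in>layer_pairs M D. \<Sum>c<M. of_bool (ab \<in> W c) * \<psi> (fst ab) (snd ab))"
  proof (rule sum.cong[OF refl])
    fix ab assume "ab \<in> layer_pairs M D"
    then have "{..<M} \<inter> {c. ab \<in> W c} = {c. c < M \<and> c \<le> fst ab \<and> snd ab < c + D}"
      by (auto simp: W_def layer_pairs_def)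
    then have "real (windows M D (fst ab) (snd ab)) = (\<Sum>c<M. of_bool (ab \<in> W c))"
      by (simp add: windows_def)
    then show "windows M D (fst ab) (snd ab) * \<psi> (fst ab) (snd ab) = (\<Sum>c<M. of_bool (ab \<in> W c) * \<psi> (fst ab) (snd ab))"
      by (simp only: sum_distrib_right)
  qed
  also have "\<dots> = (\<Sum>c<M. \<Sum>ab\<in>layer_pairs M D. of_bool (ab \<in> W c) * \<psi> (fst ab) (snd ab))"
    by (rule sum.swap)
  also have "\<dots> = (\<Sum>c<M. \<Sum>ab\<in>W c. \<psi> (fst ab) (snd ab))"
  proof (rule sum.cong[OF refl])
    fix c assume "c \<in> {..<M}"
    then have "layer_pairs M D \<inter> {ab. ab \<in> W c} = W c" using sub[of c] by auto
    then show "(\<Sum>ab\<in>layer_pairs M D. of_bool (ab \<in> W c) * \<psi> (fst ab) (snd ab)) = (\<Sum>ab\<in>W c. \<psi> (fst ab) (snd ab))"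
      by (simp only: sum_of_bool_mult_eq[OF finite_layer_pairs])
  qed
  finally show ?thesis by (simp only: W)
qed

definition layered_arc :: "nat \<Rightarrow> (nat \<times> nat) \<times> (nat \<times> nat) \<Rightarrow> nat \<times> nat" where
  "layered_arc n z = (fst (snd z) + n * fst (fst z), snd (snd z) + n * snd (fst z))"

text \<open>Number of incidences between windows and pairs of layers; it normalises the
  weights.\<close>

definition total_windows :: "nat \<Rightarrow> nat \<Rightarrow> real" where
  "total_windows M D = M * (\<Sum>j<D. real j)"

text \<open>The vertex \<open>x\<close> is the copy of the base vertex \<open>x mod n\<close> in the layer \<open>x div n\<close>. Weighting a pair
  of layers by the number of windows of \<open>D\<close> consecutive layers containing both makes the weight a
  positive kernel up to its diagonal.\<close>
definition layered :: "nat \<Rightarrow> nat \<Rightarrow> nat \<Rightarrow> (nat \<times> nat) set \<Rightarrow> (nat \<times> nat \<Rightarrow> nat) \<Rightarrow> nat gmd_instance" where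
  "layered M D n A lab =
    \<lparr> verts = {..<n * (M + D)},
      arcs = layered_arc n ` (layer_pairs M D \<times> A),
      elabel = (\<lambda>(x, y). lab (x mod n, y mod n)),
      weight = (\<lambda>(x, y). windows M D (x div n) (y div n) / (total_windows M D * card A)) \<rparr>"

context
  fixes M D n :: nat and A :: "(nat \<times> nat) set" and lab :: "nat \<times> nat \<Rightarrow> nat" and T :: nat
  assumes A: "A \<subseteq> {..<n} \<times> {..<n}" "A \<noteq> {}" "lab \<in> A \<rightarrow> {1..T}" and M: "M \<ge> 1" and D: "D \<ge> 2"
begin

lemma base_arc_less: "(u, v) \<in> A \<Longrightarrow> u < n \<and> v < n" using A(1) by auto

lemma finite_base_arcs: "finite A" by (rule finite_subset[OF A(1)]) simp

lemma layered_arc_simps: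
  assumes "z \<in> layer_pairs M D \<times> A"
  shows "fst (layered_arc n z) mod n = fst (snd z)" "snd (layered_arc n z) mod n = snd (snd z)"
    "fst (layered_arc n z) div n = fst (fst z)" "snd (layered_arc n z) div n = snd (fst z)"
proof -
  have lt: "fst (snd z) < n" "snd (snd z) < n" using assms base_arc_less[of "fst (snd z)" "snd (snd z)"] by auto
  then show "fst (layered_arc n z) mod n = fst (snd z)" "snd (layered_arc n z) mod n = snd (snd z)"
    by (simp_all add: layered_arc_def)
  show "fst (layered_arc n z) div n = fst (fst z)" "snd (layered_arc n z) div n = snd (fst z)"
    using lt by (simp_all add: layered_arc_def div_mult_self2)
qed

lemma inj_layered_arc: "inj_on (layered_arc n) (layer_pairs M D \<times> A)"
proof (rule inj_onI)
  fix z z' assume z: "z \<in> layer_pairs M D \<times> A" "z' \<in> layer_pairs M D \<times> A" "layered_arc n z = layered_arc n z'"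
  show "z = z'"
    using layered_arc_simps[OF z(1)] layered_arc_simps[OF z(2)] z(3) by (simp add: prod_eq_iff)
qed

lemma total_windows_pos: "0 < total_windows M D"
proof -
  have "real 1 \<le> (\<Sum>j<D. real j)" using D by (intro member_le_sum) auto
  then show ?thesis using M by (simp add: total_windows_def)
qed

lemma sum_layered:
  "(\<Sum>a\<in>arcs (layered M D n A lab). weight (layered M D n A lab) a * \<phi> a)
   = (\<Sum>ab\<in>layer_pairs M D. windows M D (fst ab) (snd ab) *
        ((\<Sum>e\<in>A. \<phi> (fst e + n * fst ab, snd e + n * snd ab)) / card A)) / total_windows M D"
proof -
  have "(\<Sum>a\<in>arcs (layered M D n A lab). weight (layered M D n A lab) a * \<phi> a)
    = (\<Sum>z\<in>layer_pairs M D \<times> A. windows M D (fst (fst z)) (snd (fst z)) / (total_windows M D * card A) * \<phi> (layered_arc n z))"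
    unfolding layered_def using inj_layered_arc
    by (simp add: sum.reindex case_prod_beta layered_arc_simps cong: sum.cong)
  also have "\<dots> = (\<Sum>ab\<in>layer_pairs M D. \<Sum>e\<in>A. windows M D (fst ab) (snd ab) / (total_windows M D * card A) * \<phi> (layered_arc n (ab, e)))"
    by (simp add: sum.cartesian_product case_prod_beta)
  also have "\<dots> = (\<Sum>ab\<in>layer_pairs M D. windows M D (fst ab) (snd ab) *
        ((\<Sum>e\<in>A. \<phi> (fst e + n * fst ab, snd e + n * snd ab)) / card A)) / total_windows M D"
    unfolding sum_divide_distrib sum_distrib_left
    by (intro sum.cong refl) (simp add: layered_arc_def)
  finally show ?thesis .
qed

lemma sum_layered_const:
  "(\<Sum>ab\<in>layer_pairs M D. windows M D (fst ab) (snd ab) * (\<kappa>::real)) = total_windows M D * \<kappa>"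
  using sum_layer_pairs[of M D "\<lambda>_ _. \<kappa>"]
  by (simp add: total_windows_def sum_distrib_right)

lemma layered_arc_cases:
  assumes "a \<in> arcs (layered M D n A lab)"
  obtains "fst a < n * (M + D)" "snd a < n * (M + D)" "fst a < snd a" "(fst a mod n, snd a mod n) \<in> A"
    "0 < windows M D (fst a div n) (snd a div n)"
proof -
  obtain z where z: "z \<in> layer_pairs M D \<times> A" "a = layered_arc n z"
    using assms by (auto simp: layered_def)
  obtain i j u v where ij: "z = ((i, j), (u, v))" by (rule that[of "fst (fst z)" "snd (fst z)" "fst (snd z)" "snd (snd z)"]) simp
  have uv: "(u, v) \<in> A" "u < n" "v < n" and w: "i < j" "0 < windows M D i j"
    using z(1) ij base_arc_less by (auto simp: layer_pairs_def)
  have a: "a = (u + n * i, v + n * j)" using z(2) ij by (simp add: layered_arc_def)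
  have j: "j < M + D" using windows_pos_bound w(2) .
  have b: "w + n * i' < n * (M + D)" if "w < n" "i' < M + D" for w i'
  proof -
    have "w + n * i' < n * (i' + 1)" using that(1) by simp
    also have "\<dots> \<le> n * (M + D)" using that(2) by (intro mult_le_mono2) simp
    finally show ?thesis .
  qed
  have "u + n * i < n * (i + 1)" using uv(2) by simp
  also have "\<dots> \<le> n * j" using w(1) by (intro mult_le_mono2) simp
  finally have "u + n * i < v + n * j" by simp
  then show thesis using that b[of u i] b[of v j] uv w j a by simp
qed

lemma layered_instance: "gmd_instance T (layered M D n A lab)"
  unfolding gmd_instance_def
proof (intro conjI)
  let ?I = "layered M D n A lab"
  show "finite (verts ?I)" by (simp add: layered_def)
  show "arcs ?I \<subseteq> verts ?I \<times> verts ?I"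
  proof
    fix a assume "a \<in> arcs ?I"
    then show "a \<in> verts ?I \<times> verts ?I" by (rule layered_arc_cases) (simp add: layered_def mem_Times_iff)
  qed
  show "irrefl (arcs ?I)"
  proof (rule irreflI)
    fix x show "(x, x) \<notin> arcs ?I"
    proof
      assume "(x, x) \<in> arcs ?I"
      then have "fst (x, x) < snd (x, x)" by (rule layered_arc_cases)
      then show False by simp
    qed
  qed
  show "elabel ?I \<in> arcs ?I \<rightarrow> {1..T}"
  proof
    fix a assume "a \<in> arcs ?I"
    then have "(fst a mod n, snd a mod n) \<in> A" by (rule layered_arc_cases)
    then have "lab (fst a mod n, snd a mod n) \<in> {1..T}" using A(3) by blast
    then show "elabel ?I a \<in> {1..T}" by (simp add: layered_def case_prod_beta)
  qed
  show "\<forall>a\<in>arcs ?I. 0 < weight ?I a"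
  proof
    fix a assume "a \<in> arcs ?I"
    then have "0 < windows M D (fst a div n) (snd a div n)" by (rule layered_arc_cases)
    then show "0 < weight ?I a"
      using total_windows_pos A(2) finite_base_arcs by (simp add: layered_def case_prod_beta card_gt_0_iff)
  qed
  show "(\<Sum>a\<in>arcs ?I. weight ?I a) = 1"
  proof -
    have "(\<Sum>a\<in>arcs ?I. weight ?I a * 1) = 1"
      unfolding sum_layered using A(2) finite_base_arcs total_windows_pos sum_layered_const[of 1] by simp
    then show ?thesis by simp
  qed
qed

lemma acyclic_layered: "acyclic (arcs (layered M D n A lab))"
proof (rule acyclic_subset)
  show "acyclic {(x, y :: nat). x < y}"
    using wf_acyclic[OF wf_less] .
  show "arcs (layered M D n A lab) \<subseteq> {(x, y). x < y}"
  proof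
    fix a assume "a \<in> arcs (layered M D n A lab)"
    then have "fst a < snd a" by (rule layered_arc_cases)
    then show "a \<in> {(x, y). x < y}" by (simp add: case_prod_beta)
  qed
qed

text \<open>A labeling \<open>F\<close> restricts to one labeling \<open>f a\<close> per layer. For
  a fixed pair of layers quasirandomness bounds the satisfied fraction of the base arcs by
  \<open>p a * (1 - p b) / T + \<eta>\<close>, and the window bound averages this over the
  layers.\<close>

lemma layered_opt_le:
  assumes T: "T \<ge> 1"
    and quasi: "\<And>f g. f \<in> {..<n} \<rightarrow>\<^sub>E {0..T} \<Longrightarrow> g \<in> {..<n} \<rightarrow>\<^sub>E {0..T} \<Longrightarrow>
      card {a \<in> A. f (fst a) = 0 \<and> g (snd a) = lab a} \<le> card A * (zero_frac n f * (1 - zero_frac n g) / T + \<eta>)"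
  shows "gmd_opt T (layered M D n A lab)
    \<le> (total_windows M D + M * real D / 2 + 2 * real D ^ 3) / (4 * T * total_windows M D) + \<eta>"
proof -
  let ?I = "layered M D n A lab"
  have cA: "0 < real (card A)" using A(2) finite_base_arcs by (simp add: card_gt_0_iff)
  have fin: "finite (assignments T (verts ?I))" by (simp add: assignments_def layered_def finite_PiE)
  have ne: "assignments T (verts ?I) \<noteq> {}" by (auto simp: assignments_def PiE_eq_empty_iff)
  have "gmd_value ?I F \<le> (total_windows M D + M * real D / 2 + 2 * real D ^ 3) / (4 * T * total_windows M D) + \<eta>"
    if F: "F \<in> assignments T (verts ?I)" for F
  proof -
    \<comment> \<open>Layers from \<open>M + D\<close> on get the constant label 0, which makes
      \<open>f a\<close> a legal labeling for every index.\<close>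
    define f where "f a = (\<lambda>v\<in>{..<n}. if a < M + D then F (v + n * a) else 0)" for a
    define p where "p a = zero_frac n (f a)" for a
    have f: "f a \<in> {..<n} \<rightarrow>\<^sub>E {0..T}" for a
    proof (rule PiE_I)
      fix v assume v: "v \<in> {..<n}"
      have "v + n * a \<in> verts ?I" if "a < M + D"
      proof -
        have "v + n * a < n * (a + 1)" using v by simp
        also have "\<dots> \<le> n * (M + D)" using that by (intro mult_le_mono2) simp
        finally show ?thesis by (simp add: layered_def)
      qed
      then show "f a v \<in> {0..T}" using F v PiE_mem[of F "verts ?I" "\<lambda>_. {0..T}"] by (auto simp: f_def assignments_def)
    qed (simp add: f_def)
    have "gmd_value ?I F = (\<Sum>a\<in>arcs ?I. weight ?I a * of_bool (satisfies ?I F a))"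
      unfolding gmd_value_def using finite_layer_pairs finite_base_arcs
      by (intro sum.mono_neutral_cong_left) (auto simp: layered_def)
    also have "\<dots> = (\<Sum>ab\<in>layer_pairs M D. windows M D (fst ab) (snd ab) *
        ((\<Sum>e\<in>A. of_bool (satisfies ?I F (fst e + n * fst ab, snd e + n * snd ab))) / card A)) / total_windows M D"
      by (rule sum_layered)
    also have "\<dots> \<le> (\<Sum>ab\<in>layer_pairs M D. windows M D (fst ab) (snd ab) *
        (p (fst ab) * (1 - p (snd ab)) / T + \<eta>)) / total_windows M D"
    proof (rule divide_right_mono, rule sum_mono, rule mult_left_mono)
      fix ab assume ab: "ab \<in> layer_pairs M D"
      have b: "fst ab < M + D" "snd ab < M + D"
        using ab windows_pos_bound[of M D "fst ab" "snd ab"] by (auto simp: layer_pairs_def)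
      have "{e \<in> A. satisfies ?I F (fst e + n * fst ab, snd e + n * snd ab)}
        = {a \<in> A. f (fst ab) (fst a) = 0 \<and> f (snd ab) (snd a) = lab a}"
        using base_arc_less b by (auto simp: satisfies_def layered_def f_def)
      then have "(\<Sum>e\<in>A. of_bool (satisfies ?I F (fst e + n * fst ab, snd e + n * snd ab)))
        = real (card {a \<in> A. f (fst ab) (fst a) = 0 \<and> f (snd ab) (snd a) = lab a})"
        using finite_base_arcs by (simp add: Collect_conj_eq[symmetric] Int_def)
      also have "\<dots> \<le> card A * (p (fst ab) * (1 - p (snd ab)) / T + \<eta>)"
        unfolding p_def by (rule quasi[OF f f])
      finally show "(\<Sum>e\<in>A. of_bool (satisfies ?I F (fst e + n * fst ab, snd e + n * snd ab))) / card A
        \<le> p (fst ab) * (1 - p (snd ab)) / T + \<eta>"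
        using cA by (simp add: divide_le_eq mult.commute)
    qed (use total_windows_pos in auto)
    also have "\<dots> = ((\<Sum>c<M. \<Sum>j<D. \<Sum>i<j. p (c + i) * (1 - p (c + j))) / T + total_windows M D * \<eta>) / total_windows M D"
    proof -
      have "(\<Sum>ab\<in>layer_pairs M D. windows M D (fst ab) (snd ab) * (p (fst ab) * (1 - p (snd ab)) / T + \<eta>))
        = (\<Sum>ab\<in>layer_pairs M D. windows M D (fst ab) (snd ab) * (p (fst ab) * (1 - p (snd ab)))) / T
          + (\<Sum>ab\<in>layer_pairs M D. windows M D (fst ab) (snd ab) * \<eta>)"
        unfolding sum_divide_distrib sum.distrib[symmetric] by (intro sum.cong refl) (simp add: distrib_left)
      then show ?thesis
        unfolding sum_layered_const sum_layer_pairs[of M D "\<lambda>a b. p a * (1 - p b)"] by (rule arg_cong)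
    qed
    also have "\<dots> \<le> ((total_windows M D + M * real D / 2 + 2 * real D ^ 3) / 4 / T + total_windows M D * \<eta>) / total_windows M D"
      using window_sum_le[of p, where M=M and D=D] zero_frac_bounds total_windows_pos T
      by (intro divide_right_mono add_right_mono) (auto simp: p_def total_windows_def)
    also have "\<dots> = (total_windows M D + M * real D / 2 + 2 * real D ^ 3) / (4 * T * total_windows M D) + \<eta>"
      using total_windows_pos by (simp add: add_divide_distrib)
    finally show ?thesis .
  qed
  then show ?thesis unfolding gmd_opt_def using fin ne by (intro Max.boundedI) auto
qed

end

section \<open>The integrality gap\<close>

text \<open>Correlation \<open>1 - \<nu>\<close> along the lift and a diagonal raised by
  \<open>\<nu>\<close> give variance \<open>1 + \<nu>\<close>, so \<open>V - \<rho>\<close> becomes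
  \<open>2 * \<nu>\<close>. The condition \<open>small\<close> is the cubic one for
  \<open>r * (T + 1)\<close> points. Copies of a base vertex in different layers share a label, so
  layering costs nothing here.\<close>

lemma sa_opt_layered_ge:
  fixes \<nu> t :: real and N R r l n M D T :: nat
  assumes A: "A \<subseteq> {..<n} \<times> {..<n}" "A \<noteq> {}" "lab \<in> A \<rightarrow> {1..T}" and M: "M \<ge> 1" and D: "D \<ge> 2"
    and girth: "no_short_cycle (arc_adj A) (2 * l)" and simple: "\<And>u v. (u, v) \<in> A \<Longrightarrow> u \<noteq> v \<and> (v, u) \<notin> A"
    and l: "2 \<le> l" and T: "T \<ge> 1" and r: "r \<ge> 2" and N: "N \<ge> 1" and t: "t > 0" and \<nu>: "0 < \<nu>" "\<nu> \<le> 1 / 2"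
    and small: "(real r * (real T + 1)) ^ 3 * (l * (1 - \<nu>) ^ l) \<le> \<nu>"
  shows "(1 - (1 - (1/32) ^ T) ^ R) / (real T + 1) - R * ((real T + 1) * (t + (2 / N + \<nu> / 2) / t))
    \<le> sa_opt T r (layered M D n A lab)"
proof -
  let ?I = "layered M D n A lab" and ?q = "T + 1" and ?h = "\<lambda>x. x mod n"
  define adj where "adj = lift_adj A lab ?q"
  define K where "K x y = path_kernel adj l (1 - \<nu>) x y + (if x = y then \<nu> else 0)" for x y
  have lift: "no_short_cycle adj (2 * l)" unfolding adj_def by (rule no_short_cycle_lift[OF girth simple])
  have l1: "1 \<le> l" and \<rho>: "0 \<le> 1 - \<nu>" "1 - \<nu> \<le> 1" using l \<nu> by simp_all
  have sym: "symp adj" unfolding adj_def by (rule symp_lift_adj)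
  note ctx = sym lift l1 \<rho>
  have cov: "covariance_on K (S \<times> {..<?q})" if S: "S \<subseteq> ?h ` verts ?I" "card S \<le> r" for S
    unfolding K_def
  proof -
    have "finite S" using S(1) by (rule finite_subset) (simp add: layered_def)
    then have fin: "finite (S \<times> {..<?q})" by simp
    have c: "real (card (S \<times> {..<?q})) \<le> real r * (real T + 1)"
    proof -
      have "real (card (S \<times> {..<?q})) = real (card S) * (real T + 1)"
        by (simp add: card_cartesian_product algebra_simps)
      then show ?thesis using S(2) by (simp add: mult_right_mono)
    qed
    have "real (card (S \<times> {..<?q})) * ((real (card (S \<times> {..<?q})))\<^sup>2 * l * (1 - \<nu>) ^ l)
        = real (card (S \<times> {..<?q})) ^ 3 * (l * (1 - \<nu>) ^ l)"
      by (simp add: power2_eq_square power3_eq_cube)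
    also have "\<dots> \<le> (real r * (real T + 1)) ^ 3 * (l * (1 - \<nu>) ^ l)"
      using c \<rho> by (intro mult_right_mono power_mono) auto
    finally have "real (card (S \<times> {..<?q})) * ((real (card (S \<times> {..<?q})))\<^sup>2 * l * (1 - \<nu>) ^ l) \<le> \<nu>"
      using small by simp
    then have "card (S \<times> {..<?q}) * ((card (S \<times> {..<?q}))\<^sup>2 * l * (1 - \<nu>) ^ l) \<le> \<nu>" by simp
    then show "covariance_on (\<lambda>x y. path_kernel adj l (1 - \<nu>) x y + (if x = y then \<nu> else 0)) (S \<times> {..<?q})"
      by (rule covariance_on_path_kernel[OF ctx fin])
  qed
  have arc: "(fst a mod n, snd a mod n) \<in> A" if "a \<in> arcs ?I" for a
    using that by (rule layered_arc_cases[OF A M D])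
  have "(1 - (1 - (1/32) ^ T) ^ R) / (real T + 1) - R * ((real T + 1) * (t + (2 / N + ((1 + \<nu>) - (1 - \<nu>)) / 4) / t)) \<le> sa_opt T r ?I"
  proof (rule sa_opt_ge_of_kernel[where h="?h" and K=K, OF layered_instance[OF A M D] T r N _ t cov])
    show "1 \<le> 1 + \<nu>" using \<nu> by simp
    show "K (v, i) (v, i) = 1 + \<nu>" for v i by (simp add: K_def path_kernel_self[OF ctx])
    show "K (v, i) (v, j) = 0" if "i \<noteq> j" for v i j
    proof -
      have "path_kernel adj l (1 - \<nu>) (v, i) (v, j) = 0"
        unfolding adj_def by (rule path_kernel_fibre[OF girth simple that]) auto
      then show ?thesis using that by (simp add: K_def)
    qed
    show "K (fst a mod n, i) (snd a mod n, (i + elabel ?I a) mod ?q) = 1 - \<nu>" if a: "a \<in> arcs ?I" and i: "i < ?q" for a i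
    proof -
      let ?y = "(snd a mod n, (i + elabel ?I a) mod ?q)"
      have e: "elabel ?I a = lab (fst a mod n, snd a mod n)" by (simp add: layered_def case_prod_beta)
      have "adj (fst a mod n, i) ?y" using arc[OF a] i by (simp add: adj_def lift_adj_def e)
      moreover have ne: "(fst a mod n, i) \<noteq> ?y" using simple[OF arc[OF a]] by simp
      ultimately have "path_kernel adj l (1 - \<nu>) (fst a mod n, i) ?y = 1 - \<nu>"
        by (rule path_kernel_adj[OF ctx l])
      then show ?thesis unfolding K_def if_not_P[OF ne] by simp
    qed
    show "fst a mod n \<noteq> snd a mod n" if "a \<in> arcs ?I" for a using simple[OF arc[OF that]] by simp
  qed (use \<nu> in auto)
  then show ?thesis by (simp add: add.commute)
qed

text \<open>Order of choice: \<open>R\<close> makes a vertex still waiting at the end unlikely,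
  \<open>t\<close> is small compared with \<open>e / (R + 1)\<close>, and then \<open>N\<close> and
  \<open>\<nu>\<close> push the second moment below \<open>t\<^sup>2\<close>. There is no
  circularity, since the success bound \<open>(1/32) ^ T\<close> involves none of \<open>t\<close>,
  \<open>N\<close> and \<open>\<nu>\<close>.\<close>

lemma rounding_parameters:
  fixes T :: nat and e :: real
  assumes e: "0 < e" "e < 1"
  obtains R N :: nat and t \<nu> :: real where "N \<ge> 1" "t > 0" "0 < \<nu>" "\<nu> \<le> 1 / 2"
    "(1 - e) / (real T + 1) \<le> (1 - (1 - (1/32) ^ T) ^ R) / (real T + 1) - R * ((real T + 1) * (t + (2 / N + \<nu> / 2) / t))"
proof -
  let ?q = "real T + 1"
  have "0 < (1 / 32 :: real) ^ T" "(1 / 32 :: real) ^ T \<le> 1" by (auto intro: power_le_one)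
  then obtain R where R: "(1 - (1/32) ^ T) ^ R < e / 2"
    using real_arch_pow_inv[of "e / 2" "1 - (1/32) ^ T"] e by auto
  define t where "t = e / (8 * (real R + 1) * ?q\<^sup>2)"
  have t: "0 < t" using e by (simp add: t_def add_nonneg_pos)
  obtain N :: nat where N: "4 / t\<^sup>2 < N" using reals_Archimedean2 by blast
  have N0: "0 < real N" using N t by (intro less_trans[OF _ N]) simp
  define \<nu> where "\<nu> = min (t\<^sup>2) (1 / 2)"
  have \<nu>: "0 < \<nu>" "\<nu> \<le> 1 / 2" "\<nu> \<le> t\<^sup>2" using t by (simp_all add: \<nu>_def)
  have "2 / real N \<le> t\<^sup>2 / 2" using N N0 t by (simp add: field_simps)
  then have "2 / real N + \<nu> / 2 \<le> t\<^sup>2" using \<nu>(3) by simp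
  then have "(2 / real N + \<nu> / 2) / t \<le> t" using t by (simp add: divide_le_eq power2_eq_square)
  then have "R * (?q * (t + (2 / N + \<nu> / 2) / t)) \<le> (real R + 1) * (?q * (t + t))"
    using t N0 \<nu> by (intro mult_mono add_mono) auto
  also have "\<dots> = e / 4 / ?q"
  proof -
    have "a * (b * (e / (8 * a * b\<^sup>2) + e / (8 * a * b\<^sup>2))) = e / 4 / b" if "0 < a" "0 < b" for a b
      using that by (simp add: field_simps power2_eq_square)
    from this[of "real R + 1" ?q] show ?thesis unfolding t_def by simp
  qed
  finally have 1: "R * (?q * (t + (2 / N + \<nu> / 2) / t)) \<le> e / 4 / ?q" .
  have "(1 - e) / ?q \<le> (1 - e / 2) / ?q - e / 4 / ?q"
    unfolding diff_divide_distrib[symmetric] using e by (intro divide_right_mono) auto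
  moreover have "(1 - e / 2) / ?q \<le> (1 - (1 - (1/32) ^ T) ^ R) / ?q"
    using R by (intro divide_right_mono) auto
  ultimately have "(1 - e) / ?q \<le> (1 - (1 - (1/32) ^ T) ^ R) / ?q - R * (?q * (t + (2 / N + \<nu> / 2) / t))"
    using 1 by linarith
  moreover have "N \<ge> 1" using N0 by simp
  ultimately show thesis using that t \<nu> by blast
qed

lemma sum_real_lessThan: "(\<Sum>j<D. real j) = real D * (real D - 1) / 2"
  by (induction D) (simp_all add: field_simps)

theorem theorem4:
  fixes T :: nat and \<epsilon> :: real
  assumes "T \<ge> 1" and "\<epsilon> > 0"
  shows "\<exists>\<delta>>0.
    (\<forall>N. \<exists>n\<ge>N. 2 \<le> sa_rounds \<delta> n \<and>
      (\<exists>I :: nat gmd_instance. gmd_instance T I \<and> card (verts I) = n \<and>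
         integrality_gap T (sa_rounds \<delta> n) I
           \<le> (real T + 1) / (4 * real T) * (1 + \<epsilon>))) \<and>
    (\<forall>N. \<exists>n\<ge>N. 2 \<le> sa_rounds \<delta> n \<and>
      (\<exists>I :: nat gmd_instance. gmd_instance T I \<and> card (verts I) = n \<and>
         acyclic (arcs I) \<and>
         integrality_gap T (sa_rounds \<delta> n) I
           \<le> (real T + 1) / (4 * real T) * (1 + \<epsilon>)))"
proof -
  \<comment> \<open>Layering, quasirandomness and the relaxation lose \<open>e\<close> each, and
    \<open>(1 + 2 * e) / (1 - e) \<le> 1 + 8 * e \<le> 1 + \<epsilon>\<close>.\<close>
  define e where "e = min \<epsilon> 1 / 8"
  have e: "0 < e" "e \<le> 1 / 8" "8 * e \<le> \<epsilon>" using assms(2) by (simp_all add: e_def)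
  define \<eta> where "\<eta> = e / (4 * real T)"
  have T0: "0 < real T" using assms(1) by simp
  have \<eta>: "0 < \<eta>" "\<eta> \<le> 1" using e(1,2) assms(1) by (simp_all add: \<eta>_def divide_le_eq)
  obtain D0 :: nat where D0: "2 / e < D0" using reals_Archimedean2 by blast
  define D where "D = D0 + 2"
  \<comment> \<open>With this many windows both errors of the window bound, \<open>M * D / 2\<close>
    and \<open>2 * D ^ 3\<close>, equal \<open>2 * D ^ 3\<close>, while \<open>total_windows\<close>
    is \<open>2 * D ^ 3 * (D - 1)\<close>. The relative error is \<open>2 / (D - 1)\<close>, at most
    \<open>e\<close> by the choice of \<open>D\<close>.\<close>
  define M where "M = 4 * D\<^sup>2"
  have D: "D \<ge> 2" and M: "M \<ge> 1" by (simp_all add: D_def M_def)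
  have opt_num: "(total_windows M D + M * real D / 2 + 2 * real D ^ 3) / (4 * T * total_windows M D) + \<eta> \<le> (1 + 2 * e) / (4 * T)"
  proof -
    have d: "0 < real D - 1" "0 < real D" "2 / e \<le> real D - 1" using D0 by (simp_all add: D_def)
    have de: "2 \<le> e * (real D - 1)" using d(3) e(1) by (simp add: divide_le_eq mult.commute)
    have W: "total_windows M D = 2 * real D ^ 3 * (real D - 1)"
      by (simp add: total_windows_def sum_real_lessThan M_def power2_eq_square power3_eq_cube)
    have "M * real D / 2 + 2 * real D ^ 3 = 2 * real D ^ 3 * 2"
      by (simp add: M_def power2_eq_square power3_eq_cube)
    also have "\<dots> \<le> 2 * real D ^ 3 * (e * (real D - 1))" using de by (intro mult_left_mono) auto
    also have "\<dots> = e * total_windows M D" by (simp add: W)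
    finally have "total_windows M D + M * real D / 2 + 2 * real D ^ 3 \<le> (1 + e) * total_windows M D"
      by (simp add: distrib_right)
    moreover have W0: "0 < total_windows M D" using d by (simp add: W)
    ultimately have "(total_windows M D + M * real D / 2 + 2 * real D ^ 3) / (4 * T * total_windows M D) \<le> (1 + e) * total_windows M D / (4 * T * total_windows M D)"
      by (intro divide_right_mono) auto
    also have "\<dots> = (1 + e) / (4 * T)" using W0 by simp
    finally show ?thesis by (simp add: \<eta>_def add_divide_distrib)
  qed
  have "e < 1" using e(2) by simp
  obtain R N t \<nu> where par: "N \<ge> 1" "t > 0" "0 < \<nu>" "\<nu> \<le> 1 / 2"
    "(1 - e) / (real T + 1) \<le> (1 - (1 - (1/32) ^ T) ^ R) / (real T + 1) - R * ((real T + 1) * (t + (2 / real N + \<nu> / 2) / t))"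
    by (rule rounding_parameters[OF e(1) \<open>e < 1\<close>, of T])
  obtain B l0 :: nat where B: "B \<ge> 2" and ex:
    "\<And>l. l \<ge> l0 \<Longrightarrow> \<exists>A lab. A \<subseteq> {..<B ^ l} \<times> {..<B ^ l} \<and> A \<noteq> {} \<and> lab \<in> A \<rightarrow> {1..T} \<and>
       no_short_cycle (arc_adj A) (2 * l) \<and> (\<forall>u v. (u, v) \<in> A \<longrightarrow> u \<noteq> v \<and> (v, u) \<notin> A) \<and>
       (\<forall>f\<in>{..<B ^ l} \<rightarrow>\<^sub>E {0..T}. \<forall>g\<in>{..<B ^ l} \<rightarrow>\<^sub>E {0..T}.
         card {a \<in> A. f (fst a) = 0 \<and> g (snd a) = lab a}
           \<le> card A * (zero_frac (B ^ l) f * (1 - zero_frac (B ^ l) g) / T + \<eta>))"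
    by (rule random_instance[OF assms(1) \<eta>]) (rule that)
  define \<rho> where "\<rho> = 1 - \<nu>"
  have \<rho>: "0 < \<rho>" "\<rho> < 1" using par(3,4) by (simp_all add: \<rho>_def)
  define k where "k = M + D"
  \<comment> \<open>Only the cube of the number of rounds matters. This choice makes
    \<open>(B ^ l) powr (3 * \<delta>)\<close> equal to \<open>\<rho>\<close> to the power
    \<open>- l / 2\<close>, so half of the decay of \<open>\<rho> ^ l\<close> survives and beats the
    factor \<open>l\<close>.\<close>
  define \<delta> where "\<delta> = - ln \<rho> / (6 * ln B)"
  have lnB: "0 < ln (real B)" using B by simp
  have "ln \<rho> < 0" using \<rho> by (simp add: ln_less_zero_iff)
  then have \<delta>: "0 < \<delta>" using lnB unfolding \<delta>_def by (intro divide_pos_pos) simp_all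
  have powB: "(real B ^ l) powr (3 * \<delta>) * \<rho> ^ l = sqrt \<rho> ^ l" for l
  proof -
    have "(real B ^ l) powr (3 * \<delta>) = exp (3 * \<delta> * (l * ln B))"
      using B by (simp add: powr_def ln_realpow)
    also have "\<dots> = exp (- (l * (ln \<rho> / 2)))" using lnB by (simp add: \<delta>_def)
    finally have 1: "(real B ^ l) powr (3 * \<delta>) = exp (- (l * (ln \<rho> / 2)))" .
    have "\<rho> ^ l = exp (l * ln \<rho>)" using \<rho> by (simp add: exp_of_nat_mult)
    moreover have "sqrt \<rho> ^ l = exp (l * (ln \<rho> / 2))" using \<rho> by (simp add: exp_of_nat_mult ln_sqrt[symmetric])
    ultimately show ?thesis unfolding 1 by (simp add: exp_add[symmetric])
  qed
  let ?c = "real k powr (3 * \<delta>) * (real T + 1) ^ 3"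
  have "(\<lambda>l. ?c * (real l * sqrt \<rho> ^ l)) \<longlonglongrightarrow> ?c * 0"
    using \<rho> by (intro tendsto_mult_left powser_times_n_limit_0) auto
  then have "\<forall>\<^sub>F l in sequentially. ?c * (real l * sqrt \<rho> ^ l) < \<nu>"
    using par(3) by (intro order_tendstoD(2)) auto
  then obtain l1 where l1: "\<And>l. l \<ge> l1 \<Longrightarrow> ?c * (real l * sqrt \<rho> ^ l) < \<nu>"
    by (auto simp: eventually_sequentially)
  \<comment> \<open>For \<open>l \<ge> l2\<close> this gives
    \<open>(2 ^ l) powr \<delta> \<ge> 2\<close>, hence at least two rounds.\<close>
  obtain l2 :: nat where l2: "1 / \<delta> < l2" using reals_Archimedean2 by blast
  \<comment> \<open>The acyclic instances serve both claims, with the same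
    \<open>\<delta>\<close>.\<close>
  have main: "\<exists>n\<ge>n0. 2 \<le> sa_rounds \<delta> n \<and>
      (\<exists>I :: nat gmd_instance. gmd_instance T I \<and> card (verts I) = n \<and> acyclic (arcs I) \<and>
         integrality_gap T (sa_rounds \<delta> n) I \<le> (real T + 1) / (4 * real T) * (1 + \<epsilon>))" for n0
  proof -
    define l where "l = l0 + l1 + l2 + n0 + 2"
    define n where "n = B ^ l"
    define r where "r = sa_rounds \<delta> (n * k)"
    have l: "2 \<le> l" "l0 \<le> l" "l1 \<le> l" "l2 \<le> l" "n0 \<le> l" by (simp_all add: l_def)
    have k1: "1 \<le> k" using D by (simp add: k_def)
    have two: "2 ^ l \<le> n" unfolding n_def using B by (rule power_mono) simp
    have nk: "n \<le> n * k" using k1 by simp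
    have "l < 2 ^ l" by (rule less_exp)
    then have size: "n0 \<le> n * k" using l(5) two nk by linarith
    have r2: "2 \<le> r"
    proof -
      have "1 \<le> l * \<delta>"
      proof -
        have "1 / \<delta> \<le> l" using l2 l(4) by simp
        then show ?thesis using \<delta> by (simp add: divide_le_eq)
      qed
      then have "2 powr 1 \<le> 2 powr (l * \<delta>)" by (intro powr_mono) auto
      also have "\<dots> = (2 ^ l) powr \<delta>" by (simp add: powr_powr[symmetric] powr_realpow)
      also have "\<dots> \<le> real (n * k) powr \<delta>"
      proof (rule powr_mono2)
        have "real (2 ^ l) \<le> real (n * k)" using two nk by (intro of_nat_mono) linarith
        then show "2 ^ l \<le> real (n * k)" by simp
      qed (use \<delta> in auto)
      finally have "2 \<le> real (n * k) powr \<delta>" by simp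
      then have "2 \<le> \<lfloor>real (n * k) powr \<delta>\<rfloor>" by (simp add: le_floor_iff)
      from nat_mono[OF this] show ?thesis unfolding r_def sa_rounds_def by (simp only: nat_numeral)
    qed
    have small: "(real r * (real T + 1)) ^ 3 * (l * (1 - \<nu>) ^ l) \<le> \<nu>"
    proof -
      have "real r \<le> real (n * k) powr \<delta>" by (simp add: r_def sa_rounds_def)
      then have "real r ^ 3 \<le> (real (n * k) powr \<delta>) ^ 3" by (intro power_mono) auto
      also have "\<dots> = real (n * k) powr (3 * \<delta>)"
        using k1 B by (subst powr_power) (simp_all add: n_def)
      also have "\<dots> = (real B ^ l) powr (3 * \<delta>) * real k powr (3 * \<delta>)" by (simp add: n_def powr_mult)
      finally have r3: "real r ^ 3 \<le> (real B ^ l) powr (3 * \<delta>) * real k powr (3 * \<delta>)" .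
      have "(real r * (real T + 1)) ^ 3 * (l * (1 - \<nu>) ^ l) = real r ^ 3 * ((real T + 1) ^ 3 * (l * \<rho> ^ l))"
        by (simp add: power_mult_distrib \<rho>_def mult.assoc)
      also have "\<dots> \<le> ((real B ^ l) powr (3 * \<delta>) * real k powr (3 * \<delta>)) * ((real T + 1) ^ 3 * (l * \<rho> ^ l))"
        using r3 \<rho> by (intro mult_right_mono) auto
      also have "\<dots> = ?c * (l * ((real B ^ l) powr (3 * \<delta>) * \<rho> ^ l))" by (simp only: mult_ac)
      also have "\<dots> = ?c * (real l * sqrt \<rho> ^ l)" by (simp only: powB)
      also have "\<dots> \<le> \<nu>" using l1[OF l(3)] by simp
      finally show ?thesis .
    qed
    obtain A lab where A: "A \<subseteq> {..<n} \<times> {..<n}" "A \<noteq> {}" "lab \<in> A \<rightarrow> {1..T}"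
      and girth: "no_short_cycle (arc_adj A) (2 * l)" and simple: "\<forall>u v. (u, v) \<in> A \<longrightarrow> u \<noteq> v \<and> (v, u) \<notin> A"
      and quasi: "\<forall>f\<in>{..<n} \<rightarrow>\<^sub>E {0..T}. \<forall>g\<in>{..<n} \<rightarrow>\<^sub>E {0..T}.
         card {a \<in> A. f (fst a) = 0 \<and> g (snd a) = lab a}
           \<le> card A * (zero_frac n f * (1 - zero_frac n g) / T + \<eta>)"
      using ex[OF l(2)] unfolding n_def[symmetric] by (elim exE conjE)
    let ?I = "layered M D n A lab"
    have opt: "gmd_opt T ?I \<le> (1 + 2 * e) / (4 * T)"
    proof -
      have "gmd_opt T ?I \<le> (total_windows M D + M * real D / 2 + 2 * real D ^ 3) / (4 * T * total_windows M D) + \<eta>"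
        using quasi by (intro layered_opt_le[OF A M D assms(1)]) blast
      then show ?thesis using opt_num by linarith
    qed
    have sa: "(1 - e) / (real T + 1) \<le> sa_opt T r ?I"
      using simple by (intro order_trans[OF par(5)]
        sa_opt_layered_ge[OF A M D girth _ l(1) assms(1) r2 par(1,2,3,4) small]) blast
    have "integrality_gap T r ?I \<le> (real T + 1) / (4 * real T) * (1 + \<epsilon>)"
    proof -
      have pos: "0 < (1 - e) / (real T + 1)" using e(2) by simp
      have "integrality_gap T r ?I \<le> (1 + 2 * e) / (4 * T) / sa_opt T r ?I"
        unfolding integrality_gap_def using opt sa pos by (intro divide_right_mono) auto
      also have "\<dots> \<le> (1 + 2 * e) / (4 * T) / ((1 - e) / (real T + 1))"
        using sa pos e(1) by (intro divide_left_mono mult_pos_pos) auto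
      also have "\<dots> = (real T + 1) / (4 * real T) * ((1 + 2 * e) / (1 - e))" by simp
      also have "\<dots> \<le> (real T + 1) / (4 * real T) * (1 + \<epsilon>)"
      proof (rule mult_left_mono)
        have "e * e \<le> e * (1 / 8)" using e by (intro mult_left_mono) auto
        moreover have "(1 - e) * (1 + 8 * e) = 1 + 7 * e - 8 * (e * e)" by (simp add: algebra_simps)
        ultimately have "1 + 2 * e \<le> (1 - e) * (1 + 8 * e)" using e(1) by linarith
        then have "(1 + 2 * e) / (1 - e) \<le> 1 + 8 * e" using e(2) by (simp add: divide_le_eq mult.commute)
        then show "(1 + 2 * e) / (1 - e) \<le> 1 + \<epsilon>" using e(3) by linarith
      qed simp
      finally show ?thesis .
    qed
    moreover have "card (verts ?I) = n * k" by (simp add: layered_def k_def)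
    ultimately show ?thesis
      using size r2 layered_instance[OF A M D] acyclic_layered[OF A M D] unfolding r_def by blast
  qed
  show ?thesis
  proof (intro exI[of _ \<delta>] conjI allI \<delta>)
    fix n0 :: nat
    from main[of n0] show "\<exists>n\<ge>n0. 2 \<le> sa_rounds \<delta> n \<and>
      (\<exists>I :: nat gmd_instance. gmd_instance T I \<and> card (verts I) = n \<and>
         integrality_gap T (sa_rounds \<delta> n) I \<le> (real T + 1) / (4 * real T) * (1 + \<epsilon>))" by blast
    from main[of n0] show "\<exists>n\<ge>n0. 2 \<le> sa_rounds \<delta> n \<and>
      (\<exists>I :: nat gmd_instance. gmd_instance T I \<and> card (verts I) = n \<and> acyclic (arcs I) \<and>
         integrality_gap T (sa_rounds \<delta> n) I \<le> (real T + 1) / (4 * real T) * (1 + \<epsilon>))" .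
  qed
qed

end
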